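(* Let $q\in\mathbb Z\setminus\{0\}$, let $c\in\mathbb N$, $b,d\in\mathbb Z$, and let $c_1,\ldots,c_r\in\mathbb N$. Then any sum of the form $$\sum_{n=1}^\infty \frac{\left(\frac{1}{q}\right)_n}{(n+b)^c\,(n+d)!}\,S_{c_1,c_2,\ldots,c_r}(n)$$ can be expressed in terms of cyclotomic polylogarithms at one.
   Context: $(x)_n=x(x+1)\cdots(x+n-1)$ denotes the Pochhammer symbol, and $1/(n+d)!$ is taken to be $0$ when $n+d<0$. The multiple harmonic sum is $S_{c_1,\ldots,c_r}(n)=\sum_{i_1=1}^n\frac{1}{i_1^{c_1}}\sum_{i_2=1}^{i_1}\frac{1}{i_2^{c_2}}\cdots\sum_{i_r=1}^{i_{r-1}}\frac{1}{i_r^{c_r}}$. Cyclotomic polylogarithms: for a pair $(a,b)$ with either $(a,b)=(0,0)$ or $a\in\mathbb N$, $b\in\mathbb N_0$, $b<\varphi(a)$ ($\varphi$ Euler's totient), set $f_0^0(x)=1/x$ and $f_a^b(x)=x^b/\Phi_a(x)$ otherwise, where $\Phi_a$ is the $a$-th cyclotomic polynomial. For such letters $m_i=(a_i,b_i)$ and $x\in(0,1)$ define $H(x)=1$, $H_{m_1,\ldots,m_k}(x)=\frac{1}{k!}(\log x)^k$ if all $m_i=(0,0)$, and otherwise $H_{m_1,\ldots,m_k}(x)=\int_0^x f_{a_1}^{b_1}(y)H_{m_2,\ldots,m_k}(y)\,dy$. The cyclotomic polylogarithm at one is $H_{m_1,\ldots,m_k}(1):=\lim_{x\to1}H_{m_1,\ldots,m_k}(x)$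 when this limit exists. *)

theory Defs
  imports "HOL-Analysis.Analysis" "HOL-Number_Theory.Totient"
    "HOL-Computational_Algebra.Polynomial"
begin

fun multi_harmonic :: "nat list \<Rightarrow> nat \<Rightarrow> real" where
  "multi_harmonic [] n = 1"
| "multi_harmonic (c # cs) n = (\<Sum>i = 1..n. 1 / real i ^ c * multi_harmonic cs i)"

definition inv_fact :: "int \<Rightarrow> real" where
  "inv_fact m = (if m < 0 then 0 else 1 / fact (nat m))"

text \<open>If \<open>b < 0\<close>, the summand with index \<open>n = - b\<close> has a vanishing denominator; since
  \<open>x / 0 = 0\<close>, this one summand is omitted from the series.\<close>

definition pochhammer_summand ::
    "int \<Rightarrow> nat \<Rightarrow> int \<Rightarrow> int \<Rightarrow> nat list \<Rightarrow> nat \<Rightarrow> real" where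
  "pochhammer_summand q c b d cs n =
     pochhammer (1 / of_int q) n / of_int (int n + b) ^ c * inv_fact (int n + d)
       * multi_harmonic cs n"

definition complex_cyclotomic_poly :: "nat \<Rightarrow> complex poly" where
  "complex_cyclotomic_poly n = (\<Prod>k\<in>totatives n. [:- cis (2 * pi * real k / real n), 1:])"

text \<open>The coefficients of the product over the primitive roots of unity are real, so that
  taking real parts loses nothing; see \<open>of_real_cyclotomic_poly\<close> below.\<close>

definition cyclotomic_poly :: "nat \<Rightarrow> real poly" where
  "cyclotomic_poly n = map_poly Re (complex_cyclotomic_poly n)"

lemma map_poly_cnj_mult: "map_poly cnj (p * q) = map_poly cnj p * map_poly cnj q"
  by (intro poly_eqI) (simp add: coeff_map_poly coeff_mult)

lemma map_poly_cnj_prod: "map_poly cnj (\<Prod>x\<in>A. f x) = (\<Prod>x\<in>A. map_poly cnj (f x))"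
  by (induction A rule: infinite_finite_induct) (simp_all add: map_poly_cnj_mult)

lemma cnj_complex_cyclotomic_poly:
  "map_poly cnj (complex_cyclotomic_poly n) = complex_cyclotomic_poly n"
proof (cases "n \<le> 1")
  case True
  then have "n = 0 \<or> n = 1" by auto
  then show ?thesis
    by (auto simp: complex_cyclotomic_poly_def map_poly_pCons cis_2pi)
next
  case False
  then have n: "n > 1" by simp
  have less: "k < n" if "k \<in> totatives n" for k
    using totatives_less[OF that n] .
  have refl: "n - k \<in> totatives n" if "k \<in> totatives n" for k
  proof -
    have "gcd (n - k) n = gcd k n"
      by (rule gcd_diff2_nat) (use less[OF that] in simp)
    also have "\<dots> = 1"
      using that by (simp add: in_totatives_iff)
    finally have "coprime (n - k) n"
      by (simp only: coprime_iff_gcd_eq_1)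
    then show ?thesis using less[OF that] that by (auto simp: in_totatives_iff)
  qed
  have "cis (2 * pi * real (n - k) / real n) = cnj (cis (2 * pi * real k / real n))"
    if "k \<in> totatives n" for k
  proof -
    have "2 * pi * real (n - k) / real n = 2 * pi - 2 * pi * real k / real n"
      using less[OF that] n by (simp add: field_simps of_nat_diff)
    then show ?thesis
      by (simp only:) (simp add: complex_eq_iff cos_diff sin_diff)
  qed
  then have "map_poly cnj (complex_cyclotomic_poly n) =
      (\<Prod>k\<in>totatives n. [:- cis (2 * pi * real (n - k) / real n), 1:])"
    unfolding complex_cyclotomic_poly_def map_poly_cnj_prod
    by (intro prod.cong) (auto simp: map_poly_pCons)
  also have "\<dots> = complex_cyclotomic_poly n"
    unfolding complex_cyclotomic_poly_def
    by (rule prod.reindex_bij_witness[of _ "\<lambda>k. n - k" "\<lambda>k. n - k"])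
       (use less refl in \<open>auto simp: less_imp_le\<close>)
  finally show ?thesis .
qed

lemma of_real_cyclotomic_poly:
  "map_poly of_real (cyclotomic_poly n) = complex_cyclotomic_poly n"
proof (rule poly_eqI)
  fix i
  have "cnj (coeff (complex_cyclotomic_poly n) i) = coeff (complex_cyclotomic_poly n) i"
    using arg_cong[OF cnj_complex_cyclotomic_poly, of "\<lambda>p. coeff p i" n]
    by (simp add: coeff_map_poly)
  then show "coeff (map_poly of_real (cyclotomic_poly n)) i = coeff (complex_cyclotomic_poly n) i"
    by (simp add: cyclotomic_poly_def coeff_map_poly complex_eq_iff)
qed

definition cyclotomic_letters :: "(nat \<times> nat) set" where
  "cyclotomic_letters = {(a, b). (a = 0 \<and> b = 0) \<or> (a \<ge> 1 \<and> b < totient a)}"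

definition letter_fun :: "nat \<times> nat \<Rightarrow> real \<Rightarrow> real" where
  "letter_fun m x =
     (if m = (0, 0) then 1 / x else x ^ snd m / poly (cyclotomic_poly (fst m)) x)"

fun cyclotomic_polylog :: "(nat \<times> nat) list \<Rightarrow> real \<Rightarrow> real" where
  "cyclotomic_polylog [] x = 1"
| "cyclotomic_polylog (m # ms) x =
     (if set (m # ms) = {(0, 0)} then ln x ^ length (m # ms) / fact (length (m # ms))
      else integral {0..x} (\<lambda>y. letter_fun m y * cyclotomic_polylog ms y))"

text \<open>The numbers expressible in terms of cyclotomic polylogarithms at one: the values of
  polynomial expressions with rational coefficients in those values at one that exist.
  The functions are considered on \<open>(0, 1)\<close>, hence the limit from the left.\<close>

inductive_set cyclotomic_expressible :: "real set" where
  rational: "r \<in> \<rat> \<Longrightarrow> r \<in> cyclotomic_expressible"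
| polylog_at_one: "set ms \<subseteq> cyclotomic_letters
    \<Longrightarrow> (cyclotomic_polylog ms \<longlongrightarrow> h) (at_left 1) \<Longrightarrow> h \<in> cyclotomic_expressible"
| add: "x \<in> cyclotomic_expressible \<Longrightarrow> y \<in> cyclotomic_expressible
    \<Longrightarrow> x + y \<in> cyclotomic_expressible"
| mult: "x \<in> cyclotomic_expressible \<Longrightarrow> y \<in> cyclotomic_expressible
    \<Longrightarrow> x * y \<in> cyclotomic_expressible"

end

theory Submission
  imports Defs "HOL-Computational_Algebra.Polynomial_Factorial"
    "HOL-Computational_Algebra.Field_as_Ring" "HOL-Computational_Algebra.Fundamental_Theorem_Algebra"
begin

text \<open>
  For \<open>1 \<le> p \<le> m\<close> let \<open>a\<^sub>n = (p/m)\<^sub>n / n!\<close>, the coefficients of \<open>(1 - y) powr (- p/m)\<close>, and write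
  \<open>\<mu>\<^sub>h(n)\<close> for the integral of \<open>(1 - x^m)^n h(x)\<close> over \<open>(0, 1)\<close>. By the binomial series the sum of
  \<open>a\<^sub>n \<mu>\<^sub>h(n)\<close> over \<open>n \<ge> 1\<close> is the integral of \<open>(x^(-p) - 1) h(x)\<close>. Integration by parts gives functions
  \<open>D h\<close> and \<open>E h\<close> with \<open>\<mu>\<^sub>h(n) = n \<mu>\<^sub>D\<^sub>h(n)\<close> and \<open>a\<^sub>n \<mu>\<^sub>h(n) = w\<^sub>n - w\<^sub>n\<^sub>+\<^sub>1\<close> for \<open>w\<^sub>n = n a\<^sub>n \<mu>\<^sub>E\<^sub>h(n)\<close>, so
  that Abel summation strips the outermost harmonic sum: summing \<open>a\<^sub>n S\<^sub>c\<^sub>,\<^sub>c\<^sub>s(n) \<mu>\<^sub>h(n)\<close> is the same as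
  summing \<open>a\<^sub>n S\<^sub>c\<^sub>s(n) \<mu>\<^sub>k(n)\<close> with \<open>k = D^(c-1) (E h)\<close>. Both operators only integrate against the rational
  functions \<open>x^i / (1 - x^m)\<close> with \<open>-1 \<le> i < m\<close>, which are rational combinations of cyclotomic
  letters, and the last integrand has no pole at one. This settles the factors \<open>1 / n^e\<close>.

  Telescoping \<open>n a\<^sub>n f(n) S(n)\<close> with \<open>f(n) = 1 / (n + j)^e\<close> moves the shift \<open>j\<close> by one, and partial
  fractions reduce \<open>n! / ((n + d)! (n + b)^c)\<close> to such factors. For \<open>q < -1\<close> the identity
  \<open>(1/q)\<^sub>n\<^sub>+\<^sub>1 = (1/q) (1 + 1/q)\<^sub>n\<close> leads back to a parameter \<open>p/m\<close> between zero and one; for \<open>q = -1\<close> the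
  sum is finite.
\<close>

section \<open>Cyclotomic polynomials and partial fractions\<close>

text \<open>Convergence is assumed only for the whole series. Comparison with the harmonic series
  turns it into the inequality \<open>d + int c >= order_min\<close> (for \<open>q < -1\<close> with
  \<open>d + 1\<close> in place of \<open>d\<close>), which is the decay that the partial fractions
  need.

  For \<open>p = m\<close>, that is \<open>q = 1\<close>, the coefficients do not decay. Terms of
  exponent one may then enter only through differences, and the relation that moves a shift
  \<open>j\<close> breaks down, because its factor \<open>p/m - j - 1\<close> vanishes at
  \<open>j = 0\<close>; a different telescoping sequence replaces it.

  Denominators such as \<open>n + b\<close> may vanish, so identities between summands hold only for
  large \<open>n\<close>. As all summands are rational, finitely many of them change a sum by a
  rational number; this is why every series carries the rationality of its terms.

  The kernels have poles at both ends. Iterated integrals whose innermost kernel has no pole at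
  zero, with one uniform bound at one, keep all integrals convergent, and positivity of the kernels
  gives the monotonicity and the dominating function for the limits.\<close>

lemma degree_complex_cyclotomic_poly: "degree (complex_cyclotomic_poly n) = totient n"
  unfolding complex_cyclotomic_poly_def
  by (subst degree_prod_eq_sum_degree) (auto simp: totient_def)

lemma lead_coeff_complex_cyclotomic_poly: "lead_coeff (complex_cyclotomic_poly n) = 1"
  unfolding complex_cyclotomic_poly_def by (simp add: lead_coeff_prod)

lemma poly_complex_cyclotomic_poly_eq_0_iff:
  "poly (complex_cyclotomic_poly n) z = 0 \<longleftrightarrow>
     (\<exists>k\<in>totatives n. z = cis (2 * pi * real k / real n))"
  unfolding complex_cyclotomic_poly_def by (auto simp: poly_prod)

lemma cis_eq_imp:
  assumes "cis x = cis y"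
  shows "\<exists>n::int. x = y + 2 * pi * real_of_int n"
proof -
  have "sin x = sin y \<and> cos x = cos y" using assms by (simp add: complex_eq_iff)
  then show ?thesis by (simp only: sin_cos_eq_iff)
qed

text \<open>Both fractions lie in (0, 1], so their difference, an integer, is zero, and a fraction
  in lowest terms determines its numerator and denominator. Distinct cyclotomic polynomials thus
  share no root.\<close>

lemma cis_2pi_rat_eq_imp:
  assumes "cis (2 * pi * real k / real n) = cis (2 * pi * real l / real m)"
    and "k \<in> totatives n" "l \<in> totatives m"
  shows "n = m" "k = l"
proof -
  have pos: "0 < n" "0 < m" "0 < k" "k \<le> n" "0 < l" "l \<le> m" and
       cop: "coprime k n" "coprime l m"
    using assms(2,3) by (auto simp: in_totatives_iff)
  have "\<exists>x::int. 2 * pi * real k / real n = 2 * pi * real l / real m + 2 * pi * real_of_int x"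
    using assms(1) by (intro cis_eq_imp)
  then obtain x :: int where "2 * pi * real k / real n = 2 * pi * real l / real m + 2 * pi * real_of_int x"
    by blast
  then have "2 * pi * (real k / real n - real l / real m - real_of_int x) = 0"
    by (simp add: algebra_simps)
  then have x: "real k / real n - real l / real m = of_int x"
    by simp
  have "real k / real n \<le> 1" "real l / real m \<le> 1" "real k / real n > 0" "real l / real m > 0"
    using pos by auto
  then have "\<bar>real_of_int x\<bar> < 1" using x by linarith
  then have "x = 0" by linarith
  then have "real k * real m = real l * real n"
    using x pos by (simp add: field_simps)
  then have eq: "k * m = l * n" by (metis of_nat_eq_iff of_nat_mult)
  have "n dvd k * m" unfolding eq by simp
  moreover have "m dvd l * n" unfolding eq[symmetric] by simp
  ultimately have "n dvd m" "m dvd n"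
    using cop by (simp_all add: coprime_commute coprime_dvd_mult_right_iff)
  then show "n = m" by (rule dvd_antisym)
  then show "k = l" using eq pos by simp
qed

text \<open>Both sides are monic of degree \<open>n\<close> and agree at \<open>n\<close> distinct
  points.\<close>

lemma prod_roots_unity_poly:
  assumes "n > 0"
  shows "(\<Prod>j\<in>{0<..n}. [:- cis (2 * pi * real j / real n), 1:]) = monom 1 n - 1"
proof -
  define w where "w = (\<lambda>j. cis (2 * pi * real j / real n))"
  have inj: "inj_on w {0<..n}"
  proof (rule inj_onI)
    fix i j assume ij: "i \<in> {0<..n}" "j \<in> {0<..n}" "w i = w j"
    have "\<exists>x::int. 2 * pi * real i / real n = 2 * pi * real j / real n + 2 * pi * real_of_int x"
      using ij(3) unfolding w_def by (intro cis_eq_imp)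
    then obtain x :: int where "2 * pi * real i / real n = 2 * pi * real j / real n + 2 * pi * real_of_int x"
      by blast
    then have "2 * pi * (real i / real n - real j / real n - real_of_int x) = 0"
      by (simp add: algebra_simps)
    then have x: "real i / real n - real j / real n = of_int x" by simp
    have "real i / real n \<le> 1" "real j / real n \<le> 1" "real i / real n > 0" "real j / real n > 0"
      using ij by auto
    then have "\<bar>real_of_int x\<bar> < 1" using x by linarith
    then have "x = 0" by linarith
    then show "i = j" using x assms by (simp add: field_simps)
  qed
  have root: "w j ^ n = 1" for j
    using assms by (simp add: w_def Complex.DeMoivre cis_multiple_2pi)
  let ?P = "\<Prod>j\<in>{0<..n}. [:- w j, 1:]"
  have degP: "degree ?P = n"
    by (subst degree_prod_eq_sum_degree) auto
  have degQ: "degree (monom 1 n - 1 :: complex poly) = n"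
    using assms degree_add_eq_left[of "- 1" "monom (1::complex) n"] by (simp add: degree_monom_eq)
  have "?P = monom 1 n - 1"
  proof (rule poly_eqI_degree_lead_coeff[where n = n and A = "w ` {0<..n}"])
    show "coeff ?P n = coeff (monom 1 n - 1) n"
      using degP assms lead_coeff_prod[of "\<lambda>j. [:- w j, 1:]" "{0<..n}"] by simp
    show "poly ?P z = poly (monom 1 n - 1) z" if "z \<in> w ` {0<..n}" for z
      using that by (fastforce simp: poly_prod poly_monom root)
    show "n \<le> card (w ` {0<..n})" using inj by (simp add: card_image)
  qed (use degP degQ in auto)
  then show ?thesis unfolding w_def .
qed

text \<open>The exponents up to \<open>n\<close> are grouped by their gcd with \<open>n\<close>; the
  class of \<open>d\<close> consists of the multiples by \<open>d\<close> of the totatives of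
  \<open>n div d\<close>.\<close>

lemma prod_complex_cyclotomic_poly:
  assumes "n > 0"
  shows "(\<Prod>d | d dvd n. complex_cyclotomic_poly d) = monom 1 n - 1"
proof -
  define g where "g = (\<lambda>j. [:- cis (2 * pi * real j / real n), 1:])"
  have fin: "finite {d. d dvd n}" using assms by simp
  have "monom 1 n - 1 = prod g {0<..n}"
    using prod_roots_unity_poly[OF assms] by (simp add: g_def)
  also have "\<dots> = (\<Prod>d | d dvd n. prod g {k\<in>{0<..n}. gcd k n = d})"
    by (subst prod.group) (use fin in auto)
  also have "\<dots> = (\<Prod>d | d dvd n. complex_cyclotomic_poly (n div d))"
  proof (rule prod.cong)
    fix d assume "d \<in> {d. d dvd n}"
    then have d: "d dvd n" by simp
    then have "d > 0" using assms by (auto intro: Nat.gr0I)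
    have "prod g {k\<in>{0<..n}. gcd k n = d} = (\<Prod>k\<in>totatives (n div d). g (k * d))"
      using prod.reindex_bij_betw[OF bij_betw_totatives_gcd_eq[OF d assms], of g] by simp
    also have "\<dots> = complex_cyclotomic_poly (n div d)"
      unfolding complex_cyclotomic_poly_def g_def
      using d \<open>d > 0\<close> by (intro prod.cong) (auto simp: field_simps real_of_nat_div)
    finally show "prod g {k\<in>{0<..n}. gcd k n = d} = complex_cyclotomic_poly (n div d)" .
  qed simp
  also have "\<dots> = (\<Prod>d | d dvd n. complex_cyclotomic_poly d)"
    using assms by (intro prod.reindex_bij_witness[of _ "(div) n" "(div) n"]) (auto elim: dvdE)
  finally show ?thesis by simp
qed

section \<open>Descent of the cyclotomic polynomials to rational coefficients\<close>

lemma map_poly_of_rat_mult: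
  "map_poly (of_rat :: rat \<Rightarrow> 'a::field_char_0) (p * q) = map_poly of_rat p * map_poly of_rat q"
  by (intro poly_eqI) (simp add: coeff_map_poly coeff_mult of_rat_sum of_rat_mult)

lemma map_poly_of_rat_add:
  "map_poly (of_rat :: rat \<Rightarrow> 'a::field_char_0) (p + q) = map_poly of_rat p + map_poly of_rat q"
  by (intro poly_eqI) (simp add: coeff_map_poly of_rat_add)

lemma map_poly_of_rat_diff:
  "map_poly (of_rat :: rat \<Rightarrow> 'a::field_char_0) (p - q) = map_poly of_rat p - map_poly of_rat q"
  by (intro poly_eqI) (simp add: coeff_map_poly of_rat_diff)

lemma map_poly_of_rat_prod:
  "map_poly (of_rat :: rat \<Rightarrow> 'a::field_char_0) (\<Prod>x\<in>A. f x) = (\<Prod>x\<in>A. map_poly of_rat (f x))"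
  by (induction A rule: infinite_finite_induct) (simp_all add: map_poly_of_rat_mult map_poly_1)

lemma degree_map_poly_of_rat:
  "degree (map_poly (of_rat :: rat \<Rightarrow> 'a::field_char_0) p) = degree p"
  by (intro degree_map_poly) simp

lemma map_poly_of_rat_eq_0_iff:
  "map_poly (of_rat :: rat \<Rightarrow> 'a::field_char_0) p = 0 \<longleftrightarrow> p = 0"
  by (auto simp: poly_eq_iff coeff_map_poly)

lemma map_poly_of_rat_monom_diff_1:
  "map_poly (of_rat :: rat \<Rightarrow> 'a::field_char_0) (monom 1 n - 1) = monom 1 n - 1"
  by (intro poly_eqI) (simp add: coeff_map_poly of_rat_diff)

lemma of_real_of_rat: "of_real (of_rat r) = (of_rat r :: 'a::real_field)"
  by (cases r) (simp add: of_rat_rat)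

lemma factor_eq_0_of_degree_less:
  fixes p q r :: "'a::idom poly"
  assumes "p * q = r" "r = 0 \<or> degree r < degree q" "q \<noteq> 0"
  shows "p = 0"
proof (rule ccontr)
  assume "p \<noteq> 0"
  then have "degree r = degree p + degree q" "r \<noteq> 0"
    using assms by (auto simp: degree_mult_eq simp flip: assms(1))
  then show False using assms(2) by auto
qed

text \<open>By induction the product \<open>B\<close> over the proper divisors is rational. Dividing
  \<open>X^n - 1\<close> by \<open>B\<close> over the rationals is also a division over the complex
  numbers, where it is exact; uniqueness identifies the rational quotient with the cyclotomic
  polynomial.\<close>

lemma ex_rat_complex_cyclotomic_poly:
  assumes "n > 0"
  shows "\<exists>P. map_poly of_rat P = complex_cyclotomic_poly n"
  using assms
proof (induction n rule: less_induct)
  case (less n)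
  let ?h = "map_poly (of_rat :: rat \<Rightarrow> complex)"
  let ?D = "{d. d dvd n \<and> d \<noteq> n}"
  have fin: "finite ?D" using less.prems by (auto intro: finite_subset[of _ "{d. d dvd n}"])
  have "\<forall>d\<in>?D. \<exists>P. ?h P = complex_cyclotomic_poly d"
  proof
    fix d assume "d \<in> ?D"
    then have "d dvd n" "d \<noteq> n" by auto
    then have "d < n" "d > 0"
      using less.prems dvd_imp_le[of d n] dvd_pos_nat[of n d] by simp_all
    then show "\<exists>P. ?h P = complex_cyclotomic_poly d" by (rule less.IH)
  qed
  then obtain R where R: "\<And>d. d \<in> ?D \<Longrightarrow> ?h (R d) = complex_cyclotomic_poly d"
    by metis
  define B where "B = prod R ?D"
  have hB: "?h B = prod complex_cyclotomic_poly ?D"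
    unfolding B_def map_poly_of_rat_prod by (intro prod.cong) (auto simp: R)
  have "B \<noteq> 0"
  proof -
    have "lead_coeff (?h B) = 1"
      unfolding hB by (simp add: lead_coeff_prod lead_coeff_complex_cyclotomic_poly)
    then show ?thesis by auto
  qed
  define A where "A = (monom 1 n - 1 :: rat poly)"
  have "{d. d dvd n} = insert n ?D" by auto
  then have "complex_cyclotomic_poly n * ?h B = ?h A"
    using prod_complex_cyclotomic_poly[OF less.prems] fin
    by (simp add: hB A_def map_poly_of_rat_monom_diff_1)
  also have "A = (A div B) * B + A mod B" by simp
  finally have "complex_cyclotomic_poly n * ?h B = ?h (A div B * B + A mod B)" .
  then have "(complex_cyclotomic_poly n - ?h (A div B)) * ?h B = ?h (A mod B)"
    unfolding map_poly_of_rat_mult map_poly_of_rat_add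
    by (simp add: map_poly_of_rat_mult map_poly_of_rat_add algebra_simps)
  moreover have "A mod B = 0 \<or> degree (A mod B) < degree B"
    using degree_mod_less[OF \<open>B \<noteq> 0\<close>, of A] .
  ultimately have "complex_cyclotomic_poly n - ?h (A div B) = 0"
    using \<open>B \<noteq> 0\<close>
    by (intro factor_eq_0_of_degree_less[where r = "?h (A mod B)" and q = "?h B"])
      (simp_all only: map_poly_of_rat_eq_0_iff degree_map_poly_of_rat not_False_eq_True)
  then show ?case by (metis eq_iff_diff_eq_0)
qed

text \<open>A rational preimage keeps the Bezout coefficients and remainders of the partial fraction
  decomposition rational, like the constants of \<open>cyclotomic_expressible\<close>.\<close>

definition rat_cyclotomic_poly :: "nat \<Rightarrow> rat poly" where
  "rat_cyclotomic_poly n = (SOME P. map_poly of_rat P = complex_cyclotomic_poly n)"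

lemma complex_rat_cyclotomic_poly:
  assumes "n > 0"
  shows "map_poly of_rat (rat_cyclotomic_poly n) = complex_cyclotomic_poly n"
  unfolding rat_cyclotomic_poly_def using someI_ex[OF ex_rat_complex_cyclotomic_poly[OF assms]] .

lemma real_rat_cyclotomic_poly:
  assumes "n > 0"
  shows "map_poly of_rat (rat_cyclotomic_poly n) = cyclotomic_poly n"
proof (rule poly_eqI)
  fix i
  have "coeff (cyclotomic_poly n) i = Re (coeff (complex_cyclotomic_poly n) i)"
    by (simp add: cyclotomic_poly_def coeff_map_poly)
  also have "\<dots> = Re (of_real (of_rat (coeff (rat_cyclotomic_poly n) i)))"
    using of_real_of_rat[of "coeff (rat_cyclotomic_poly n) i", where 'a = complex]
    by (simp flip: complex_rat_cyclotomic_poly[OF assms] add: coeff_map_poly)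
  finally show "coeff (map_poly of_rat (rat_cyclotomic_poly n)) i = coeff (cyclotomic_poly n) i"
    by (simp add: coeff_map_poly)
qed

lemma degree_rat_cyclotomic_poly: "n > 0 \<Longrightarrow> degree (rat_cyclotomic_poly n) = totient n"
  using degree_map_poly_of_rat[of "rat_cyclotomic_poly n", where 'a = complex]
  by (simp only: complex_rat_cyclotomic_poly degree_complex_cyclotomic_poly)

lemma rat_cyclotomic_poly_nonzero:
  assumes "n > 0"
  shows "rat_cyclotomic_poly n \<noteq> 0"
proof
  assume "rat_cyclotomic_poly n = 0"
  then have "complex_cyclotomic_poly n = 0"
    using complex_rat_cyclotomic_poly[OF assms] by simp
  then show False using lead_coeff_complex_cyclotomic_poly[of n] by simp
qed

lemma prod_rat_cyclotomic_poly:
  assumes "n > 0"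
  shows "(\<Prod>d | d dvd n. rat_cyclotomic_poly d) = monom 1 n - 1"
proof -
  have "map_poly (of_rat :: rat \<Rightarrow> complex)
      ((\<Prod>d | d dvd n. rat_cyclotomic_poly d) - (monom 1 n - 1)) =
      (\<Prod>d | d dvd n. complex_cyclotomic_poly d) - (monom 1 n - 1)"
    unfolding map_poly_of_rat_diff[of _ "monom 1 n - 1"] map_poly_of_rat_monom_diff_1
      map_poly_of_rat_prod
    using assms by (intro arg_cong2[where f = minus] prod.cong refl complex_rat_cyclotomic_poly)
      (auto intro: Nat.gr0I)
  also have "\<dots> = 0" using prod_complex_cyclotomic_poly[OF assms] by simp
  finally show ?thesis by (simp only: map_poly_of_rat_eq_0_iff eq_iff_diff_eq_0[symmetric])
qed

text \<open>A common divisor of positive degree would have a complex root, which would be primitive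
  of two different orders.\<close>

lemma coprime_rat_cyclotomic_poly:
  assumes "a > 0" "b > 0" "a \<noteq> b"
  shows "coprime (rat_cyclotomic_poly a) (rat_cyclotomic_poly b)"
proof (rule coprimeI)
  fix g assume g: "g dvd rat_cyclotomic_poly a" "g dvd rat_cyclotomic_poly b"
  let ?h = "map_poly (of_rat :: rat \<Rightarrow> complex)"
  have dvd: "?h g dvd complex_cyclotomic_poly a" "?h g dvd complex_cyclotomic_poly b"
    using g assms by (metis complex_rat_cyclotomic_poly dvd_def map_poly_of_rat_mult)+
  have "degree g = 0"
  proof (rule ccontr)
    assume "degree g \<noteq> 0"
    then have "\<not> constant (poly (?h g))"
      by (simp add: constant_degree degree_map_poly_of_rat)
    then obtain z where "poly (?h g) z = 0"
      using fundamental_theorem_of_algebra by blast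
    then have "poly (complex_cyclotomic_poly a) z = 0" "poly (complex_cyclotomic_poly b) z = 0"
      using dvd by (auto elim: dvdE)
    then show False
      using assms cis_2pi_rat_eq_imp(1) unfolding poly_complex_cyclotomic_poly_eq_0_iff by blast
  qed
  moreover have "g \<noteq> 0" using g rat_cyclotomic_poly_nonzero assms by auto
  ultimately show "is_unit g" by (simp add: is_unit_iff_degree)
qed

text \<open>Bezout's identity peels off one factor at a time. Everything is written over the common
  denominator, so that the argument stays inside the polynomial ring.\<close>

lemma partial_fractions_coprime:
  fixes f :: "'b \<Rightarrow> rat poly"
  assumes "finite A" "\<And>a. a \<in> A \<Longrightarrow> f a \<noteq> 0"
    and "\<And>a b. a \<in> A \<Longrightarrow> b \<in> A \<Longrightarrow> a \<noteq> b \<Longrightarrow> coprime (f a) (f b)"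
    and "P = 0 \<or> degree P < (\<Sum>a\<in>A. degree (f a))"
  shows "\<exists>N. (\<forall>a\<in>A. N a = 0 \<or> degree (N a) < degree (f a)) \<and>
     P = (\<Sum>a\<in>A. N a * prod f (A - {a}))"
  using assms
proof (induction A arbitrary: P rule: finite_induct)
  case empty
  then show ?case by auto
next
  case (insert a A)
  define F G where "F = f a" and "G = prod f A"
  have F0: "F \<noteq> 0" and G0: "G \<noteq> 0" using insert by (auto simp: F_def G_def)
  have "coprime F G" unfolding F_def G_def
    by (rule prod_coprime_right) (use insert.hyps insert.prems(2) in auto)
  then obtain s t where st: "s * F + t * G = 1"
    using bezout_coefficients_fst_snd[of F G] by (auto simp: coprime_iff_gcd_eq_1)
  \<comment> \<open>The numerator belonging to \<open>F\<close> is reduced modulo \<open>F\<close>;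
    the quotient moves into \<open>M\<close>.\<close>
  define N where "N = (P * t) mod F"
  define M where "M = P * s + ((P * t) div F) * G"
  have P: "P = M * F + N * G"
  proof -
    have "P = P * (s * F + t * G)" using st by simp
    also have "\<dots> = P * s * F + ((P * t) div F * F + N) * G"
      unfolding N_def div_mult_mod_eq by (simp add: algebra_simps)
    finally show ?thesis by (simp add: M_def algebra_simps)
  qed
  have N: "N = 0 \<or> degree N < degree F" unfolding N_def using degree_mod_less[OF F0] .
  have degG: "degree G = (\<Sum>a\<in>A. degree (f a))"
    unfolding G_def using insert by (subst degree_prod_eq_sum_degree) auto
  \<comment> \<open>Otherwise \<open>M * F\<close> would dominate \<open>N * G\<close>, and
    \<open>P\<close> would exceed its degree bound.\<close>
  have "M = 0 \<or> degree M < degree G"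
  proof (rule ccontr)
    assume "\<not> ?thesis"
    then have M: "M \<noteq> 0" "degree M \<ge> degree G" by auto
    have 1: "degree (M * F) = degree M + degree F" using M F0 by (simp add: degree_mult_eq)
    have 2: "N * G = 0 \<or> degree (N * G) < degree (M * F)"
      using N
    proof
      assume "degree N < degree F"
      then have "degree (N * G) < degree M + degree F"
        using degree_mult_le[of N G] M(2) by linarith
      then show ?thesis using 1 by simp
    qed simp
    have "degree P = degree (M * F)"
      using 2 unfolding P by (elim disjE) (simp_all only: degree_add_eq_left add_0_right)
    moreover have "P \<noteq> 0"
    proof
      assume "P = 0"
      then have "M * F = - (N * G)" using P by (simp add: eq_neg_iff_add_eq_0)
      then have "degree (M * F) = degree (N * G)" "N * G \<noteq> 0"
        using M F0 by (simp_all only: degree_minus) auto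
      then show False using 2 by simp
    qed
    ultimately show False
      using insert.prems(3) insert.hyps M 1 degG by (simp add: F_def)
  qed
  then obtain N' where N': "\<forall>a\<in>A. N' a = 0 \<or> degree (N' a) < degree (f a)"
      "M = (\<Sum>a\<in>A. N' a * prod f (A - {a}))"
    using insert.IH[of M] insert.prems degG by auto
  define N'' where "N'' = N'(a := N)"
  have "(\<Sum>b\<in>insert a A. N'' b * prod f (insert a A - {b})) =
      N * G + (\<Sum>b\<in>A. N'' b * prod f (insert a A - {b}))"
    using insert.hyps by (simp add: N''_def G_def)
  also have "(\<Sum>b\<in>A. N'' b * prod f (insert a A - {b})) = (\<Sum>b\<in>A. (N' b * prod f (A - {b})) * F)"
  proof (rule sum.cong)
    fix b assume "b \<in> A"
    then have "b \<noteq> a" "insert a A - {b} = insert a (A - {b})" using insert.hyps by auto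
    then show "N'' b * prod f (insert a A - {b}) = (N' b * prod f (A - {b})) * F"
      using insert.hyps by (simp add: N''_def F_def algebra_simps)
  qed simp
  also have "N * G + \<dots> = P" using P N'(2) by (simp add: sum_distrib_right)
  finally show ?case using N N' by (intro exI[of _ N'']) (auto simp: N''_def F_def)
qed

text \<open>Roots of unity have modulus one. Letters other than \<open>1 / x\<close> are therefore
  regular on [0, 1), and only index one has a pole at one.\<close>

lemma cyclotomic_poly_real_root:
  assumes "poly (cyclotomic_poly n) x = 0"
  shows "\<bar>x\<bar> = 1" "x = 1 \<Longrightarrow> n = 1"
proof -
  have "poly (complex_cyclotomic_poly n) (of_real x) = of_real (poly (cyclotomic_poly n) x)"
    unfolding of_real_cyclotomic_poly[symmetric]
    by (simp add: poly_altdef coeff_map_poly degree_map_poly)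
  then obtain k where k: "of_real x = cis (2 * pi * real k / real n)" "k \<in> totatives n"
    using assms by (auto simp: poly_complex_cyclotomic_poly_eq_0_iff)
  have "norm (of_real x :: complex) = 1" unfolding k(1) by simp
  then show "\<bar>x\<bar> = 1" by simp
  assume "x = 1"
  then have "cis (2 * pi * real k / real n) = cis (2 * pi * real 1 / real 1)"
    using k by (simp add: complex_eq_iff)
  then show "n = 1" using k by (intro cis_2pi_rat_eq_imp(1)) auto
qed

lemma cyclotomic_poly_nonzero_Ioo:
  assumes "0 < x" "x < 1"
  shows "poly (cyclotomic_poly n) x \<noteq> 0"
  using cyclotomic_poly_real_root(1)[of n x] assms by auto

lemma cyclotomic_poly_nonzero_Icc:
  assumes "0 \<le> x" "x \<le> 1" "n \<noteq> 1"
  shows "poly (cyclotomic_poly n) x \<noteq> 0"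
  using cyclotomic_poly_real_root[of n x] assms by auto

lemma poly_map_of_rat_sum:
  "poly (map_poly of_rat p) x = (\<Sum>i\<le>degree p. of_rat (coeff p i) * x ^ i)"
  for x :: "'a::field_char_0"
  by (simp add: poly_altdef degree_map_poly_of_rat coeff_map_poly)

text \<open>The constant in front of the letter \<open>(1, 0)\<close>, the only one with a pole at one, is zero as
  soon as the numerator vanishes there: cancel the factor \<open>x - 1\<close> before decomposing.\<close>

lemma partial_fractions_cyclotomic:
  fixes P :: "rat poly"
  assumes "m > 0" "degree P < m"
  obtains c :: "nat \<times> nat \<Rightarrow> rat"
  where "\<forall>x::real. 0 < x \<longrightarrow> x < 1 \<longrightarrow> poly (map_poly of_rat P) x / (1 - x ^ m) =
       (\<Sum>a | a dvd m. \<Sum>b<totient a. of_rat (c (a, b)) * letter_fun (a, b) x)"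
    and "poly P 1 = 0 \<longrightarrow> c (1, 0) = 0"
proof -
  let ?r = "rat_cyclotomic_poly"
  have fin: "finite {a. a dvd m}" using assms by simp
  have pos: "a > 0" if "a dvd m" for a using that assms by (auto intro: Nat.gr0I)
  define D where "D = (if poly P 1 = 0 then {a. a dvd m} - {1} else {a. a dvd m})"
  have D: "finite D" "D \<subseteq> {a. a dvd m}" using fin by (auto simp: D_def)
  have mono: "monom 1 m - 1 = prod ?r {a. a dvd m}"
    using prod_rat_cyclotomic_poly[OF assms(1)] by simp
  have r1: "?r 1 = [:-1, 1:]"
  proof -
    have "(\<Prod>d | d dvd (1::nat). ?r d) = monom 1 1 - 1"
      by (rule prod_rat_cyclotomic_poly) simp
    moreover have "{d. d dvd (1::nat)} = {1}" by auto
    ultimately show ?thesis by (simp add: monom_Suc one_pCons)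
  qed
  obtain Q where Q: "Q = 0 \<or> degree Q < (\<Sum>a\<in>D. degree (?r a))"
    and PQ: "P * prod ?r D = Q * (monom 1 m - 1)"
  proof (cases "poly P 1 = 0")
    case True
    then obtain Q where Q: "P = [:-1, 1:] * Q" by (auto simp: poly_eq_0_iff_dvd elim: dvdE)
    have "{a. a dvd m} = insert 1 D" "1 \<notin> D" using True by (auto simp: D_def)
    then have 1: "prod ?r {a. a dvd m} = [:-1, 1:] * prod ?r D"
      and 2: "(\<Sum>a | a dvd m. totient a) = 1 + (\<Sum>a\<in>D. totient a)"
      using D r1 by (simp_all del: mult_pCons_left)
    have 3: "(\<Sum>a\<in>D. degree (?r a)) = (\<Sum>a\<in>D. totient a)"
      using D pos by (intro sum.cong) (auto simp: degree_rat_cyclotomic_poly)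
    show ?thesis
    proof (rule that[of Q])
      show "Q = 0 \<or> degree Q < (\<Sum>a\<in>D. degree (?r a))"
      proof (cases "Q = 0")
        case False
        then have "degree P = 1 + degree Q" unfolding Q by (subst degree_mult_eq) auto
        then show ?thesis using assms 2 3 totient_divisor_sum[of m] by simp
      qed simp
      show "P * prod ?r D = Q * (monom 1 m - 1)"
        unfolding mono 1 Q by (simp only: ac_simps)
    qed
  next
    case False
    have "(\<Sum>a\<in>D. degree (?r a)) = (\<Sum>a | a dvd m. totient a)"
      using False D pos unfolding D_def by (intro sum.cong) (auto simp: degree_rat_cyclotomic_poly)
    then show ?thesis using assms totient_divisor_sum[of m] mono False
      by (intro that[of P]) (auto simp: D_def)
  qed
  have "\<exists>N. (\<forall>a\<in>D. N a = 0 \<or> degree (N a) < degree (?r a)) \<and>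
     Q = (\<Sum>a\<in>D. N a * prod ?r (D - {a}))"
  proof (rule partial_fractions_coprime[OF D(1) _ _ Q])
    show "?r a \<noteq> 0" if "a \<in> D" for a
      using that D(2) pos by (intro rat_cyclotomic_poly_nonzero) auto
    show "coprime (?r a) (?r b)" if "a \<in> D" "b \<in> D" "a \<noteq> b" for a b
      using that D(2) pos by (intro coprime_rat_cyclotomic_poly) auto
  qed
  then obtain N where N: "\<And>a. a \<in> D \<Longrightarrow> N a = 0 \<or> degree (N a) < degree (?r a)"
      "Q = (\<Sum>a\<in>D. N a * prod ?r (D - {a}))" by blast
  \<comment> \<open>The sign comes from the product of the cyclotomic polynomials being
    \<open>x^m - 1\<close> rather than \<open>1 - x^m\<close>.\<close>
  define c where "c = (\<lambda>(a, b). if a \<in> D then - coeff (N a) b else 0)"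
  show ?thesis
  proof (rule that[of c]; intro allI impI)
    show "c (1, 0) = 0" if "poly P 1 = 0" using that by (simp add: c_def D_def)
  next
    fix x :: real assume x: "0 < x" "x < 1"
    let ?e = "\<lambda>p. poly (map_poly of_rat p) x"
    have e_mult: "?e (p * q) = ?e p * ?e q" for p q by (simp add: map_poly_of_rat_mult)
    have e_prod: "?e (prod f A) = (\<Prod>a\<in>A. ?e (f a))" for f :: "nat \<Rightarrow> rat poly" and A
      by (simp add: map_poly_of_rat_prod poly_prod)
    have e_sum: "?e (sum f A) = (\<Sum>a\<in>A. ?e (f a))" for f :: "nat \<Rightarrow> rat poly" and A
      by (induction A rule: infinite_finite_induct) (simp_all add: map_poly_of_rat_add)
    have er: "?e (?r a) = poly (cyclotomic_poly a) x" if "a dvd m" for a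
      using pos[OF that] by (simp add: real_rat_cyclotomic_poly)
    have nz: "?e (?r a) \<noteq> 0" if "a dvd m" for a
      unfolding er[OF that] using x by (rule cyclotomic_poly_nonzero_Ioo)
    have nzD: "(\<Prod>a\<in>D. ?e (?r a)) \<noteq> 0" using nz D by auto
    have xm: "?e (monom 1 m - 1) = x ^ m - 1"
      by (simp add: map_poly_of_rat_monom_diff_1 poly_monom)
    have "x ^ m < 1" using x assms by (simp add: power_less_one_iff)
    then have xm0: "x ^ m - 1 \<noteq> 0" by simp
    have "?e P * (\<Prod>a\<in>D. ?e (?r a)) = ?e Q * (x ^ m - 1)"
      using arg_cong[OF PQ, of ?e] by (simp only: e_mult e_prod xm)
    then have "?e P / (1 - x ^ m) = - (?e Q / (\<Prod>a\<in>D. ?e (?r a)))"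
      using nzD xm0 by (simp add: field_simps)
    also have "?e Q / (\<Prod>a\<in>D. ?e (?r a)) = (\<Sum>a\<in>D. ?e (N a) / ?e (?r a))"
      unfolding N(2) e_sum e_mult e_prod sum_divide_distrib
    proof (rule sum.cong)
      fix a assume a: "a \<in> D"
      then have "(\<Prod>a\<in>D. ?e (?r a)) = ?e (?r a) * (\<Prod>a\<in>D - {a}. ?e (?r a))"
        using D by (simp add: prod.remove)
      then show "?e (N a) * (\<Prod>a\<in>D - {a}. ?e (?r a)) / (\<Prod>a\<in>D. ?e (?r a)) = ?e (N a) / ?e (?r a)"
        using nzD by simp
    qed simp
    also have "- \<dots> = (\<Sum>a\<in>D. \<Sum>b<totient a. of_rat (c (a, b)) * letter_fun (a, b) x)"
      unfolding sum_negf[symmetric]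
    proof (rule sum.cong)
      fix a assume a: "a \<in> D"
      then have ad: "a dvd m" "a > 0" using D pos by auto
      have "?e (N a) = (\<Sum>b\<le>degree (N a). of_rat (coeff (N a) b) * x ^ b)"
        by (rule poly_map_of_rat_sum)
      also have "\<dots> = (\<Sum>b<totient a. of_rat (coeff (N a) b) * x ^ b)"
        using N(1)[OF a] degree_rat_cyclotomic_poly[OF ad(2)] ad(2)
        by (intro sum.mono_neutral_cong_left) (auto simp: not_le coeff_eq_0)
      finally have eN: "?e (N a) = (\<Sum>b<totient a. of_rat (coeff (N a) b) * x ^ b)" .
      have "- (?e (N a) / ?e (?r a)) =
          (\<Sum>b<totient a. - (of_rat (coeff (N a) b) * x ^ b / ?e (?r a)))"
        unfolding eN by (simp add: sum_divide_distrib sum_negf)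
      also have "\<dots> = (\<Sum>b<totient a. of_rat (c (a, b)) * letter_fun (a, b) x)"
        using a ad er[OF ad(1)] by (intro sum.cong) (auto simp: c_def letter_fun_def of_rat_minus)
      finally show "- (?e (N a) / ?e (?r a)) =
          (\<Sum>b<totient a. of_rat (c (a, b)) * letter_fun (a, b) x)" .
    qed simp
    also have "\<dots> = (\<Sum>a | a dvd m. \<Sum>b<totient a. of_rat (c (a, b)) * letter_fun (a, b) x)"
      using D fin by (intro sum.mono_neutral_left) (auto simp: c_def)
    finally show "?e P / (1 - x ^ m) =
        (\<Sum>a | a dvd m. \<Sum>b<totient a. of_rat (c (a, b)) * letter_fun (a, b) x)" .
  qed
qed

section \<open>Integrals with algebraic singularities at one\<close>

text \<open>A big-O bound on the whole interval. Continuity is included because it supplies the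
  measurability needed for integrability.\<close>

definition dominated :: "(real \<Rightarrow> real) \<Rightarrow> (real \<Rightarrow> real) \<Rightarrow> bool" where
  "dominated g f \<longleftrightarrow> continuous_on {0<..<1} f \<and> (\<exists>C. \<forall>x\<in>{0<..<1}. \<bar>f x\<bar> \<le> C * g x)"

lemma dominatedI:
  "continuous_on {0<..<1} f \<Longrightarrow> (\<And>x. 0 < x \<Longrightarrow> x < 1 \<Longrightarrow> \<bar>f x\<bar> \<le> C * g x) \<Longrightarrow> dominated g f"
  unfolding dominated_def by (meson greaterThanLessThan_iff)

lemma dominated_continuous: "dominated g f \<Longrightarrow> continuous_on {0<..<1} f"
  by (simp add: dominated_def)

lemma dominatedE:
  assumes "dominated g f" "\<And>x. 0 < x \<Longrightarrow> x < 1 \<Longrightarrow> g x \<ge> 0"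
  obtains C where "C \<ge> 0" "\<And>x. 0 < x \<Longrightarrow> x < 1 \<Longrightarrow> \<bar>f x\<bar> \<le> C * g x"
proof -
  obtain C where C: "\<And>x. x \<in> {0<..<1} \<Longrightarrow> \<bar>f x\<bar> \<le> C * g x"
    using assms(1) unfolding dominated_def by blast
  show ?thesis
  proof (rule that[of "\<bar>C\<bar>"])
    fix x :: real assume x: "0 < x" "x < 1"
    then have "C * g x \<le> \<bar>C\<bar> * g x" using assms(2) by (intro mult_right_mono) auto
    then show "\<bar>f x\<bar> \<le> \<bar>C\<bar> * g x" using C[of x] x by auto
  qed simp
qed

lemma dominated_mult:
  assumes "dominated g f" "dominated g' f'"
  shows "dominated (\<lambda>x. g x * g' x) (\<lambda>x. f x * f' x)"
proof -
  obtain C C' where C: "\<And>x. x \<in> {0<..<1} \<Longrightarrow> \<bar>f x\<bar> \<le> C * g x"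
      "\<And>x. x \<in> {0<..<1} \<Longrightarrow> \<bar>f' x\<bar> \<le> C' * g' x"
    using assms unfolding dominated_def by blast
  show ?thesis
  proof (rule dominatedI[of _ "C * C'"])
    show "continuous_on {0<..<1} (\<lambda>x. f x * f' x)"
      using assms by (intro continuous_on_mult dominated_continuous)
    fix x :: real assume "0 < x" "x < 1"
    then have "\<bar>f x\<bar> * \<bar>f' x\<bar> \<le> (C * g x) * (C' * g' x)"
      using C[of x] by (intro mult_mono) force+
    then show "\<bar>f x * f' x\<bar> \<le> C * C' * (g x * g' x)" by (simp add: abs_mult mult_ac)
  qed
qed

lemma dominated_mono:
  assumes "dominated g f" "\<And>x. 0 < x \<Longrightarrow> x < 1 \<Longrightarrow> 0 \<le> g x"
    and "\<And>x. 0 < x \<Longrightarrow> x < 1 \<Longrightarrow> g x \<le> g' x"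
  shows "dominated g' f"
proof -
  obtain C where C: "C \<ge> 0" "\<And>x. 0 < x \<Longrightarrow> x < 1 \<Longrightarrow> \<bar>f x\<bar> \<le> C * g x"
    using assms(1,2) by (elim dominatedE) auto
  show ?thesis
  proof (rule dominatedI[of _ C])
    fix x :: real assume x: "0 < x" "x < 1"
    then have "C * g x \<le> C * g' x" using assms(3) C by (intro mult_left_mono) auto
    then show "\<bar>f x\<bar> \<le> C * g' x" using C(2)[OF x] by linarith
  qed (use assms dominated_continuous in auto)
qed

lemma dominated_cong:
  assumes "dominated g f" "\<And>x. 0 < x \<Longrightarrow> x < 1 \<Longrightarrow> g x = g' x"
    "\<And>x. 0 < x \<Longrightarrow> x < 1 \<Longrightarrow> f x = f' x"
  shows "dominated g' f'"
proof -
  obtain C where C: "\<And>x. x \<in> {0<..<1} \<Longrightarrow> \<bar>f x\<bar> \<le> C * g x"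
    using assms(1) unfolding dominated_def by blast
  show ?thesis
  proof (rule dominatedI[of _ C])
    show "continuous_on {0<..<1} f'"
      using dominated_continuous[OF assms(1)] assms(3)
      by (subst continuous_on_cong[OF refl, of _ _ f]) auto
    show "\<bar>f' x\<bar> \<le> C * g' x" if "0 < x" "x < 1" for x
      using C[of x] assms(2,3)[OF that] that by auto
  qed
qed

text \<open>All powers of logarithms at one are absorbed into the exponent one half: a function of order
  \<open>x / sqrt (1 - x)\<close> times a letter with a simple pole at one is of order
  \<open>(1 - x) powr (- 3 / 2)\<close>, whose integral from zero is again of order \<open>x / sqrt (1 - x)\<close>.\<close>

definition weight_mild :: "real \<Rightarrow> real" where "weight_mild x = 1 / ((1 - x) * sqrt (1 - x))"
definition weight_half :: "real \<Rightarrow> real" where "weight_half x = 1 / sqrt (1 - x)"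
definition weight_tame :: "real \<Rightarrow> real" where "weight_tame x = x / sqrt (1 - x)"

lemma weight_nonneg:
  assumes "0 < x" "x < 1"
  shows "weight_mild x \<ge> 0" "weight_half x \<ge> 0" "weight_tame x \<ge> 0"
  using assms by (auto simp: weight_mild_def weight_half_def weight_tame_def)

lemma integrable_on_Icc_dominated:
  fixes f g :: "real \<Rightarrow> real"
  assumes "continuous_on {a<..<b} f" "g integrable_on {a..b}"
    and "\<And>x. a < x \<Longrightarrow> x < b \<Longrightarrow> \<bar>f x\<bar> \<le> g x"
  shows "f integrable_on {a..b}" "\<bar>integral {a..b} f\<bar> \<le> integral {a..b} g"
proof -
  have g: "g integrable_on {a<..<b}" using assms(2) by (simp add: integrable_on_Icc_iff_Ioo)
  have "f absolutely_integrable_on {a<..<b}"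
    using assms g
    by (intro measurable_bounded_by_integrable_imp_absolutely_integrable[where g = g])
       (auto intro!: continuous_imp_measurable_on_sets_lebesgue)
  then have f: "f integrable_on {a<..<b}"
    using absolutely_integrable_on_def by blast
  then show "f integrable_on {a..b}" by (simp add: integrable_on_Icc_iff_Ioo)
  show "\<bar>integral {a..b} f\<bar> \<le> integral {a..b} g"
    using integral_norm_bound_integral[OF f g] assms(3) by (simp add: integral_open_interval_real)
qed

lemma has_integral_weight_mild:
  assumes "0 \<le> x" "x < 1"
  shows "(weight_mild has_integral (2 / sqrt (1 - x) - 2)) {0..x}"
proof -
  have "(weight_mild has_integral (2 / sqrt (1 - x) - 2 / sqrt (1 - 0))) {0..x}"
  proof (rule fundamental_theorem_of_calculus[OF assms(1)])
    fix y assume "y \<in> {0..x}"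
    then have y: "y < 1" using assms by auto
    have "((\<lambda>y. 2 / sqrt (1 - y)) has_real_derivative weight_mild y) (at y)"
      using y by (auto intro!: derivative_eq_intros simp: weight_mild_def field_simps)
    then show "((\<lambda>y. 2 / sqrt (1 - y)) has_vector_derivative weight_mild y) (at y within {0..x})"
      by (simp add: has_real_derivative_iff_has_vector_derivative has_vector_derivative_at_within)
  qed
  then show ?thesis by simp
qed

lemma integrable_weight_half: "weight_half integrable_on {0..1}"
proof -
  have "(weight_half has_integral (- 2 * sqrt (1 - 1) - - 2 * sqrt (1 - 0))) {0..1}"
  proof (rule fundamental_theorem_of_calculus_interior)
    show "continuous_on {0..1::real} (\<lambda>x. - 2 * sqrt (1 - x))"
      by (intro continuous_intros)
    fix y :: real assume "y \<in> {0<..<1}"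
    then have "((\<lambda>x. - 2 * sqrt (1 - x)) has_real_derivative weight_half y) (at y)"
      by (auto intro!: derivative_eq_intros simp: weight_half_def field_simps)
    then show "((\<lambda>x. - 2 * sqrt (1 - x)) has_vector_derivative weight_half y) (at y)"
      by (simp add: has_real_derivative_iff_has_vector_derivative)
  qed simp
  then show ?thesis by blast
qed

context
  fixes f :: "real \<Rightarrow> real"
  assumes mild: "dominated weight_mild f"
begin

lemma mild_integrable:
  assumes "0 \<le> x" "x < 1"
  shows "f integrable_on {0..x}"
proof -
  obtain C where C: "C \<ge> 0" "\<And>x. 0 < x \<Longrightarrow> x < 1 \<Longrightarrow> \<bar>f x\<bar> \<le> C * weight_mild x"
    using dominatedE[OF mild] weight_nonneg(1) by blast
  show ?thesis
  proof (rule integrable_on_Icc_dominated(1))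
    show "continuous_on {0<..<x} f"
      using dominated_continuous[OF mild] assms by (auto elim: continuous_on_subset)
    show "(\<lambda>x. C * weight_mild x) integrable_on {0..x}"
      using has_integral_mult_right[OF has_integral_weight_mild[OF assms]] by blast
  qed (use C assms in auto)
qed

lemma mild_has_derivative:
  assumes "0 < x" "x < 1"
  shows "((\<lambda>x. integral {0..x} f) has_real_derivative f x) (at x)"
proof -
  \<comment> \<open>Nothing is known about \<open>f\<close> at zero, so the fundamental theorem is
    applied on an interval inside (0, 1), and the integral up to \<open>a\<close> is added as a
    constant.\<close>
  define a b where "a = x / 2" and "b = (x + 1) / 2"
  have ab: "0 < a" "a < x" "x < b" "b < 1" using assms by (auto simp: a_def b_def)
  have cont: "continuous_on {a..b} f"
    using dominated_continuous[OF mild] ab by (auto elim: continuous_on_subset)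
  have "((\<lambda>y. integral {a..y} f) has_real_derivative f x) (at x within {a..b})"
    using ab cont by (intro integral_has_real_derivative) auto
  then have "((\<lambda>y. integral {0..a} f + integral {a..y} f) has_real_derivative f x) (at x within {a..b})"
    by (auto intro!: derivative_eq_intros)
  then have 1: "((\<lambda>y. integral {0..a} f + integral {a..y} f) has_real_derivative f x) (at x)"
    using ab by (simp add: at_within_Icc_at)
  show ?thesis
  proof (rule has_field_derivative_transform_within_open[OF 1])
    show "open {a<..<b}" "x \<in> {a<..<b}" using ab by auto
    fix y assume "y \<in> {a<..<b}"
    then show "integral {0..a} f + integral {a..y} f = integral {0..y} f"
      using ab by (intro Henstock_Kurzweil_Integration.integral_combine mild_integrable) auto
  qed
qed

text \<open>Integrating from zero gains the factor \<open>x\<close>, which pays for a later kernel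
  \<open>1 / x\<close>.\<close>

lemma mild_integral_tame: "dominated weight_tame (\<lambda>x. integral {0..x} f)"
proof -
  obtain C where C: "C \<ge> 0" "\<And>x. 0 < x \<Longrightarrow> x < 1 \<Longrightarrow> \<bar>f x\<bar> \<le> C * weight_mild x"
    using dominatedE[OF mild] weight_nonneg(1) by blast
  show ?thesis
  proof (rule dominatedI[of _ "2 * C"])
    show "continuous_on {0<..<1} (\<lambda>x. integral {0..x} f)"
      using mild_has_derivative
      by (intro continuous_at_imp_continuous_on) (fastforce intro: DERIV_isCont)
    fix x :: real assume x: "0 < x" "x < 1"
    have W: "((\<lambda>y. C * weight_mild y) has_integral (C * (2 / sqrt (1 - x) - 2))) {0..x}"
      using x by (intro has_integral_mult_right has_integral_weight_mild) auto
    have "\<bar>integral {0..x} f\<bar> \<le> integral {0..x} (\<lambda>y. C * weight_mild y)"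
    proof (rule integrable_on_Icc_dominated(2))
      show "continuous_on {0<..<x} f"
        using dominated_continuous[OF mild] x by (auto elim: continuous_on_subset)
    qed (use W C x in auto)
    also have "\<dots> = C * (2 / sqrt (1 - x) - 2)" using W by (rule integral_unique)
    also have "\<dots> \<le> C * (2 * (x / sqrt (1 - x)))"
    proof (rule mult_left_mono[OF _ C(1)])
      \<comment> \<open>In terms of \<open>s\<close> the bound reads
        \<open>2 (1 - s) / s <= 2 (1 - s^2) / s\<close>.\<close>
      define s where "s = sqrt (1 - x)"
      have s: "0 < s" "s \<le> 1" "x = 1 - s * s" using x by (auto simp: s_def)
      have "2 / s - 2 \<le> 2 * (x / s)"
      proof -
        have "2 / s - 2 = 2 * (1 - s) / s" using s by (simp add: field_simps)
        also have "\<dots> \<le> 2 * x / s"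
          using s mult_left_le[of s s] by (intro divide_right_mono) auto
        finally show ?thesis by simp
      qed
      then show "2 / sqrt (1 - x) - 2 \<le> 2 * (x / sqrt (1 - x))" by (simp add: s_def)
    qed
    finally show "\<bar>integral {0..x} f\<bar> \<le> 2 * C * weight_tame x"
      by (simp add: weight_tame_def mult_ac)
  qed
qed

end

lemma half_integrable:
  assumes "dominated weight_half f"
  shows "f integrable_on {0..1}"
proof -
  obtain C where C: "C \<ge> 0" "\<And>x. 0 < x \<Longrightarrow> x < 1 \<Longrightarrow> \<bar>f x\<bar> \<le> C * weight_half x"
    using dominatedE[OF assms] weight_nonneg(2) by blast
  show ?thesis
  proof (rule integrable_on_Icc_dominated(1))
    show "(\<lambda>x. C * weight_half x) integrable_on {0..1}"
      using integrable_weight_half has_integral_mult_right by (metis integrable_on_def)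
  qed (use C dominated_continuous[OF assms] in auto)
qed

text \<open>This is the source of the values at one: the indefinite integral is continuous up to the
  endpoint.\<close>

lemma half_tendsto_integral:
  assumes "dominated weight_half f"
  shows "((\<lambda>x. integral {0..x} f) \<longlongrightarrow> integral {0..1} f) (at_left 1)"
proof -
  have "continuous_on {0..1} (\<lambda>x. integral {0..x} f)"
    by (intro indefinite_integral_continuous_1 half_integrable assms)
  then have "((\<lambda>x. integral {0..x} f) \<longlongrightarrow> integral {0..1} f) (at 1 within {0..1})"
    by (auto simp: continuous_on_def)
  then show ?thesis by (simp add: at_within_Icc_at_left)
qed

lemma half_imp_mild: "dominated weight_half f \<Longrightarrow> dominated weight_mild f"
proof (rule dominated_mono)
  fix x :: real assume x: "0 < x" "x < 1"
  then show "weight_half x \<ge> 0" by (rule weight_nonneg)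
  have "(1 - x) * sqrt (1 - x) \<le> sqrt (1 - x)" using x by (intro mult_left_le_one_le) auto
  then show "weight_half x \<le> weight_mild x"
    using x unfolding weight_half_def weight_mild_def by (intro divide_left_mono mult_pos_pos) auto
qed auto

lemma continuous_on_Icc_squeeze:
  fixes G :: "real \<Rightarrow> real"
  assumes "continuous_on {0<..<1} G" "\<And>x. x \<in> {0..1} \<Longrightarrow> \<bar>G x\<bar> \<le> C * (x * sqrt (1 - x))"
  shows "continuous_on {0..1} G"
proof -
  have "(G \<longlongrightarrow> G x) (at x within {0..1})" if x: "x \<in> {0..1}" for x
  proof (cases "x \<in> {0<..<1}")
    case True
    then have "isCont G x"
      using assms(1) by (simp add: continuous_on_eq_continuous_at)
    then show ?thesis by (simp add: isCont_def tendsto_within_subset[of _ _ _ UNIV])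
  next
    case False
    then have e: "x = 0 \<or> x = 1" using x by auto
    then have G0: "G x = 0" using assms(2)[OF x] by auto
    have "((\<lambda>y. C * (y * sqrt (1 - y))) \<longlongrightarrow> C * (x * sqrt (1 - x))) (at x within {0..1})"
      by (intro tendsto_intros)
    then have lim: "((\<lambda>y. C * (y * sqrt (1 - y))) \<longlongrightarrow> 0) (at x within {0..1})"
      using e by auto
    have "(G \<longlongrightarrow> 0) (at x within {0..1})"
    proof (rule Lim_null_comparison[OF _ lim])
      show "\<forall>\<^sub>F y in at x within {0..1}. norm (G y) \<le> C * (y * sqrt (1 - y))"
        using assms(2) by (auto simp: eventually_at_filter)
    qed
    then show ?thesis using G0 by simp
  qed
  then show ?thesis by (simp add: continuous_on_def)
qed

text \<open>The primitive of \<open>f\<close> is of order \<open>x / sqrt (1 - x)\<close> and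
  \<open>A\<close> vanishes linearly at one, so their product is of order
  \<open>x * sqrt (1 - x)\<close> and leaves no boundary terms.\<close>

lemma integral_by_parts_vanishing:
  assumes f: "dominated weight_mild f"
    and A': "\<And>x. (A has_real_derivative A' x) (at x)" "continuous_on UNIV A'"
    and bound: "\<And>x. 0 < x \<Longrightarrow> x < 1 \<Longrightarrow> \<bar>A x\<bar> \<le> B * (1 - x)"
  shows "(\<lambda>x. A x * f x) integrable_on {0..1}"
    "integral {0..1} (\<lambda>x. A x * f x) = - integral {0..1} (\<lambda>x. A' x * integral {0..x} f)"
proof -
  define K where "K = (\<lambda>x. integral {0..x} f)"
  have K: "dominated weight_tame K" unfolding K_def by (rule mild_integral_tame[OF f])
  have contA: "continuous_on S A" for S
    using A'(1) by (intro continuous_at_imp_continuous_on) (auto intro: DERIV_isCont)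
  have domA: "dominated (\<lambda>x. 1 - x) A"
    using bound contA by (intro dominatedI)
  have domA': "dominated (\<lambda>x. 1) A'"
  proof -
    have "compact (A' ` {0..1})"
      using A'(2) by (intro compact_continuous_image) (auto elim: continuous_on_subset)
    then obtain D where "\<And>x. x \<in> {0..1} \<Longrightarrow> \<bar>A' x\<bar> \<le> D"
      by (metis bounded_iff compact_imp_bounded imageI real_norm_def)
    then show ?thesis
      using A'(2) by (intro dominatedI[of _ D]) (auto elim: continuous_on_subset)
  qed
  have "dominated weight_half (\<lambda>x. A x * f x)"
    by (rule dominated_cong[OF dominated_mult[OF domA f]])
       (auto simp: weight_half_def weight_mild_def)
  then have int1: "(\<lambda>x. A x * f x) integrable_on {0..1}" by (rule half_integrable)
  have "dominated weight_half (\<lambda>x. A' x * K x)"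
    by (rule dominated_mono[OF dominated_mult[OF domA' K]])
       (auto simp: weight_half_def weight_tame_def intro!: divide_right_mono)
  then have int2: "(\<lambda>x. A' x * K x) integrable_on {0..1}" by (rule half_integrable)
  \<comment> \<open>\<open>K 1\<close> would integrate \<open>f\<close> up to one, where
    integrability may fail; the product is replaced by zero at both endpoints.\<close>
  define G where "G = (\<lambda>x. if x \<in> {0<..<1} then A x * K x else 0)"
  have domAK: "dominated (\<lambda>x. x * sqrt (1 - x)) (\<lambda>x. A x * K x)"
    by (rule dominated_cong[OF dominated_mult[OF domA K]])
       (auto simp: weight_tame_def real_div_sqrt field_simps)
  then obtain C where C: "C \<ge> 0" "\<And>x. 0 < x \<Longrightarrow> x < 1 \<Longrightarrow> \<bar>A x * K x\<bar> \<le> C * (x * sqrt (1 - x))"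
    by (rule dominatedE) auto
  have contG: "continuous_on {0..1} G"
  proof (rule continuous_on_Icc_squeeze)
    show "continuous_on {0<..<1} G"
      using dominated_continuous[OF domAK] by (subst continuous_on_cong[OF refl]) (auto simp: G_def)
    show "\<bar>G x\<bar> \<le> C * (x * sqrt (1 - x))" if "x \<in> {0..1}" for x
      using that C by (auto simp: G_def)
  qed
  have "((\<lambda>x. A' x * K x + A x * f x) has_integral (G 1 - G 0)) {0..1}"
  proof (rule fundamental_theorem_of_calculus_interior[OF _ contG])
    fix x :: real assume x: "x \<in> {0<..<1}"
    have "((\<lambda>x. A x * K x) has_real_derivative A' x * K x + A x * f x) (at x)"
      using x A'(1)[of x] mild_has_derivative[OF f, of x, folded K_def]
      by (auto intro!: derivative_eq_intros simp: mult.commute)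
    then have "(G has_real_derivative A' x * K x + A x * f x) (at x)"
      by (rule has_field_derivative_transform_within_open[where S = "{0<..<1}"])
         (use x in \<open>auto simp: G_def\<close>)
    then show "(G has_vector_derivative A' x * K x + A x * f x) (at x)"
      by (simp add: has_real_derivative_iff_has_vector_derivative)
  qed simp
  then have "integral {0..1} (\<lambda>x. A' x * K x + A x * f x) = 0"
    by (simp add: integral_unique G_def)
  then have "integral {0..1} (\<lambda>x. A' x * K x) + integral {0..1} (\<lambda>x. A x * f x) = 0"
    using int1 int2 by (simp add: integral_add)
  then show "integral {0..1} (\<lambda>x. A x * f x) = - integral {0..1} (\<lambda>x. A' x * integral {0..x} f)"
    by (simp add: K_def)
  show "(\<lambda>x. A x * f x) integrable_on {0..1}" by fact
qed

section \<open>Cyclotomic polylogarithms\<close>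

lemma letter_fun_zero: "letter_fun (0, 0) = (\<lambda>x. 1 / x)"
  by (simp add: letter_fun_def fun_eq_iff)

lemma cyclotomic_poly_1: "cyclotomic_poly 1 = [:-1, 1:]"
  by (simp add: cyclotomic_poly_def complex_cyclotomic_poly_def map_poly_pCons cis_2pi)

lemma letter_fun_bounded:
  assumes "a \<ge> 2"
  shows "dominated (\<lambda>_. 1) (letter_fun (a, b))"
proof -
  have cont: "continuous_on {0..1} (letter_fun (a, b))"
    unfolding letter_fun_def using assms cyclotomic_poly_nonzero_Icc
    by (auto intro!: continuous_intros)
  then have "compact (letter_fun (a, b) ` {0..1})"
    by (intro compact_continuous_image) auto
  then obtain D where "\<And>x. x \<in> {0..1} \<Longrightarrow> \<bar>letter_fun (a, b) x\<bar> \<le> D"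
    by (metis bounded_iff compact_imp_bounded imageI real_norm_def)
  then show ?thesis
    using cont by (intro dominatedI[of _ D]) (auto elim: continuous_on_subset)
qed

lemma letter_fun_simple_pole:
  assumes "(a, b) \<in> cyclotomic_letters" "(a, b) \<noteq> (0, 0)"
  shows "dominated (\<lambda>x. 1 / (1 - x)) (letter_fun (a, b))"
proof (cases "a = 1")
  case True
  then have "b = 0" using assms by (simp add: cyclotomic_letters_def)
  then have "letter_fun (a, b) = (\<lambda>x. 1 / (x - 1))"
    using True by (simp add: letter_fun_def fun_eq_iff cyclotomic_poly_1[simplified])
  then show ?thesis
    by (auto intro!: dominatedI[of _ 1] continuous_intros simp: field_simps)
next
  case False
  then have "a \<ge> 2" using assms by (auto simp: cyclotomic_letters_def)
  from letter_fun_bounded[OF this] show ?thesis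
    by (rule dominated_mono) auto
qed

lemma letter_index_ge_2:
  assumes "(a, b) \<in> cyclotomic_letters" "(a, b) \<noteq> (0, 0)" "(a, b) \<noteq> (1, 0)"
  shows "a \<ge> 2"
proof -
  have "a \<ge> 1" "b < totient a" using assms by (auto simp: cyclotomic_letters_def)
  moreover have "a \<noteq> 1"
  proof
    assume "a = 1"
    then have "b = 0" using \<open>b < totient a\<close> by simp
    then show False using \<open>a = 1\<close> assms by simp
  qed
  ultimately show ?thesis by linarith
qed

text \<open>A last letter other than \<open>(0, 0)\<close> makes the innermost integral converge at
  zero and rules out the logarithmic clause of \<open>cyclotomic_polylog\<close>.\<close>

definition regular_word :: "(nat \<times> nat) list \<Rightarrow> bool" where
  "regular_word w \<longleftrightarrow> w \<noteq> [] \<and> last w \<noteq> (0, 0) \<and> set w \<subseteq> cyclotomic_letters"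

lemma cyclotomic_polylog_Cons:
  assumes "regular_word (l # w)"
  shows "cyclotomic_polylog (l # w) =
    (\<lambda>x. integral {0..x} (\<lambda>y. letter_fun l y * cyclotomic_polylog w y))"
proof -
  have "last (l # w) \<in> set (l # w)" by (rule last_in_set) simp
  then have "set (l # w) \<noteq> {(0, 0)}" using assms unfolding regular_word_def by auto
  then show ?thesis by (simp only: cyclotomic_polylog.simps if_False fun_eq_iff) simp
qed

text \<open>By induction the inner polylogarithm is of order \<open>x / sqrt (1 - x)\<close>. Its
  factor \<open>x\<close> cancels the pole of \<open>(0, 0)\<close>, bounded letters preserve the
  order at one, and only \<open>(1, 0)\<close> adds a pole there.\<close>

lemma dominated_letter_fun_mult_polylog:
  assumes "regular_word (l # w)"
  shows "dominated weight_mild (\<lambda>y. letter_fun l y * cyclotomic_polylog w y)"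
    and "l \<noteq> (1, 0) \<Longrightarrow> dominated weight_half (\<lambda>y. letter_fun l y * cyclotomic_polylog w y)"
proof -
  have "dominated weight_mild (\<lambda>y. letter_fun l y * cyclotomic_polylog w y) \<and>
    (l \<noteq> (1, 0) \<longrightarrow> dominated weight_half (\<lambda>y. letter_fun l y * cyclotomic_polylog w y))"
    using assms
  proof (induction w arbitrary: l)
    case Nil
    obtain a b where l: "l = (a, b)" by force
    have ab: "(a, b) \<in> cyclotomic_letters" "(a, b) \<noteq> (0, 0)"
      using Nil by (auto simp: regular_word_def l)
    have "dominated weight_mild (letter_fun (a, b))"
    proof (rule dominated_mono[OF letter_fun_simple_pole[OF ab]])
      fix x :: real assume x: "0 < x" "x < 1"
      then have "(1 - x) * sqrt (1 - x) \<le> 1 - x" by (intro mult_left_le) auto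
      then show "1 / (1 - x) \<le> weight_mild x"
        using x unfolding weight_mild_def by (intro divide_left_mono mult_pos_pos) auto
    qed auto
    moreover have "dominated weight_half (letter_fun (a, b))" if "(a, b) \<noteq> (1, 0)"
    proof -
      have "a \<ge> 2" using letter_index_ge_2[OF ab that] .
      from letter_fun_bounded[OF this] show ?thesis
        by (rule dominated_mono) (auto simp: weight_half_def field_simps)
    qed
    ultimately show ?case by (simp add: l)
  next
    case (Cons l' w)
    obtain a b where l: "l = (a, b)" by force
    have ab: "(a, b) \<in> cyclotomic_letters" and w: "regular_word (l' # w)"
      using Cons.prems by (auto simp: regular_word_def l split: if_splits)
    let ?H = "cyclotomic_polylog (l' # w)"
    have tame: "dominated weight_tame ?H"
      unfolding cyclotomic_polylog_Cons[OF w] using Cons.IH[OF w] by (intro mild_integral_tame) simp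
    have half: "dominated weight_half (\<lambda>y. letter_fun (a, b) y * ?H y)" if "(a, b) \<noteq> (1, 0)"
    proof (cases "(a, b) = (0, 0)")
      case True
      have "dominated (\<lambda>x. 1 / x) (letter_fun (a, b))"
        unfolding True letter_fun_zero by (auto intro!: dominatedI[of _ 1] continuous_intros)
      from dominated_mult[OF this tame] show ?thesis
        by (rule dominated_cong) (auto simp: weight_half_def weight_tame_def)
    next
      case False
      then have "a \<ge> 2" using letter_index_ge_2[OF ab _ that] by simp
      from dominated_mult[OF letter_fun_bounded[OF this] tame] show ?thesis
        by (rule dominated_mono)
           (auto simp: weight_half_def weight_tame_def intro!: divide_right_mono)
    qed
    moreover have "dominated weight_mild (\<lambda>y. letter_fun (a, b) y * ?H y)"
    proof (cases "(a, b) = (1, 0)")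
      case True
      have "dominated (\<lambda>x. 1 / (1 - x)) (letter_fun (a, b))"
        by (rule letter_fun_simple_pole[OF ab]) (use True in auto)
      from dominated_mult[OF this tame] show ?thesis
        by (rule dominated_mono)
           (auto simp: weight_mild_def weight_tame_def intro!: divide_right_mono)
    qed (use half half_imp_mild in blast)
    ultimately show ?case unfolding l by blast
  qed
  then show "dominated weight_mild (\<lambda>y. letter_fun l y * cyclotomic_polylog w y)"
    and "l \<noteq> (1, 0) \<Longrightarrow> dominated weight_half (\<lambda>y. letter_fun l y * cyclotomic_polylog w y)"
    by auto
qed

lemma polylog_has_integral:
  assumes "regular_word (l # w)" "0 < x" "x < 1"
  shows "((\<lambda>y. letter_fun l y * cyclotomic_polylog w y) has_integral
    cyclotomic_polylog (l # w) x) {0..x}"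
  unfolding cyclotomic_polylog_Cons[OF assms(1)]
  using assms by (intro integrable_integral mild_integrable dominated_letter_fun_mult_polylog) auto

lemma polylog_at_one:
  assumes "regular_word (l # w)" "l \<noteq> (1, 0)"
  shows "integral {0..1} (\<lambda>y. letter_fun l y * cyclotomic_polylog w y) \<in> cyclotomic_expressible"
  \<comment> \<open>In this proof \<open>polylog_at_one\<close> still denotes the introduction rule
    of \<open>cyclotomic_expressible\<close>.\<close>
  using assms
  by (intro polylog_at_one[where ms = "l # w"])
     (auto simp: cyclotomic_polylog_Cons regular_word_def
        simp del: cyclotomic_polylog.simps
        intro!: half_tendsto_integral dominated_letter_fun_mult_polylog)

section \<open>Rational combinations of letters and of words\<close>

definition rat_comb :: "('a \<Rightarrow> real \<Rightarrow> real) \<Rightarrow> (rat \<times> 'a) list \<Rightarrow> real \<Rightarrow> real" where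
  "rat_comb F L x = (\<Sum>(r, a)\<leftarrow>L. of_rat r * F a x)"

lemma rat_comb_Nil: "rat_comb F [] x = 0"
  and rat_comb_Cons: "rat_comb F ((r, a) # L) x = of_rat r * F a x + rat_comb F L x"
  by (simp_all add: rat_comb_def)

lemma rat_comb_mult_has_integral:
  assumes "\<And>r l q w. (r, l) \<in> set K \<Longrightarrow> (q, w) \<in> set L \<Longrightarrow>
      ((\<lambda>y. F l y * G w y) has_integral h l w) S"
  shows "((\<lambda>y. rat_comb F K y * rat_comb G L y) has_integral
      (\<Sum>(r, l)\<leftarrow>K. \<Sum>(q, w)\<leftarrow>L. of_rat (r * q) * h l w)) S"
  using assms
proof (induction K)
  case Nil
  then show ?case by (simp add: rat_comb_Nil)
next
  case (Cons rl K)
  obtain r l where rl: "rl = (r, l)" by force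
  have "((\<lambda>y. of_rat r * F l y * rat_comb G L y) has_integral
      (\<Sum>(q, w)\<leftarrow>L. of_rat (r * q) * h l w)) S"
    using Cons.prems
  proof (induction L)
    case Nil
    then show ?case by (simp add: rat_comb_Nil)
  next
    case (Cons qw L)
    obtain q w where qw: "qw = (q, w)" by force
    have 1: "((\<lambda>y. F l y * G w y) has_integral h l w) S"
      by (rule Cons.prems[of r _ q]) (auto simp: rl qw)
    have 2: "((\<lambda>y. of_rat r * F l y * rat_comb G L y) has_integral
        (\<Sum>(q, w)\<leftarrow>L. of_rat (r * q) * h l w)) S"
      by (rule Cons.IH) (use Cons.prems in auto)
    show ?case
      using has_integral_add[OF has_integral_mult_right[OF 1, of "of_rat (r * q)"] 2]
      by (simp add: qw rat_comb_Cons algebra_simps of_rat_mult)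
  qed
  moreover have "((\<lambda>y. rat_comb F K y * rat_comb G L y) has_integral
      (\<Sum>(r, l)\<leftarrow>K. \<Sum>(q, w)\<leftarrow>L. of_rat (r * q) * h l w)) S"
    by (rule Cons.IH) (use Cons.prems in auto)
  ultimately have "((\<lambda>y. of_rat r * F l y * rat_comb G L y + rat_comb F K y * rat_comb G L y) has_integral
      (\<Sum>(q, w)\<leftarrow>L. of_rat (r * q) * h l w) +
      (\<Sum>(r, l)\<leftarrow>K. \<Sum>(q, w)\<leftarrow>L. of_rat (r * q) * h l w)) S"
    by (rule has_integral_add)
  then show ?case by (simp add: rl rat_comb_Cons ring_distribs)
qed

lemma rat_comb_product:
  "(\<Sum>(r, l)\<leftarrow>K. \<Sum>(q, w)\<leftarrow>L. of_rat (r * q) * H (f l w) x) =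
    rat_comb H (concat (map (\<lambda>(r, l). map (\<lambda>(q, w). (r * q, f l w)) L) K)) x"
proof (induction K)
  case (Cons rl K)
  have "rat_comb H (M @ N) x = rat_comb H M x + rat_comb H N x" for M N by (simp add: rat_comb_def)
  with Cons show ?case by (auto simp: case_prod_unfold rat_comb_def comp_def)
qed (simp add: rat_comb_def)

lemma expressible_sum_list:
  "(\<And>x. x \<in> set xs \<Longrightarrow> f x \<in> cyclotomic_expressible) \<Longrightarrow>
    (\<Sum>x\<leftarrow>xs. f x) \<in> cyclotomic_expressible"
  by (induction xs) (auto intro: cyclotomic_expressible.intros)

lemma of_rat_expressible: "of_rat r \<in> cyclotomic_expressible"
  by (intro cyclotomic_expressible.rational) simp

lemma rat_comb_of_sum:
  assumes "finite A"
  obtains K where "snd ` set K = A" "\<forall>x. rat_comb F K x = (\<Sum>a\<in>A. of_rat (c a) * F a x)"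
proof -
  obtain xs where xs: "set xs = A" "distinct xs" using finite_distinct_list[OF assms] by auto
  show ?thesis
    by (rule that[of "map (\<lambda>a. (c a, a)) xs"])
       (use xs in \<open>auto simp: rat_comb_def comp_def sum_list_distinct_conv_sum_set image_image\<close>)
qed

lemma rational_fraction_rat_comb:
  fixes P :: "rat poly"
  assumes "m > 0" "degree P < m"
  obtains K where
    "\<forall>l\<in>snd ` set K. l \<in> cyclotomic_letters \<and> l \<noteq> (0, 0) \<and> (poly P 1 = 0 \<longrightarrow> l \<noteq> (1, 0))"
    "\<forall>x::real. 0 < x \<longrightarrow> x < 1 \<longrightarrow> poly (map_poly of_rat P) x / (1 - x ^ m) = rat_comb letter_fun K x"
proof -
  obtain c where c: "\<forall>x::real. 0 < x \<longrightarrow> x < 1 \<longrightarrow> poly (map_poly of_rat P) x / (1 - x ^ m) =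
       (\<Sum>a | a dvd m. \<Sum>b<totient a. of_rat (c (a, b)) * letter_fun (a, b) x)"
    "poly P 1 = 0 \<longrightarrow> c (1, 0) = (0 :: rat)"
    by (rule partial_fractions_cyclotomic[OF assms])
  note c = c[rule_format]
  define A where "A = (SIGMA a:{a. a dvd m}. {..<totient a})"
  \<comment> \<open>A zero coefficient is not enough here: the letter itself has to leave the list,
    since later bounds inspect the letters.\<close>
  define B where "B = (if poly P 1 = 0 then A - {(1, 0)} else A)"
  have fin: "finite A" "finite B" using assms by (auto simp: A_def B_def)
  obtain K where K: "snd ` set K = B"
      "\<forall>x. rat_comb letter_fun K x = (\<Sum>a\<in>B. of_rat (c a) * letter_fun a x)"
    by (rule rat_comb_of_sum[OF fin(2)])
  note K = K[rule_format]
  show ?thesis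
  proof (rule that[of K]; intro allI impI ballI)
    show "l \<in> cyclotomic_letters \<and> l \<noteq> (0, 0) \<and> (poly P 1 = 0 \<longrightarrow> l \<noteq> (1, 0))"
      if "l \<in> snd ` set K" for l
      using that assms unfolding K B_def A_def
      by (auto simp: cyclotomic_letters_def Suc_le_eq split: if_splits intro!: Nat.gr0I)
    fix x :: real assume x: "0 < x" "x < 1"
    have "poly (map_poly of_rat P) x / (1 - x ^ m) =
        (\<Sum>(a, b)\<in>A. of_rat (c (a, b)) * letter_fun (a, b) x)"
      unfolding c(1)[OF x] A_def using assms by (subst sum.Sigma) auto
    also have "\<dots> = (\<Sum>a\<in>A. of_rat (c a) * letter_fun a x)"
      by (simp add: case_prod_unfold)
    also have "\<dots> = (\<Sum>a\<in>B. of_rat (c a) * letter_fun a x)"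
      using fin c(2) by (intro sum.mono_neutral_right) (auto simp: B_def)
    finally show "poly (map_poly of_rat P) x / (1 - x ^ m) = rat_comb letter_fun K x"
      by (simp add: K)
  qed
qed

section \<open>The kernels of \<open>1 - x^m\<close> and their iterated integrals\<close>

lemma power_pred: "n > 0 \<Longrightarrow> x ^ n = x ^ (n - 1) * x" for x :: "'a::comm_monoid_mult"
  by (cases n) (auto simp: mult.commute)

text \<open>The exponent is shifted by one, so that the index \<open>0\<close> stands for the only kernel with a pole
  at zero.\<close>

definition root_kernel :: "nat \<Rightarrow> nat \<Rightarrow> real \<Rightarrow> real" where
  "root_kernel m i x = real m * x ^ i / (x * (1 - x ^ m))"

lemma one_minus_power_bounds:
  fixes x :: real
  assumes "0 < x" "x < 1" "m > 0"
  shows "1 - x \<le> 1 - x ^ m" "1 - x ^ m \<le> real m * (1 - x)" "0 < 1 - x ^ m"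
proof -
  have "x ^ m \<le> x ^ 1" using assms by (intro power_decreasing) auto
  then show "1 - x \<le> 1 - x ^ m" "0 < 1 - x ^ m" using assms by auto
  have "1 + real m * (x - 1) \<le> (1 + (x - 1)) ^ m" using assms by (intro Bernoulli_inequality) auto
  then show "1 - x ^ m \<le> real m * (1 - x)" by (simp add: algebra_simps)
qed

lemma poly_map_of_rat_monom:
  "poly (map_poly (of_rat :: rat \<Rightarrow> real) (monom (of_nat c) k)) x = real c * x ^ k"
  by (simp add: map_poly_monom poly_monom)

text \<open>For \<open>0 < i <= m\<close> the fraction is proper. For \<open>i = 0\<close> the pole
  at zero splits off: \<open>1 / (x (1 - x^m)) = 1 / x + x^(m-1) / (1 - x^m)\<close>.\<close>

lemma kernel_rat_comb:
  assumes "m > 0" "i \<le> m"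
  obtains K where "\<forall>l\<in>snd ` set K. l \<in> cyclotomic_letters \<and> (i > 0 \<longrightarrow> l \<noteq> (0, 0))"
    "\<forall>x::real. 0 < x \<longrightarrow> x < 1 \<longrightarrow> root_kernel m i x = rat_comb letter_fun K x"
proof -
  define k where "k = (if i = 0 then m - 1 else i - 1)"
  have "degree (monom (of_nat m :: rat) k) < m"
    using assms degree_monom_le[of "of_nat m :: rat" k] by (auto simp: k_def)
  then obtain K where K: "\<forall>l\<in>snd ` set K. l \<in> cyclotomic_letters \<and> l \<noteq> (0, 0) \<and>
        (poly (monom (of_nat m :: rat) k) 1 = 0 \<longrightarrow> l \<noteq> (1, 0))"
    and K': "\<forall>x::real. 0 < x \<longrightarrow> x < 1 \<longrightarrow>
        poly (map_poly of_rat (monom (of_nat m :: rat) k)) x / (1 - x ^ m) = rat_comb letter_fun K x"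
    by (rule rational_fraction_rat_comb[OF assms(1)])
  note K = K[rule_format] K'[rule_format, unfolded poly_map_of_rat_monom]
  show ?thesis
  proof (cases "i = 0")
    case True
    show ?thesis
    proof (rule that[of "(of_nat m, (0, 0)) # K"]; intro allI impI ballI)
      fix x :: real assume x: "0 < x" "x < 1"
      have "x ^ m = x ^ k * x" using assms True power_pred[of m x] by (simp add: k_def)
      moreover have "1 - x ^ m \<noteq> 0" using one_minus_power_bounds[OF x assms(1)] by simp
      ultimately show "root_kernel m i x = rat_comb letter_fun ((of_nat m, (0, 0)) # K) x"
        using x True unfolding rat_comb_Cons K(2)[OF x, symmetric] root_kernel_def letter_fun_zero
        by (simp add: field_simps)
    qed (use K True in \<open>auto simp: cyclotomic_letters_def\<close>)
  next
    case False
    show ?thesis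
    proof (rule that[of K]; intro allI impI ballI)
      fix x :: real assume x: "0 < x" "x < 1"
      have "x ^ i = x ^ k * x" using assms False power_pred[of i x] by (simp add: k_def)
      then show "root_kernel m i x = rat_comb letter_fun K x"
        using x unfolding K(2)[OF x, symmetric] root_kernel_def by simp
    qed (use K in auto)
  qed
qed

text \<open>The product has numerator \<open>x^(i-p-1) - x^(i-1)\<close>, up to the constant
  \<open>m\<close>, which vanishes at one and so excludes the letter \<open>(1, 0)\<close>. For
  \<open>i = p\<close> the exponent is -1, and the letter \<open>1 / x\<close> splits off as
  before.\<close>

lemma kernel_mult_rat_comb:
  assumes "m > 0" "1 \<le> p" "p \<le> i" "i \<le> m"
  obtains K where
    "\<forall>l\<in>snd ` set K. l \<in> cyclotomic_letters \<and> l \<noteq> (1, 0) \<and> (i > p \<longrightarrow> l \<noteq> (0, 0))"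
    "\<forall>x::real. 0 < x \<longrightarrow> x < 1 \<longrightarrow> (1 / x ^ p - 1) * root_kernel m i x = rat_comb letter_fun K x"
proof -
  define k where "k = (if i = p then m - 1 else i - p - 1)"
  define P where "P = monom (of_nat m :: rat) k - monom (of_nat m) (i - 1)"
  have "degree P < m"
    unfolding P_def using assms
    by (intro degree_diff_less le_less_trans[OF degree_monom_le]) (auto simp: k_def)
  have "poly P 1 = 0" by (simp add: P_def poly_monom)
  obtain K where K:
    "\<forall>l\<in>snd ` set K. l \<in> cyclotomic_letters \<and> l \<noteq> (0, 0) \<and> (poly P 1 = 0 \<longrightarrow> l \<noteq> (1, 0))"
    "\<forall>x::real. 0 < x \<longrightarrow> x < 1 \<longrightarrow> poly (map_poly of_rat P) x / (1 - x ^ m) = rat_comb letter_fun K x"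
    by (rule rational_fraction_rat_comb[OF assms(1) \<open>degree P < m\<close>])
  note K = K[rule_format]
  have K0: "\<And>l. l \<in> snd ` set K \<Longrightarrow> l \<in> cyclotomic_letters \<and> l \<noteq> (0, 0) \<and> l \<noteq> (1, 0)"
    using K(1) \<open>poly P 1 = 0\<close> by blast
  have eP: "poly (map_poly of_rat P) x = real m * x ^ k - real m * x ^ (i - 1)" for x :: real
    unfolding P_def map_poly_of_rat_diff poly_diff poly_map_of_rat_monom ..
  show ?thesis
  proof (cases "i = p")
    case True
    show ?thesis
    proof (rule that[of "(of_nat m, (0, 0)) # K"]; intro allI impI ballI)
      fix x :: real assume x: "0 < x" "x < 1"
      have k: "k = m - 1" using True by (simp add: k_def)
      have xm: "x ^ m = x ^ k * x" unfolding k by (rule power_pred[OF assms(1)])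
      have xi: "x ^ p = x ^ (p - 1) * x" by (rule power_pred) (use assms in simp)
      have alg: "(1 / (Y * x) - 1) * (c * (Y * x) / (x * (1 - X * x))) =
          c * (1 / x) + (c * X - c * Y) / (1 - X * x)"
        if "Y \<noteq> 0" "1 - X * x \<noteq> 0" for X Y c
      proof -
        define D Z where "D = 1 - X * x" and "Z = Y * x"
        have nz: "D \<noteq> 0" "Z \<noteq> 0" "x \<noteq> 0" using that x by (auto simp: D_def Z_def)
        have "(1 / Z - 1) * (c * Z / (x * D)) = c * (1 - Z) / (x * D)"
          using nz by (simp add: field_simps)
        also have "c * (1 - Z) = c * D + (c * X - c * Y) * x"
          by (simp add: D_def Z_def algebra_simps)
        also have "(c * D + (c * X - c * Y) * x) / (x * D) = c * (1 / x) + (c * X - c * Y) / D"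
          using nz by (simp add: add_divide_distrib)
        finally show ?thesis by (simp only: D_def Z_def)
      qed
      have "1 - x ^ m \<noteq> 0" using one_minus_power_bounds[OF x assms(1)] by simp
      then show "(1 / x ^ p - 1) * root_kernel m i x = rat_comb letter_fun ((of_nat m, (0, 0)) # K) x"
        using alg[of "x ^ (p - 1)" "x ^ k" "real m", folded xm xi] x
        by (simp add: rat_comb_Cons K(2)[OF x, symmetric] root_kernel_def letter_fun_zero eP True)
    qed (use K0 True in \<open>auto simp: cyclotomic_letters_def\<close>)
  next
    case False
    show ?thesis
    proof (rule that[of K]; intro allI impI ballI)
      fix x :: real assume x: "0 < x" "x < 1"
      have i: "i = Suc (k + p)" using assms False by (simp add: k_def)
      have alg: "(1 / Z - 1) * (c * (X * Z * x) / (x * D)) = (c * X - c * (X * Z)) / D"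
        if "Z \<noteq> 0" "D \<noteq> 0" for X Z c D
      proof -
        have "(1 / Z - 1) * (c * (X * Z * x) / (x * D)) = (1 / Z - 1) * Z * (c * X) / D"
          using x by simp
        also have "(1 / Z - 1) * Z * (c * X) = c * X - c * (X * Z)"
          using that by (simp add: algebra_simps)
        finally show ?thesis .
      qed
      have "1 - x ^ m \<noteq> 0" using one_minus_power_bounds[OF x assms(1)] by simp
      then show "(1 / x ^ p - 1) * root_kernel m i x = rat_comb letter_fun K x"
        using alg[of "x ^ p" "1 - x ^ m" "real m" "x ^ k"] x
        unfolding K(2)[OF x, symmetric] root_kernel_def eP i
        by (simp add: power_add mult_ac)
    qed (use K0 in auto)
  qed
qed

text \<open>Counterpart of \<open>cyclotomic_polylog\<close> over the kernels. No logarithmic clause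
  is present, because \<open>regular_indices\<close> forbids index 0 in the innermost place.\<close>

fun iterated_kernel :: "nat \<Rightarrow> nat list \<Rightarrow> real \<Rightarrow> real" where
  "iterated_kernel m [] x = 1"
| "iterated_kernel m (i # is) x = integral {0..x} (\<lambda>y. root_kernel m i y * iterated_kernel m is y)"

definition regular_indices :: "nat \<Rightarrow> nat list \<Rightarrow> bool" where
  "regular_indices m is \<longleftrightarrow> set is \<subseteq> {..m} \<and> (is \<noteq> [] \<longrightarrow> last is \<noteq> 0)"

lemma iterated_kernel_rat_comb:
  assumes "m > 0" "regular_indices m is"
  obtains L where
    "\<forall>w\<in>snd ` set L. (if is = [] then w = [] else regular_word w)"
    "\<forall>x::real. 0 < x \<longrightarrow> x < 1 \<longrightarrow> iterated_kernel m is x = rat_comb cyclotomic_polylog L x"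
  using assms(2)
proof (induction "is" arbitrary: thesis)
  case Nil
  show ?case by (rule Nil(1)[of "[(1, [])]"]) (simp_all add: rat_comb_def)
next
  case (Cons i "is")
  have ri: "regular_indices m is"
    using Cons.prems by (auto simp: regular_indices_def split: if_splits)
  obtain L where L:
    "\<forall>w\<in>snd ` set L. (if is = [] then w = [] else regular_word w)"
    "\<forall>x::real. 0 < x \<longrightarrow> x < 1 \<longrightarrow> iterated_kernel m is x = rat_comb cyclotomic_polylog L x"
    by (rule Cons.IH[OF _ ri])
  note L = L[rule_format]
  have "i \<le> m" using Cons.prems by (auto simp: regular_indices_def)
  then obtain K where K:
    "\<forall>l\<in>snd ` set K. l \<in> cyclotomic_letters \<and> (i > 0 \<longrightarrow> l \<noteq> (0, 0))"
    "\<forall>x::real. 0 < x \<longrightarrow> x < 1 \<longrightarrow> root_kernel m i x = rat_comb letter_fun K x"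
    by (rule kernel_rat_comb[OF assms(1)])
  note K = K[rule_format]
  have reg: "regular_word (l # w)" if "(r, l) \<in> set K" "(q, w) \<in> set L" for r l q w
  proof -
    have "l \<in> snd ` set K" "w \<in> snd ` set L" using that by force+
    from K(1)[OF this(1)] L(1)[OF this(2)] show ?thesis
      using Cons.prems(2) by (auto simp: regular_word_def regular_indices_def split: if_splits)
  qed
  define M where "M = concat (map (\<lambda>(r, l). map (\<lambda>(q, w). (r * q, l # w)) L) K)"
  show ?case
  proof (rule Cons.prems(1)[of M]; intro allI impI ballI)
    show "if i # is = [] then w = [] else regular_word w" if "w \<in> snd ` set M" for w
      using that reg by (auto simp: M_def)
    fix x :: real assume x: "0 < x" "x < 1"
    have "((\<lambda>y. rat_comb letter_fun K y * rat_comb cyclotomic_polylog L y) has_integral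
      (\<Sum>(r, l)\<leftarrow>K. \<Sum>(q, w)\<leftarrow>L. of_rat (r * q) * cyclotomic_polylog (l # w) x)) {0..x}"
      by (intro rat_comb_mult_has_integral polylog_has_integral reg x)
    then have "((\<lambda>y. root_kernel m i y * iterated_kernel m is y) has_integral
      (\<Sum>(r, l)\<leftarrow>K. \<Sum>(q, w)\<leftarrow>L. of_rat (r * q) * cyclotomic_polylog (l # w) x)) {0..x}"
      by (rule has_integral_spike_finite[of "{0}", rotated 2]) (use x K L in auto)
    then show "iterated_kernel m (i # is) x = rat_comb cyclotomic_polylog M x"
      unfolding rat_comb_product M_def by (simp add: integral_unique)
  qed
qed

lemma continuous_on_root_kernel:
  assumes "m > 0"
  shows "continuous_on {0<..<1} (root_kernel m i)"
proof -
  have "x * (1 - x ^ m) \<noteq> 0" if "x \<in> {0<..<1}" for x :: real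
    using one_minus_power_bounds(3)[of x m] assms that by simp
  then show ?thesis unfolding root_kernel_def by (intro continuous_intros) auto
qed

lemma dominated_kernel:
  assumes "m > 0" "i > 0"
  shows "dominated (\<lambda>x. 1 / (1 - x)) (root_kernel m i)"
proof (rule dominatedI[of _ "real m"])
  show "continuous_on {0<..<1} (root_kernel m i)"
    by (rule continuous_on_root_kernel[OF assms(1)])
  fix x :: real assume x: "0 < x" "x < 1"
  note b = one_minus_power_bounds[OF x assms(1)]
  have "x ^ i = x ^ (i - 1) * x" using assms(2) by (rule power_pred)
  then have "\<bar>root_kernel m i x\<bar> = real m * (x ^ (i - 1) / (1 - x ^ m))"
    using x b by (simp add: root_kernel_def abs_mult)
  also have "\<dots> \<le> real m * (1 / (1 - x))"
    using x b by (intro mult_left_mono frac_le) (simp_all add: power_le_one)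
  finally show "\<bar>root_kernel m i x\<bar> \<le> real m * (1 / (1 - x))" .
qed

lemma dominated_kernel_0:
  assumes "m > 0"
  shows "dominated (\<lambda>x. 1 / (x * (1 - x))) (root_kernel m i)"
proof (rule dominatedI[of _ "real m"])
  show "continuous_on {0<..<1} (root_kernel m i)"
    by (rule continuous_on_root_kernel[OF assms(1)])
  fix x :: real assume x: "0 < x" "x < 1"
  note b = one_minus_power_bounds[OF x assms(1)]
  have "\<bar>root_kernel m i x\<bar> = real m * (x ^ i / (x * (1 - x ^ m)))"
    using x b by (simp add: root_kernel_def abs_mult)
  also have "\<dots> \<le> real m * (1 / (x * (1 - x)))"
    using x b by (intro mult_left_mono frac_le mult_pos_pos) (simp_all add: power_le_one)
  finally show "\<bar>root_kernel m i x\<bar> \<le> real m * (1 / (x * (1 - x)))" .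
qed

lemma regular_indices_ConsD: "regular_indices m (i # is) \<Longrightarrow> regular_indices m is"
  by (auto simp: regular_indices_def split: if_splits)

text \<open>The crude kernel bound \<open>1 / (x (1 - x))\<close> suffices: multiplied by the order
  \<open>x / sqrt (1 - x)\<close> of the inner integral it is exactly
  \<open>weight_mild\<close>.\<close>

lemma dominated_kernel_mult_iterated:
  assumes "m > 0" "regular_indices m (i # is)"
  shows "dominated weight_mild (\<lambda>y. root_kernel m i y * iterated_kernel m is y)"
  using assms(2)
proof (induction "is" arbitrary: i)
  case Nil
  then have "i > 0" by (simp add: regular_indices_def)
  from dominated_kernel[OF assms(1) this] have "dominated weight_mild (root_kernel m i)"
  proof (rule dominated_mono)
    fix x :: real assume x: "0 < x" "x < 1"
    then have "(1 - x) * sqrt (1 - x) \<le> 1 - x" by (intro mult_left_le) auto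
    then show "1 / (1 - x) \<le> weight_mild x"
      using x unfolding weight_mild_def by (intro divide_left_mono mult_pos_pos) auto
  qed auto
  then show ?case by simp
next
  case (Cons j "is")
  have "dominated weight_tame (iterated_kernel m (j # is))"
    unfolding iterated_kernel.simps
    by (rule mild_integral_tame[OF Cons.IH[OF regular_indices_ConsD[OF Cons.prems]]])
  from dominated_mult[OF dominated_kernel_0[OF assms(1)] this] show ?case
    by (rule dominated_cong) (auto simp: weight_mild_def weight_tame_def)
qed

lemma kernel_nonneg:
  assumes "m > 0" "0 < x" "x < 1"
  shows "root_kernel m i x \<ge> 0"
  using one_minus_power_bounds(3)[OF assms(2,3,1)] assms by (simp add: root_kernel_def)

lemma iterated_kernel_nonneg:
  assumes "m > 0" "regular_indices m is" "0 < x" "x < 1"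
  shows "iterated_kernel m is x \<ge> 0"
  using assms(2-)
proof (induction "is" arbitrary: x)
  case (Cons i "is")
  have "(\<lambda>y. root_kernel m i y * iterated_kernel m is y) integrable_on {0..x}"
    using Cons.prems assms(1) by (intro mild_integrable dominated_kernel_mult_iterated) auto
  then have "0 \<le> integral {0<..<x} (\<lambda>y. root_kernel m i y * iterated_kernel m is y)"
    using Cons.prems assms(1) Cons.IH[OF regular_indices_ConsD[OF Cons.prems(1)]]
    by (intro integral_nonneg) (auto simp: integrable_on_Icc_iff_Ioo intro!: mult_nonneg_nonneg kernel_nonneg)
  then show ?case by (simp add: integral_open_interval_real)
qed simp

text \<open>The factor \<open>1 / x^p - 1\<close> removes the pole at one, so no word starts with
  \<open>(1, 0)\<close> and each has a value at one. The condition on empty \<open>is\<close>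
  prevents the one-letter word \<open>(0, 0)\<close>.\<close>

lemma integral_kernel_mult_iterated_expressible:
  assumes "m > 0" "1 \<le> p" "p \<le> i" "i \<le> m" "regular_indices m is" "is = [] \<Longrightarrow> i > p"
  shows "(\<lambda>x. (1 / x ^ p - 1) * (root_kernel m i x * iterated_kernel m is x)) integrable_on {0..1}"
    "integral {0..1} (\<lambda>x. (1 / x ^ p - 1) * (root_kernel m i x * iterated_kernel m is x))
       \<in> cyclotomic_expressible"
proof -
  obtain L where L:
    "\<forall>w\<in>snd ` set L. (if is = [] then w = [] else regular_word w)"
    "\<forall>x::real. 0 < x \<longrightarrow> x < 1 \<longrightarrow> iterated_kernel m is x = rat_comb cyclotomic_polylog L x"
    by (rule iterated_kernel_rat_comb[OF assms(1,5)])
  note L = L[rule_format]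
  obtain K where K:
    "\<forall>l\<in>snd ` set K. l \<in> cyclotomic_letters \<and> l \<noteq> (1, 0) \<and> (i > p \<longrightarrow> l \<noteq> (0, 0))"
    "\<forall>x::real. 0 < x \<longrightarrow> x < 1 \<longrightarrow> (1 / x ^ p - 1) * root_kernel m i x = rat_comb letter_fun K x"
    by (rule kernel_mult_rat_comb[OF assms(1-4)])
  note K = K[rule_format]
  have reg: "regular_word (l # w)" "l \<noteq> (1, 0)" if "(r, l) \<in> set K" "(q, w) \<in> set L" for r l q w
  proof -
    have "l \<in> snd ` set K" "w \<in> snd ` set L" using that by force+
    from K(1)[OF this(1)] L(1)[OF this(2)] show "regular_word (l # w)" "l \<noteq> (1, 0)"
      using assms(6) by (auto simp: regular_word_def split: if_splits)
  qed
  let ?I = "\<lambda>l w. integral {0..1} (\<lambda>y. letter_fun l y * cyclotomic_polylog w y)"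
  have "((\<lambda>y. rat_comb letter_fun K y * rat_comb cyclotomic_polylog L y) has_integral
      (\<Sum>(r, l)\<leftarrow>K. \<Sum>(q, w)\<leftarrow>L. of_rat (r * q) * ?I l w)) {0..1}"
    using reg
    by (intro rat_comb_mult_has_integral integrable_integral half_integrable
        dominated_letter_fun_mult_polylog) auto
  then have *: "((\<lambda>x. (1 / x ^ p - 1) * (root_kernel m i x * iterated_kernel m is x)) has_integral
      (\<Sum>(r, l)\<leftarrow>K. \<Sum>(q, w)\<leftarrow>L. of_rat (r * q) * ?I l w)) {0..1}"
    by (rule has_integral_spike_finite[of "{0, 1}", rotated 2])
       (use K L in \<open>auto simp flip: mult.assoc\<close>)
  show "(\<lambda>x. (1 / x ^ p - 1) * (root_kernel m i x * iterated_kernel m is x)) integrable_on {0..1}"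
    using * by blast
  have "(\<Sum>(r, l)\<leftarrow>K. \<Sum>(q, w)\<leftarrow>L. of_rat (r * q) * ?I l w) \<in> cyclotomic_expressible"
  proof (intro expressible_sum_list, clarify, intro expressible_sum_list, clarify)
    fix r a b q w assume "(r, a, b) \<in> set K" "(q, w) \<in> set L"
    then show "of_rat (r * q) * ?I (a, b) w \<in> cyclotomic_expressible"
      by (intro cyclotomic_expressible.mult of_rat_expressible polylog_at_one reg)
  qed
  then show "integral {0..1} (\<lambda>x. (1 / x ^ p - 1) * (root_kernel m i x * iterated_kernel m is x))
       \<in> cyclotomic_expressible"
    using * by (simp add: integral_unique)
qed

section \<open>Moments and Abel summation\<close>

text \<open>A positive limit would make the series dominate a multiple of the harmonic
  series.\<close>

lemma decseq_tendsto_0_of_summable_harmonic: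
  fixes w :: "nat \<Rightarrow> real"
  assumes "decseq w" "\<And>n. w n \<ge> 0" "summable (\<lambda>n. w n / real (Suc n))"
  shows "w \<longlonglongrightarrow> 0"
proof -
  obtain L where L: "w \<longlonglongrightarrow> L" "\<And>n. L \<le> w n"
    using decseq_convergent[OF assms(1), of 0] assms(2) by auto
  have "L \<ge> 0" using L(1) assms(2) by (intro LIMSEQ_le_const) auto
  moreover have "\<not> L > 0"
  proof
    assume "L > 0"
    have "summable (\<lambda>n. L / real (Suc n))"
      by (rule summable_comparison_test'[OF assms(3), of 0])
         (use \<open>L > 0\<close> L(2) in \<open>auto intro!: divide_right_mono\<close>)
    then have "summable (\<lambda>n. L * inverse (real (Suc n)))"
      by (simp add: divide_inverse)
    then have "summable (\<lambda>n. inverse (real (Suc n)))"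
      using \<open>L > 0\<close> by (subst (asm) summable_cmult_iff) auto
    then have "summable (\<lambda>n. inverse (real n))" by (rule iffD1[OF summable_Suc_iff])
    then show False using not_summable_harmonic[where 'a = real] by simp
  qed
  ultimately show ?thesis using L(1) by (cases "L = 0") auto
qed

text \<open>Tannery's theorem: \<open>w n <= w k\<close> for \<open>k <= n\<close>, so the
  convergent series of \<open>b k * w k\<close> dominates uniformly in \<open>n\<close>.\<close>

lemma partial_sums_mult_tendsto_0:
  fixes b w :: "nat \<Rightarrow> real"
  assumes "\<And>n. b n \<ge> 0" "decseq w" "\<And>n. w n \<ge> 0" "w \<longlonglongrightarrow> 0" "summable (\<lambda>n. b n * w n)"
  shows "(\<lambda>n. (\<Sum>i\<le>n. b i) * w n) \<longlonglongrightarrow> 0"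
proof -
  define a where "a = (\<lambda>k n. if k \<le> n then b k * w n else 0)"
  have "((\<lambda>n. suminf (\<lambda>k. a k n)) \<longlongrightarrow> suminf (\<lambda>k. 0 :: real)) sequentially"
  proof (rule conjunct2[OF conjunct2[OF tannerys_theorem]])
    show "((\<lambda>n. a k n) \<longlongrightarrow> 0) sequentially" for k
    proof -
      have "(\<lambda>n. b k * w n) \<longlonglongrightarrow> b k * 0" by (intro tendsto_intros assms)
      moreover have "eventually (\<lambda>n. b k * w n = a k n) sequentially"
        using eventually_ge_at_top[of k] by eventually_elim (simp add: a_def)
      ultimately show ?thesis by (auto intro: Lim_transform_eventually)
    qed
    show "\<forall>\<^sub>F (k, n) in sequentially \<times>\<^sub>F sequentially. norm (a k n) \<le> b k * w k"
      using assms decseqD[OF assms(2)]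
      by (intro always_eventually) (auto simp: a_def abs_mult intro!: mult_left_mono)
  qed (use assms in auto)
  moreover have "suminf (\<lambda>k. a k n) = (\<Sum>i\<le>n. b i) * w n" for n
  proof -
    have "suminf (\<lambda>k. a k n) = (\<Sum>k\<le>n. a k n)"
      by (rule suminf_finite) (auto simp: a_def)
    then show ?thesis by (simp add: a_def sum_distrib_right)
  qed
  ultimately show ?thesis by simp
qed

lemma abel_summation_sums:
  fixes b w :: "nat \<Rightarrow> real"
  assumes "\<And>n. b n \<ge> 0" "decseq w" "\<And>n. w n \<ge> 0" "w \<longlonglongrightarrow> 0" "(\<lambda>n. b n * w n) sums s"
  shows "(\<lambda>n. (\<Sum>i\<le>n. b i) * (w n - w (Suc n))) sums s"
proof -
  have parts: "(\<Sum>n\<le>N. (\<Sum>i\<le>n. b i) * (w n - w (Suc n))) =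
      (\<Sum>n\<le>N. b n * w n) - (\<Sum>i\<le>N. b i) * w (Suc N)" for N
    by (induction N) (simp_all add: algebra_simps)
  have lim: "(\<lambda>n. (\<Sum>i\<le>n. b i) * w n) \<longlonglongrightarrow> 0"
    using assms by (intro partial_sums_mult_tendsto_0) (auto simp: sums_iff)
  have "(\<lambda>n. (\<Sum>i\<le>n. b i) * w (Suc n)) \<longlonglongrightarrow> 0"
  proof (rule Lim_null_comparison[OF _ lim], intro always_eventually allI)
    fix n
    show "norm ((\<Sum>i\<le>n. b i) * w (Suc n)) \<le> (\<Sum>i\<le>n. b i) * w n"
      using assms(1,3) decseqD[OF assms(2), of n "Suc n"]
      by (auto simp: abs_mult sum_nonneg intro!: mult_left_mono)
  qed
  moreover have "(\<lambda>N. \<Sum>n\<le>N. b n * w n) \<longlonglongrightarrow> s" using assms(5) by (simp add: sums_def_le)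
  ultimately have "(\<lambda>N. (\<Sum>n\<le>N. b n * w n) - (\<Sum>i\<le>N. b i) * w (Suc N)) \<longlonglongrightarrow> s - 0"
    by (intro tendsto_diff)
  then show ?thesis unfolding sums_def_le parts[symmetric] by simp
qed

lemma multi_harmonic_Cons_Suc:
  "multi_harmonic (c # cs) (Suc n) = (\<Sum>i\<le>n. multi_harmonic cs (Suc i) / real (Suc i) ^ c)"
  by (induction n) (simp_all del: of_nat_Suc)

lemma multi_harmonic_nonneg: "multi_harmonic cs n \<ge> 0"
  by (induction cs arbitrary: n) (auto intro!: sum_nonneg)

section \<open>Moments and the binomial coefficients for the parameter \<open>p/m\<close>\<close>

locale root_sum =
  fixes m p :: nat
  assumes p_pos: "1 \<le> p" and p_le: "p \<le> m"
begin

lemma m_pos: "m > 0"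
  using p_pos p_le by simp

definition coef :: "nat \<Rightarrow> real" where
  "coef n = pochhammer (real p / real m) n / fact n"

lemma coef_0: "coef 0 = 1"
  by (simp add: coef_def)

lemma coef_pos: "coef n > 0"
  unfolding coef_def using p_pos m_pos by (intro divide_pos_pos pochhammer_pos) auto

lemma Suc_coef_Suc: "real (Suc n) * coef (Suc n) = (real n + real p / real m) * coef n"
  by (simp add: coef_def pochhammer_Suc fact_Suc field_simps del: of_nat_Suc)

lemma coef_sums:
  assumes "0 < x" "x < 1"
  shows "(\<lambda>n. coef n * (1 - x ^ m) ^ n) sums (1 / x ^ p)"
proof -
  note b = one_minus_power_bounds[OF assms m_pos]
  have "x ^ m > 0" using assms by simp
  then have "\<bar>- (1 - x ^ m)\<bar> < 1" using b by simp
  from gen_binomial_real[OF this, of "- (real p / real m)"]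
  have "(\<lambda>n. ((- (real p / real m)) gchoose n) * (- (1 - x ^ m)) ^ n) sums
      (x ^ m) powr (- (real p / real m))" by simp
  also have "(\<lambda>n. ((- (real p / real m)) gchoose n) * (- (1 - x ^ m)) ^ n) =
      (\<lambda>n. coef n * (1 - x ^ m) ^ n)"
    by (auto simp: fun_eq_iff gbinomial_pochhammer coef_def power_minus[of "1 - x ^ m"]
        simp flip: power_mult_distrib)
  also have "(x ^ m) powr (- (real p / real m)) = 1 / x ^ p"
    using assms m_pos by (simp add: powr_powr powr_minus_divide flip: powr_realpow)
  finally show ?thesis .
qed

text \<open>Multiplying by \<open>coef n\<close> and summing over \<open>n\<close> turns moments into integrals by the binomial
  series; the substitution \<open>1 - x ^ m\<close> removes its fractional exponent.\<close>

definition moment :: "nat \<Rightarrow> nat list \<Rightarrow> nat \<Rightarrow> real" where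
  "moment i is n =
    integral {0..1} (\<lambda>x. (1 - x ^ m) ^ n * (root_kernel m i x * iterated_kernel m is x))"

lemma one_minus_power_power_le:
  fixes x :: real
  assumes "0 < x" "x < 1" "n > 0"
  shows "\<bar>(1 - x ^ m) ^ n\<bar> \<le> real m * (1 - x)"
proof -
  note b = one_minus_power_bounds[OF assms(1,2) m_pos]
  have "(1 - x ^ m) ^ n \<le> (1 - x ^ m) ^ 1"
    using assms b by (intro power_decreasing) auto
  then show ?thesis using b by simp
qed

text \<open>For \<open>n > 0\<close> the factor \<open>(1 - x^m)^n\<close> vanishes at one and
  lowers the order there to one half. At \<open>n = 0\<close> the integral may diverge, hence all
  series below start at \<open>Suc n\<close>.\<close>

lemma moment_integrable:
  assumes "regular_indices m (i # is)" "n > 0"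
  shows "(\<lambda>x. (1 - x ^ m) ^ n * (root_kernel m i x * iterated_kernel m is x)) integrable_on {0..1}"
  by (rule integral_by_parts_vanishing(1)[where B = "real m" and
        A' = "\<lambda>x. real n * (1 - x ^ m) ^ (n - 1) * (- (real m * x ^ (m - 1)))"])
     (auto intro!: derivative_eq_intros continuous_intros dominated_kernel_mult_iterated
        one_minus_power_power_le assms m_pos)

lemma moment_nonneg:
  assumes "regular_indices m (i # is)" "n > 0"
  shows "moment i is n \<ge> 0"
proof -
  have "(\<lambda>x. (1 - x ^ m) ^ n * (root_kernel m i x * iterated_kernel m is x)) integrable_on {0<..<1}"
    using moment_integrable[OF assms] by (simp add: integrable_on_Icc_iff_Ioo)
  then have "0 \<le> integral {0<..<1} (\<lambda>x. (1 - x ^ m) ^ n * (root_kernel m i x * iterated_kernel m is x))"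
  proof (rule integral_nonneg)
    fix x :: real assume "x \<in> {0<..<1}"
    then show "0 \<le> (1 - x ^ m) ^ n * (root_kernel m i x * iterated_kernel m is x)"
      using one_minus_power_bounds(3)[of x m] regular_indices_ConsD[OF assms(1)] m_pos
      by (intro mult_nonneg_nonneg kernel_nonneg iterated_kernel_nonneg) auto
  qed
  then show ?thesis unfolding moment_def by (simp add: integral_open_interval_real)
qed

text \<open>The operator \<open>D\<close> of the overview: the derivative of
  \<open>(1 - x^m)^n\<close> is \<open>- n (1 - x^m)^n\<close> times the kernel of index
  \<open>m\<close>, so \<open>D h\<close> is that kernel times the primitive of
  \<open>h\<close>.\<close>

lemma moment_divide:
  assumes "regular_indices m (i # is)" "n > 0"
  shows "moment i is n = real n * moment m (i # is) n"
proof -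
  let ?f = "\<lambda>x. root_kernel m i x * iterated_kernel m is x"
  have "moment i is n = - integral {0..1}
      (\<lambda>x. (real n * (1 - x ^ m) ^ (n - 1) * (- (real m * x ^ (m - 1)))) * integral {0..x} ?f)"
    unfolding moment_def
    by (rule integral_by_parts_vanishing(2)[where B = "real m"])
       (auto intro!: derivative_eq_intros continuous_intros dominated_kernel_mult_iterated
          one_minus_power_power_le assms m_pos)
  also have "\<dots> = - integral {0<..<1}
      (\<lambda>x. (real n * (1 - x ^ m) ^ (n - 1) * (- (real m * x ^ (m - 1)))) * integral {0..x} ?f)"
    by (simp add: integral_open_interval_real)
  also have "integral {0<..<1}
      (\<lambda>x. (real n * (1 - x ^ m) ^ (n - 1) * (- (real m * x ^ (m - 1)))) * integral {0..x} ?f) =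
    integral {0<..<1} (\<lambda>x. - real n *
      ((1 - x ^ m) ^ n * (root_kernel m m x * iterated_kernel m (i # is) x)))"
  proof (rule integral_cong)
    fix x :: real assume "x \<in> {0<..<1}"
    then have x: "0 < x" "x < 1" by auto
    note b = one_minus_power_bounds[OF x m_pos]
    have "root_kernel m m x = real m * x ^ (m - 1) / (1 - x ^ m)"
      unfolding root_kernel_def power_pred[OF m_pos, of x] using x by simp
    then have "(1 - x ^ m) ^ n * root_kernel m m x = (1 - x ^ m) ^ (n - 1) * (real m * x ^ (m - 1))"
      unfolding power_pred[OF assms(2), of "1 - x ^ m"] using b by simp
    then have "- real n * ((1 - x ^ m) ^ n * root_kernel m m x) * integral {0..x} ?f =
       - real n * ((1 - x ^ m) ^ (n - 1) * (real m * x ^ (m - 1))) * integral {0..x} ?f" by simp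
    then show "(real n * (1 - x ^ m) ^ (n - 1) * (- (real m * x ^ (m - 1)))) * integral {0..x} ?f =
       - real n * ((1 - x ^ m) ^ n * (root_kernel m m x * iterated_kernel m (i # is) x))"
      by (simp only: iterated_kernel.simps mult_minus_left mult_minus_right mult.assoc)
  qed
  also have "\<dots> = - real n * moment m (i # is) n"
    unfolding moment_def by (simp add: integral_open_interval_real del: iterated_kernel.simps)
  finally show ?thesis by simp
qed

text \<open>The integration by parts behind the recurrence uses
  \<open>(x^p (1 - x^m)^n)' = m x^(p-1) ((n + p/m) (1 - x^m)^n - n (1 - x^m)^(n-1))\<close>.\<close>

lemma moment_recurrence:
  assumes "regular_indices m ((i - p) # is)" "p \<le> i" "n > 0"
  shows "real n * moment p ((i - p) # is) n -
      (real n + real p / real m) * moment p ((i - p) # is) (Suc n) = moment i is n"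
proof -
  let ?f = "\<lambda>x. root_kernel m (i - p) x * iterated_kernel m is x"
  let ?J = "iterated_kernel m ((i - p) # is)"
  define A' where "A' = (\<lambda>x. real p * x ^ (p - 1) * (1 - x ^ m) ^ n +
      x ^ p * (real n * (1 - x ^ m) ^ (n - 1) * (- (real m * x ^ (m - 1)))))"
  have "integral {0..1} (\<lambda>x. (x ^ p * (1 - x ^ m) ^ n) * ?f x) =
      - integral {0..1} (\<lambda>x. A' x * integral {0..x} ?f)"
  proof (rule integral_by_parts_vanishing(2)[where B = "real m"])
    show "dominated weight_mild ?f" using assms m_pos by (intro dominated_kernel_mult_iterated)
    show "((\<lambda>x. x ^ p * (1 - x ^ m) ^ n) has_real_derivative A' x) (at x)" for x
      unfolding A'_def by (auto intro!: derivative_eq_intros)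
    show "continuous_on UNIV A'" unfolding A'_def by (intro continuous_intros)
    fix x :: real assume x: "0 < x" "x < 1"
    have "\<bar>x ^ p * (1 - x ^ m) ^ n\<bar> \<le> 1 * \<bar>(1 - x ^ m) ^ n\<bar>"
      unfolding abs_mult using x by (intro mult_right_mono) (auto simp: power_le_one)
    then show "\<bar>x ^ p * (1 - x ^ m) ^ n\<bar> \<le> real m * (1 - x)"
      using one_minus_power_power_le[OF x assms(3)] by linarith
  qed
  \<comment> \<open>Dividing by \<open>x^p\<close> lowers a kernel index by \<open>p\<close>. Thus
    \<open>E h\<close> is the kernel of index \<open>p\<close> times the primitive of
    \<open>h / x^p\<close>.\<close>
  also have "(\<lambda>x. (x ^ p * (1 - x ^ m) ^ n) * ?f x) =
      (\<lambda>x. (1 - x ^ m) ^ n * (root_kernel m i x * iterated_kernel m is x))"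
  proof
    fix x :: real
    have "x ^ i = x ^ p * x ^ (i - p)" using assms(2) by (simp flip: power_add)
    then show "(x ^ p * (1 - x ^ m) ^ n) * ?f x =
        (1 - x ^ m) ^ n * (root_kernel m i x * iterated_kernel m is x)"
      by (simp add: root_kernel_def)
  qed
  also have "integral {0..1} \<dots> = moment i is n" by (simp add: moment_def)
  also have "- integral {0..1} (\<lambda>x. A' x * integral {0..x} ?f) =
      integral {0<..<1} (\<lambda>x. - (A' x * ?J x))"
    by (simp add: integral_open_interval_real)
  also have "\<dots> = integral {0<..<1} (\<lambda>x. real n * ((1 - x ^ m) ^ n * (root_kernel m p x * ?J x)) -
      (real n + real p / real m) * ((1 - x ^ m) ^ (Suc n) * (root_kernel m p x * ?J x)))"
  proof (rule integral_cong)
    fix x :: real assume "x \<in> {0<..<1}"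
    then have x: "0 < x" "x < 1" by auto
    note b = one_minus_power_bounds[OF x m_pos]
    define D Y X where "D = 1 - x ^ m" and "Y = x ^ (p - 1)" and "X = D ^ (n - 1)"
    have D: "D \<noteq> 0" "x ^ m = 1 - D" using b by (auto simp: D_def)
    have pow: "x ^ p = Y * x" "D ^ n = X * D" "D ^ Suc n = X * D * D"
      using power_pred[of p x] power_pred[of n D] p_pos assms(3) by (auto simp: Y_def X_def mult_ac)
    have xm: "x * x ^ (m - 1) = 1 - D" using power_pred[OF m_pos, of x] D by (simp add: mult.commute)
    have kp: "root_kernel m p x = real m * Y / D"
      using x by (simp add: root_kernel_def pow flip: D_def)
    have "A' x = real p * Y * D ^ n + x ^ p * (real n * X * (- (real m * x ^ (m - 1))))"
      unfolding A'_def D_def Y_def X_def ..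
    also have "\<dots> = real p * Y * (X * D) + Y * real n * X * (- real m * (x * x ^ (m - 1)))"
      unfolding pow by (simp add: mult_ac)
    also have "\<dots> = real p * Y * X * D - real n * real m * Y * X * (1 - D)"
      unfolding xm by (simp add: algebra_simps)
    finally have A': "A' x = real p * Y * X * D - real n * real m * Y * X * (1 - D)" .
    have "real n * ((1 - x ^ m) ^ n * root_kernel m p x) -
      (real n + real p / real m) * ((1 - x ^ m) ^ (Suc n) * root_kernel m p x) = - A' x"
    proof -
      have 1: "X * D * (real m * Y / D) = X * real m * Y"
        and 2: "X * D * D * (real m * Y / D) = X * D * (real m * Y)"
        using D(1) by simp_all
      have 3: "real p / real m * (X * D * (real m * Y)) = real p * (X * D * Y)"
        using m_pos by simp
      show ?thesis
        unfolding kp A' D_def[symmetric] pow 1 2 distrib_right[of "real n"] 3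
        by (simp add: algebra_simps)
    qed
    then have "(real n * ((1 - x ^ m) ^ n * root_kernel m p x) -
      (real n + real p / real m) * ((1 - x ^ m) ^ (Suc n) * root_kernel m p x)) * ?J x = - A' x * ?J x"
      by (simp only:)
    then show "- (A' x * ?J x) = real n * ((1 - x ^ m) ^ n * (root_kernel m p x * ?J x)) -
      (real n + real p / real m) * ((1 - x ^ m) ^ (Suc n) * (root_kernel m p x * ?J x))"
      by (simp only: left_diff_distrib mult.assoc mult_minus_left)
  qed
  also have "\<dots> = integral {0..1} (\<lambda>x. real n * ((1 - x ^ m) ^ n * (root_kernel m p x * ?J x)) -
      (real n + real p / real m) * ((1 - x ^ m) ^ (Suc n) * (root_kernel m p x * ?J x)))"
    by (simp only: integral_open_interval_real)
  also have "\<dots> = real n * moment p ((i - p) # is) n -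
      (real n + real p / real m) * moment p ((i - p) # is) (Suc n)"
  proof -
    have "regular_indices m (p # (i - p) # is)"
      using assms(1) p_le by (auto simp: regular_indices_def)
    then show ?thesis
      unfolding moment_def using assms(3)
      by (subst integral_diff) (auto intro!: integrable_on_mult_right moment_integrable
          simp del: iterated_kernel.simps power_Suc)
  qed
  finally show ?thesis by simp
qed

text \<open>An invariant of both operators: \<open>p <= i\<close> permits division by
  \<open>x^p\<close>, and the last clause keeps the resulting index \<open>i - p\<close> from being
  0 in the innermost place.\<close>

definition admissible :: "nat \<Rightarrow> nat list \<Rightarrow> bool" where
  "admissible i is \<longleftrightarrow> p \<le> i \<and> i \<le> m \<and> regular_indices m is \<and> (is = [] \<longrightarrow> i > p)"

lemma admissible_regular: "admissible i is \<Longrightarrow> regular_indices m (i # is)"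
  using p_pos by (auto simp: admissible_def regular_indices_def)

lemma admissible_divide: "admissible i is \<Longrightarrow> admissible m (i # is)"
  using admissible_regular[of i "is"] p_le by (auto simp: admissible_def)

lemma admissible_step: "admissible i is \<Longrightarrow> admissible p ((i - p) # is)"
  using p_le by (auto simp: admissible_def regular_indices_def)

lemma moment_divide_power:
  assumes "admissible i is"
  shows "\<exists>i' is'. admissible i' is' \<and> (\<forall>n>0. moment i is n = real n ^ k * moment i' is' n)"
proof (induction k)
  case 0
  then show ?case using assms by auto
next
  case (Suc k)
  then obtain i' is' where I: "admissible i' is'" "\<forall>n>0. moment i is n = real n ^ k * moment i' is' n"
    by blast
  have "\<forall>n>0. moment i is n = real n ^ Suc k * moment m (i' # is') n"
    using I moment_divide[OF admissible_regular[OF I(1)]] by (auto simp: mult_ac)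
  then show ?case using admissible_divide[OF I(1)] by blast
qed

text \<open>All terms are nonnegative, so the limit \<open>g\<close> itself dominates the partial
  sums and sum and integral can be exchanged.\<close>

lemma coef_moment_sums:
  assumes "admissible i is"
  obtains s where "s \<in> cyclotomic_expressible" "(\<lambda>n. coef (Suc n) * moment i is (Suc n)) sums s"
proof -
  let ?h = "\<lambda>x. root_kernel m i x * iterated_kernel m is x"
  define g where "g = (\<lambda>x. (1 / x ^ p - 1) * ?h x)"
  define F where "F = (\<lambda>N x. (\<Sum>n<N. coef (Suc n) * ((1 - x ^ m) ^ Suc n * ?h x)))"
  have g: "g integrable_on {0..1}" "integral {0..1} g \<in> cyclotomic_expressible"
    using integral_kernel_mult_iterated_expressible[OF m_pos p_pos, of i "is"] assms
    by (auto simp: admissible_def g_def)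
  have "(\<lambda>N. integral {0<..<1} (F N)) \<longlonglongrightarrow> integral {0<..<1} g"
  proof (rule dominated_convergence(2))
    show "F N integrable_on {0<..<1}" for N
      unfolding F_def using moment_integrable[OF admissible_regular[OF assms]]
      by (intro integrable_sum integrable_on_mult_right)
         (auto simp: integrable_on_Icc_iff_Ioo[symmetric] simp del: power_Suc)
    show "g integrable_on {0<..<1}" using g by (simp add: integrable_on_Icc_iff_Ioo)
    fix x :: real assume "x \<in> {0<..<1}"
    then have x: "0 < x" "x < 1" by auto
    note b = one_minus_power_bounds[OF x m_pos]
    have h: "?h x \<ge> 0" using x assms m_pos
      by (intro mult_nonneg_nonneg kernel_nonneg iterated_kernel_nonneg) (auto simp: admissible_def)
    \<comment> \<open>Leaving out the term \<open>n = 0\<close>, where \<open>coef 0 = 1\<close>,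
      produces the \<open>- 1\<close> that cancels the pole at one.\<close>
    have "(\<lambda>n. coef (Suc n) * (1 - x ^ m) ^ Suc n) sums (1 / x ^ p - 1)"
      using coef_sums[OF x] by (subst sums_Suc_iff) (simp add: coef_0)
    then have s: "(\<lambda>n. coef (Suc n) * (1 - x ^ m) ^ Suc n * ?h x) sums g x"
      unfolding g_def by (intro sums_mult2)
    have F: "F N x = (\<Sum>n<N. coef (Suc n) * (1 - x ^ m) ^ Suc n * ?h x)" for N
      by (simp add: F_def mult.assoc del: power_Suc)
    show "(\<lambda>N. F N x) \<longlonglongrightarrow> g x" using s unfolding F sums_def .
    have nn: "coef (Suc n) * (1 - x ^ m) ^ Suc n * ?h x \<ge> 0" for n
      using coef_pos[of "Suc n"] b by (intro mult_nonneg_nonneg[OF _ h] mult_nonneg_nonneg) auto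
    show "norm (F N x) \<le> g x" for N
      using sum_le_suminf[OF sums_summable[OF s], of "{..<N}"] nn sums_unique[OF s]
      by (auto simp: F sum_nonneg simp del: power_Suc)
  qed
  moreover have "integral {0<..<1} (F N) = (\<Sum>n<N. coef (Suc n) * moment i is (Suc n))" for N
  proof -
    have "integral {0..1} (F N) = (\<Sum>n<N. coef (Suc n) * moment i is (Suc n))"
      unfolding F_def moment_def using moment_integrable[OF admissible_regular[OF assms]]
      by (subst integral_sum) (auto intro!: integrable_on_mult_right simp del: power_Suc)
    then show ?thesis by (simp add: integral_open_interval_real)
  qed
  ultimately have "(\<lambda>n. coef (Suc n) * moment i is (Suc n)) sums integral {0..1} g"
    by (simp add: sums_def integral_open_interval_real)
  with g(2) show ?thesis by (rule that)
qed

lemma harmonic_moment_sums: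
  assumes "admissible i is" "\<forall>k\<in>set cs. k \<ge> 1"
  shows "\<exists>s\<in>cyclotomic_expressible.
    (\<lambda>n. coef (Suc n) * multi_harmonic cs (Suc n) * moment i is (Suc n)) sums s"
  using assms
proof (induction cs arbitrary: i "is")
  case Nil
  then show ?case using coef_moment_sums[of i "is"] by auto
next
  case (Cons c cs)
  let ?j = "(i - p) # is"
  \<comment> \<open>The factor \<open>n * coef n\<close> makes \<open>Suc_coef_Suc\<close> turn the
    moment recurrence into a plain difference.\<close>
  define w where "w = (\<lambda>n. real (Suc n) * coef (Suc n) * moment p ?j (Suc n))"
  define b where "b = (\<lambda>n. multi_harmonic cs (Suc n) / real (Suc n) ^ c)"
  have adm: "admissible p ?j" by (rule admissible_step[OF Cons.prems(1)])
  have reg: "regular_indices m ?j" using adm by (simp add: admissible_def)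
  have w_diff: "w n - w (Suc n) = coef (Suc n) * moment i is (Suc n)" for n
  proof -
    have "p \<le> i" using Cons.prems(1) by (simp add: admissible_def)
    have "coef (Suc n) * moment i is (Suc n) = coef (Suc n) * (real (Suc n) * moment p ?j (Suc n) -
      (real (Suc n) + real p / real m) * moment p ?j (Suc (Suc n)))"
      using moment_recurrence[OF reg \<open>p \<le> i\<close>, of "Suc n"] by simp
    also have "\<dots> = w n - ((real (Suc n) + real p / real m) * coef (Suc n)) * moment p ?j (Suc (Suc n))"
      unfolding w_def by (simp add: algebra_simps del: of_nat_Suc)
    also have "\<dots> = w n - w (Suc n)"
      unfolding Suc_coef_Suc[symmetric] w_def ..
    finally show ?thesis by simp
  qed
  have w_nonneg: "w n \<ge> 0" for n
    unfolding w_def using coef_pos[of "Suc n"] moment_nonneg[OF admissible_regular[OF adm], of "Suc n"]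
    by auto
  have "decseq w"
    using w_diff coef_pos moment_nonneg[OF admissible_regular[OF Cons.prems(1)]]
    by (intro decseq_SucI) (smt (verit) mult_nonneg_nonneg zero_less_Suc)
  \<comment> \<open>Divided by \<open>n\<close>, the sequence \<open>w\<close> is again a moment
    series, already known to converge; with monotonicity this forces \<open>w\<close> to
    zero.\<close>
  have "summable (\<lambda>n. w n / real (Suc n))"
  proof -
    obtain s where "(\<lambda>n. coef (Suc n) * moment p ?j (Suc n)) sums s"
      by (rule coef_moment_sums[OF adm])
    then have "summable (\<lambda>n. coef (Suc n) * moment p ?j (Suc n))" by (simp add: sums_iff)
    then show ?thesis by (simp add: w_def)
  qed
  then have w_lim: "w \<longlonglongrightarrow> 0"
    using \<open>decseq w\<close> w_nonneg by (intro decseq_tendsto_0_of_summable_harmonic)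
  \<comment> \<open>One of the \<open>c\<close> powers of \<open>n\<close> is cancelled by the
    factor \<open>n\<close> in \<open>w\<close>; the other \<open>c - 1\<close> are absorbed by
    \<open>D\<close>.\<close>
  obtain i' is' where I: "admissible i' is'"
      "\<forall>n>0. moment p ?j n = real n ^ (c - 1) * moment i' is' n"
    using moment_divide_power[OF adm] by blast
  obtain s where s: "s \<in> cyclotomic_expressible"
      "(\<lambda>n. coef (Suc n) * multi_harmonic cs (Suc n) * moment i' is' (Suc n)) sums s"
    using Cons.IH[OF I(1)] Cons.prems(2) by auto
  have "b n * w n = coef (Suc n) * multi_harmonic cs (Suc n) * moment i' is' (Suc n)" for n
  proof -
    have "moment p ?j (Suc n) = real (Suc n) ^ (c - 1) * moment i' is' (Suc n)" using I(2) by blast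
    moreover have "real (Suc n) ^ c = real (Suc n) ^ (c - 1) * real (Suc n)"
      using Cons.prems(2) by (intro power_pred) auto
    ultimately show ?thesis by (simp add: b_def w_def del: of_nat_Suc)
  qed
  then have "(\<lambda>n. b n * w n) sums s" using s(2) by simp
  then have "(\<lambda>n. (\<Sum>i\<le>n. b i) * (w n - w (Suc n))) sums s"
    using \<open>decseq w\<close> w_nonneg w_lim multi_harmonic_nonneg
    by (intro abel_summation_sums) (auto simp: b_def)
  then have "(\<lambda>n. coef (Suc n) * multi_harmonic (c # cs) (Suc n) * moment i is (Suc n)) sums s"
    unfolding w_diff multi_harmonic_Cons_Suc b_def by (simp add: mult_ac)
  with s(1) show ?case by blast
qed

text \<open>For \<open>p = m\<close> all coefficients are one, and a factor \<open>1 / n\<close> does not make the series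
  converge.\<close>

definition order_min :: nat where
  "order_min = (if p < m then 1 else 2)"

lemma moment_Nil:
  assumes "n > 0"
  shows "moment m [] n = 1 / real n"
proof -
  have "((\<lambda>x. (1 - x ^ m) ^ (n - 1) * (real m * x ^ (m - 1))) has_integral
      (- ((1 - 1 ^ m) ^ n / real n) - - ((1 - 0 ^ m) ^ n / real n))) {0..1}"
  proof (rule fundamental_theorem_of_calculus)
    fix x :: real
    have "((\<lambda>x. - ((1 - x ^ m) ^ n / real n)) has_real_derivative
        (1 - x ^ m) ^ (n - 1) * (real m * x ^ (m - 1))) (at x within {0..1})"
      using assms by (auto intro!: derivative_eq_intros simp: field_simps)
    then show "((\<lambda>x. - ((1 - x ^ m) ^ n / real n)) has_vector_derivative
        (1 - x ^ m) ^ (n - 1) * (real m * x ^ (m - 1))) (at x within {0..1})"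
      by (simp add: has_real_derivative_iff_has_vector_derivative)
  qed simp
  then have "((\<lambda>x. (1 - x ^ m) ^ (n - 1) * (real m * x ^ (m - 1))) has_integral 1 / real n) {0..1}"
    using assms m_pos by (simp add: power_0_left)
  then have "((\<lambda>x. (1 - x ^ m) ^ n * (root_kernel m m x * iterated_kernel m [] x)) has_integral
      1 / real n) {0..1}"
  proof (rule has_integral_spike_finite[of "{0, 1}", rotated 2])
    fix x :: real assume "x \<in> {0..1} - {0, 1}"
    then have x: "0 < x" "x < 1" by auto
    note b = one_minus_power_bounds[OF x m_pos]
    have "root_kernel m m x = real m * x ^ (m - 1) / (1 - x ^ m)"
      unfolding root_kernel_def power_pred[OF m_pos, of x] using x by simp
    then show "(1 - x ^ m) ^ n * (root_kernel m m x * iterated_kernel m [] x) =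
        (1 - x ^ m) ^ (n - 1) * (real m * x ^ (m - 1))"
      unfolding power_pred[OF assms, of "1 - x ^ m"] using b by simp
  qed simp
  then show ?thesis unfolding moment_def by (rule integral_unique)
qed

text \<open>The kernel of index \<open>m\<close> has moment \<open>1 / n\<close>. For
  \<open>p = m\<close> it is not admissible, so the start is one application of \<open>D\<close>
  later, at \<open>1 / n^2\<close>; further powers come from \<open>D\<close>.\<close>

lemma harmonic_power_sums:
  assumes "\<forall>k\<in>set cs. k \<ge> 1" "e \<ge> order_min"
  shows "\<exists>s\<in>cyclotomic_expressible.
    (\<lambda>n. coef (Suc n) * multi_harmonic cs (Suc n) / real (Suc n) ^ e) sums s"
proof -
  obtain i "is" where I: "admissible i is" "\<forall>n>0. moment i is n = 1 / real n ^ order_min"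
  proof (cases "p < m")
    case True
    then show ?thesis
      using moment_Nil by (intro that[of m "[]"])
        (auto simp: admissible_def regular_indices_def order_min_def)
  next
    case False
    have reg: "regular_indices m [m]" using m_pos by (simp add: regular_indices_def)
    show ?thesis
    proof (rule that[of m "[m]"])
      show "admissible m [m]" using reg p_le by (simp add: admissible_def)
      show "\<forall>n>0. moment m [m] n = 1 / real n ^ order_min"
        using moment_divide[OF reg] moment_Nil False
        by (auto simp: order_min_def field_simps power2_eq_square)
    qed
  qed
  obtain i' is' where I': "admissible i' is'"
      "\<forall>n>0. moment i is n = real n ^ (e - order_min) * moment i' is' n"
    using moment_divide_power[OF I(1)] by blast
  have "moment i' is' (Suc n) = 1 / real (Suc n) ^ e" for n
  proof -
    have "real (Suc n) ^ e = real (Suc n) ^ order_min * real (Suc n) ^ (e - order_min)"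
      using assms(2) by (simp flip: power_add)
    moreover have "1 / real (Suc n) ^ order_min = real (Suc n) ^ (e - order_min) * moment i' is' (Suc n)"
      using I(2) I'(2) by (metis zero_less_Suc)
    ultimately show ?thesis by (simp add: field_simps del: of_nat_Suc)
  qed
  then show ?thesis using harmonic_moment_sums[OF I'(1) assms(1)] by simp
qed

end

section \<open>Shifted denominators\<close>

text \<open>Rationality of the terms is bundled in so that omitting or changing finitely many of
  them preserves expressibility.\<close>

definition expressible_series :: "(nat \<Rightarrow> real) \<Rightarrow> bool" where
  "expressible_series f \<longleftrightarrow> (\<forall>n. f n \<in> \<rat>) \<and> summable f \<and> suminf f \<in> cyclotomic_expressible"

lemma expressible_series_rational: "expressible_series f \<Longrightarrow> f n \<in> \<rat>"
  by (simp add: expressible_series_def)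

lemma expressible_series_add: "expressible_series f \<Longrightarrow> expressible_series g \<Longrightarrow> expressible_series (\<lambda>n. f n + g n)"
  by (auto simp: expressible_series_def summable_add suminf_add[symmetric] intro: cyclotomic_expressible.add)

lemma expressible_series_cmult: "expressible_series f \<Longrightarrow> r \<in> \<rat> \<Longrightarrow> expressible_series (\<lambda>n. r * f n)"
  by (auto simp: expressible_series_def summable_mult suminf_mult intro: cyclotomic_expressible.intros)

text \<open>The two sums differ by a finite sum of rationals. This disposes of all indices at which
  a denominator vanishes.\<close>

lemma expressible_series_eventually:
  assumes "expressible_series g" "\<And>n. f n \<in> \<rat>" "eventually (\<lambda>n. g n = f n) sequentially"
  shows "expressible_series f"
proof -
  obtain N where N: "\<And>n. n \<ge> N \<Longrightarrow> g n = f n"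
    using assms(3) by (auto simp: eventually_at_top_linorder)
  have g: "g sums suminf g" using assms(1) by (auto simp: expressible_series_def)
  have "(\<lambda>n. f n - g n) sums (\<Sum>n<N. f n - g n)"
    by (rule sums_finite) (use N in \<open>auto simp: not_less\<close>)
  from sums_add[OF this g] have *: "f sums ((\<Sum>n<N. f n - g n) + suminf g)" by simp
  have "(\<Sum>n<N. f n - g n) \<in> \<rat>"
    using assms by (intro Rats_sum Rats_diff) (auto dest: expressible_series_rational)
  then have "(\<Sum>n<N. f n - g n) + suminf g \<in> cyclotomic_expressible"
    using assms(1) by (auto simp: expressible_series_def intro: cyclotomic_expressible.intros)
  then show ?thesis using * assms(2) by (auto simp: expressible_series_def sums_iff)
qed

lemma expressible_series_Suc_iff:
  assumes "\<And>n. f n \<in> \<rat>"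
  shows "expressible_series (\<lambda>n. f (Suc n)) \<longleftrightarrow> expressible_series f"
proof -
  have "suminf f = f 0 + (\<Sum>n. f (Suc n))" if "summable f"
    using suminf_split_head[OF that] by simp
  moreover have "f 0 + x \<in> cyclotomic_expressible \<longleftrightarrow> x \<in> cyclotomic_expressible" for x
  proof
    assume "f 0 + x \<in> cyclotomic_expressible"
    then have "- f 0 + (f 0 + x) \<in> cyclotomic_expressible"
      using assms by (blast intro: cyclotomic_expressible.add cyclotomic_expressible.rational Rats_minus_iff[THEN iffD2])
    then show "x \<in> cyclotomic_expressible" by simp
  qed (use assms in \<open>auto intro: cyclotomic_expressible.intros\<close>)
  ultimately show ?thesis using assms by (auto simp: expressible_series_def summable_Suc_iff)
qed

lemma expressible_series_telescope:
  assumes "\<And>n. t n \<in> \<rat>" "t \<longlonglongrightarrow> 0"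
  shows "expressible_series (\<lambda>n. t (Suc n) - t n)"
proof -
  have "(\<lambda>n. t (Suc n) - t n) sums (0 - t 0)" by (rule telescope_sums[OF assms(2)])
  then show ?thesis
    using assms(1) by (auto simp: expressible_series_def sums_iff intro!: cyclotomic_expressible.rational)
qed

lemma multi_harmonic_rational: "multi_harmonic cs n \<in> \<rat>"
  by (induction cs arbitrary: n) (auto intro!: Rats_sum)

lemma multi_harmonic_ge_1: "n \<ge> 1 \<Longrightarrow> multi_harmonic cs n \<ge> 1"
proof (induction cs arbitrary: n)
  case (Cons c cs)
  have "1 \<le> (\<Sum>i=1..1. 1 / real i ^ c * multi_harmonic cs i)" using Cons.IH[of 1] by simp
  also have "\<dots> \<le> (\<Sum>i=1..n. 1 / real i ^ c * multi_harmonic cs i)"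
    using Cons.prems by (intro sum_mono2) (auto simp: multi_harmonic_nonneg)
  finally show ?case by simp
qed simp

text \<open>Rational functions of order \<open>n powr (- t)\<close>, up to finitely many values; fractions of the next
  smaller order may only enter through differences.\<close>

inductive partial_fraction :: "nat \<Rightarrow> (nat \<Rightarrow> real) \<Rightarrow> bool" for t where
  pow: "e \<ge> t \<Longrightarrow> e \<ge> 1 \<Longrightarrow> partial_fraction t (\<lambda>n. 1 / (real n + of_int j) ^ e)"
| diff: "Suc e \<ge> t \<Longrightarrow> e \<ge> 1 \<Longrightarrow>
    partial_fraction t (\<lambda>n. 1 / (real n + of_int i) ^ e - 1 / (real n + of_int j) ^ e)"
| add: "partial_fraction t f \<Longrightarrow> partial_fraction t g \<Longrightarrow> partial_fraction t (\<lambda>n. f n + g n)"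
| cmult: "partial_fraction t f \<Longrightarrow> r \<in> \<rat> \<Longrightarrow> partial_fraction t (\<lambda>n. r * f n)"
| cong: "partial_fraction t f \<Longrightarrow> (\<And>n. g n \<in> \<rat>) \<Longrightarrow>
    eventually (\<lambda>n. f n = g n) sequentially \<Longrightarrow> partial_fraction t g"

lemma partial_fraction_mono: "partial_fraction t f \<Longrightarrow> t' \<le> t \<Longrightarrow> partial_fraction t' f"
  by (induction rule: partial_fraction.induct) (auto intro: partial_fraction.intros)

lemma eventually_add_int_pos: "eventually (\<lambda>n. real n + of_int j > 0) sequentially"
proof -
  have "eventually (\<lambda>n. n > nat (- j)) sequentially" by (rule eventually_gt_at_top)
  then show ?thesis by eventually_elim linarith
qed

text \<open>For \<open>i \<noteq> j\<close> the identity
  \<open>1 / (x y) = (1 / x - 1 / y) / (y - x)\<close>, with \<open>x = n + i\<close> and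
  \<open>y = n + j\<close>, lowers the exponent of \<open>x\<close>; at exponent one a difference
  remains.\<close>

lemma partial_fraction_pow_divide:
  assumes "e \<ge> 1"
  shows "partial_fraction 2 (\<lambda>n. 1 / (real n + of_int i) ^ e / (real n + of_int j))"
proof (cases "i = j")
  case True
  have "partial_fraction 2 (\<lambda>n. 1 / (real n + of_int i) ^ Suc e)"
    using assms by (intro partial_fraction.pow) auto
  then show ?thesis by (simp add: True mult.commute)
next
  case False
  have ij: "real_of_int (j - i) \<noteq> 0" using False by simp
  show ?thesis using assms
  proof (induction e rule: dec_induct)
    case base
    have "partial_fraction 2 (\<lambda>n. 1 / of_int (j - i) *
        (1 / (real n + of_int i) ^ 1 - 1 / (real n + of_int j) ^ 1))"
      by (intro partial_fraction.cmult partial_fraction.diff) auto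
    then show ?case
    proof (rule partial_fraction.cong)
      show "eventually (\<lambda>n. 1 / of_int (j - i) *
        (1 / (real n + of_int i) ^ 1 - 1 / (real n + of_int j) ^ 1) =
        1 / (real n + of_int i) ^ 1 / (real n + of_int j)) sequentially"
        using eventually_add_int_pos[of i] eventually_add_int_pos[of j]
      proof eventually_elim
        case (elim n)
        then have "1 / (real n + of_int i) - 1 / (real n + of_int j) =
            of_int (j - i) * (1 / (real n + of_int i) / (real n + of_int j))"
          by (simp add: diff_frac_eq)
        then show ?case using ij by simp
      qed
    qed auto
  next
    case (step e)
    have "partial_fraction 2 (\<lambda>n. 1 / of_int (j - i) * (1 / (real n + of_int i) ^ Suc e +
        (- 1) * (1 / (real n + of_int i) ^ e / (real n + of_int j))))"
      using step by (intro partial_fraction.cmult partial_fraction.add partial_fraction.pow) auto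
    then show ?case
    proof (rule partial_fraction.cong)
      show "eventually (\<lambda>n. 1 / of_int (j - i) * (1 / (real n + of_int i) ^ Suc e +
        (- 1) * (1 / (real n + of_int i) ^ e / (real n + of_int j))) =
        1 / (real n + of_int i) ^ Suc e / (real n + of_int j)) sequentially"
        using eventually_add_int_pos[of i] eventually_add_int_pos[of j]
      proof eventually_elim
        case (elim n)
        define a b where "a = real n + of_int i" and "b = real n + of_int j"
        have ab: "a > 0" "b > 0" "of_int (j - i) = b - a" using elim by (auto simp: a_def b_def)
        have "1 / a ^ Suc e + (- 1) * (1 / a ^ e / b) = (b - a) * (1 / a ^ Suc e / b)"
          using ab(1,2) by (simp add: field_simps)
        then have "1 / (b - a) * (1 / a ^ Suc e + (- 1) * (1 / a ^ e / b)) = 1 / a ^ Suc e / b"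
          using ij ab(3) by simp
        then show ?case using ab(3) by (simp only: a_def b_def)
      qed
    qed auto
  qed
qed

lemma partial_fraction_divide:
  "partial_fraction 1 f \<Longrightarrow> partial_fraction 2 (\<lambda>n. f n / (real n + of_int j))"
proof (induction rule: partial_fraction.induct)
  case (pow e i)
  then show ?case by (intro partial_fraction_pow_divide)
next
  case (diff e i i')
  have "partial_fraction 2 (\<lambda>n. 1 / (real n + of_int i) ^ e / (real n + of_int j) +
      (- 1) * (1 / (real n + of_int i') ^ e / (real n + of_int j)))"
    using diff by (intro partial_fraction.add partial_fraction.cmult partial_fraction_pow_divide) auto
  then show ?case by (simp add: diff_divide_distrib)
next
  case (add f g)
  then show ?case by (simp add: add_divide_distrib partial_fraction.add)
next
  case (cmult f r)
  then show ?case using partial_fraction.cmult[OF cmult.IH, of r] by simp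
next
  case (cong f g)
  show ?case
    by (rule partial_fraction.cong[OF cong.IH])
       (use cong.hyps in \<open>auto elim: eventually_mono\<close>)
qed

lemma partial_fraction_divide_power:
  assumes "partial_fraction 1 f"
  shows "partial_fraction 1 (\<lambda>n. f n / (real n + of_int j) ^ k)"
    and "k \<ge> 1 \<Longrightarrow> partial_fraction 2 (\<lambda>n. f n / (real n + of_int j) ^ k)"
proof -
  have *: "partial_fraction 1 (\<lambda>n. f n / (real n + of_int j) ^ k) \<and>
    (k \<ge> 1 \<longrightarrow> partial_fraction 2 (\<lambda>n. f n / (real n + of_int j) ^ k))"
  proof (induction k)
    case (Suc k)
    then have "partial_fraction 2 (\<lambda>n. f n / (real n + of_int j) ^ k / (real n + of_int j))"
      by (intro partial_fraction_divide) simp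
    then have "partial_fraction 2 (\<lambda>n. f n / (real n + of_int j) ^ Suc k)"
      by (simp add: mult.commute)
    then show ?case using partial_fraction_mono[of 2 _ 1] by auto
  qed (use assms in simp)
  then show "partial_fraction 1 (\<lambda>n. f n / (real n + of_int j) ^ k)"
    and "k \<ge> 1 \<Longrightarrow> partial_fraction 2 (\<lambda>n. f n / (real n + of_int j) ^ k)" by auto
qed

text \<open>The convention for negative arguments makes this hold for every integer; at
  \<open>x <= 0\<close> both sides vanish.\<close>

lemma inv_fact_pred: "inv_fact (x - 1) = inv_fact x * of_int x"
proof (cases "x > 0")
  case True
  then have "nat x = Suc (nat (x - 1))" by simp
  then show ?thesis using True by (simp add: inv_fact_def field_simps)
qed (auto simp: inv_fact_def)

lemma fact_rational: "(fact n :: real) \<in> \<rat>"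
  by (metis Rats_of_nat of_nat_fact)

lemma inv_fact_rational: "inv_fact x \<in> \<rat>"
  by (auto simp: inv_fact_def intro!: Rats_divide fact_rational)

definition fact_ratio :: "int \<Rightarrow> nat \<Rightarrow> int \<Rightarrow> nat \<Rightarrow> real" where
  "fact_ratio b c d n = fact n * inv_fact (int n + d) / (real n + of_int b) ^ c"

lemma fact_ratio_rational: "fact_ratio b c d n \<in> \<rat>"
  unfolding fact_ratio_def
  by (intro Rats_divide Rats_mult Rats_power Rats_add inv_fact_rational fact_rational) auto

lemma fact_ratio_0: "fact_ratio b c 0 n = 1 / (real n + of_int b) ^ c"
  by (simp add: fact_ratio_def inv_fact_def)

lemma fact_ratio_pred: "fact_ratio b c (d - 1) n = fact_ratio b c d n * (real n + of_int d)"
  using inv_fact_pred[of "int n + d"] by (simp add: fact_ratio_def add_diff_eq)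

text \<open>The ratio has order \<open>n powr (- (d + c))\<close>. For positive \<open>d\<close> one
  divides by \<open>n + 1\<close>, ..., \<open>n + d\<close> in turn; otherwise numerator factors
  are traded against powers of \<open>n + b\<close>.\<close>

lemma partial_fraction_fact_ratio:
  assumes "c \<ge> 1" "d + int c \<ge> int t" "t = 1 \<or> t = 2"
  shows "partial_fraction t (fact_ratio b c d)"
proof (cases "d \<ge> 1")
  case True
  have "partial_fraction 1 (fact_ratio b c (int k)) \<and>
      (k \<ge> 1 \<longrightarrow> partial_fraction 2 (fact_ratio b c (int k)))" for k
  proof (induction k)
    case 0
    have "partial_fraction 1 (\<lambda>n. 1 / (real n + of_int b) ^ c)"
      using assms by (intro partial_fraction.pow) auto
    moreover have "fact_ratio b c (int 0) = (\<lambda>n. 1 / (real n + of_int b) ^ c)"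
      by (simp add: fun_eq_iff fact_ratio_0)
    ultimately show ?case by simp
  next
    case (Suc k)
    then have *: "partial_fraction 2 (\<lambda>n. fact_ratio b c (int k) n / (real n + of_int (int (Suc k))))"
      by (intro partial_fraction_divide) simp
    have "(\<lambda>n. fact_ratio b c (int k) n / (real n + of_int (int (Suc k)))) = fact_ratio b c (int (Suc k))"
    proof
      fix n
      have "fact_ratio b c (int k) n = fact_ratio b c (int (Suc k)) n * (real n + of_int (int (Suc k)))"
        using fact_ratio_pred[of b c "int (Suc k)" n] by simp
      then show "fact_ratio b c (int k) n / (real n + of_int (int (Suc k))) = fact_ratio b c (int (Suc k)) n"
        by (simp add: add_eq_0_iff)
    qed
    with * have "partial_fraction 2 (fact_ratio b c (int (Suc k)))" by simp
    then show ?case using partial_fraction_mono[of 2 _ 1] by auto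
  qed
  from this[of "nat d"] show ?thesis using True assms(3) by auto
next
  case False
  have "partial_fraction t (fact_ratio b c (- int D))" if "c \<ge> t + D" for c D
    using that
  proof (induction D arbitrary: c)
    case 0
    have "partial_fraction t (\<lambda>n. 1 / (real n + of_int b) ^ c)"
      using 0 assms(3) by (intro partial_fraction.pow) auto
    moreover have "fact_ratio b c (- int 0) = (\<lambda>n. 1 / (real n + of_int b) ^ c)"
      by (simp add: fun_eq_iff fact_ratio_0)
    ultimately show ?case by simp
  next
    case (Suc D)
    \<comment> \<open>From \<open>n - D = (n + b) - (b + D)\<close>: the first part cancels one
      power of \<open>n + b\<close>, so each step costs at most one unit of
      \<open>c\<close>.\<close>
    have "partial_fraction t (\<lambda>n. fact_ratio b (c - 1) (- int D) n +
        (- of_int (b + int D)) * fact_ratio b c (- int D) n)"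
      using Suc.prems by (intro partial_fraction.add partial_fraction.cmult Suc.IH) auto
    then show ?case
    proof (rule partial_fraction.cong)
      show "eventually (\<lambda>n. fact_ratio b (c - 1) (- int D) n +
        (- of_int (b + int D)) * fact_ratio b c (- int D) n = fact_ratio b c (- int (Suc D)) n) sequentially"
        using eventually_add_int_pos[of b]
      proof eventually_elim
        case (elim n)
        have "fact_ratio b (c - 1) (- int D) n = fact_ratio b c (- int D) n * (real n + of_int b)"
        proof -
          define a where "a = real n + of_int b"
          have "a ^ c = a ^ (c - 1) * a" using Suc.prems by (intro power_pred) simp
          then have "x / a ^ (c - 1) = x / a ^ c * a" for x using elim by (simp add: a_def)
          then show ?thesis unfolding fact_ratio_def a_def .
        qed
        moreover have "fact_ratio b c (- int (Suc D)) n =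
            fact_ratio b c (- int D) n * (real n + of_int (- int D))"
        proof -
          have "- int (Suc D) = - int D - 1" by simp
          then show ?thesis using fact_ratio_pred[of b c "- int D" n] by (simp only:)
        qed
        moreover have "F * (real n + of_int b) + (- of_int (b + int D)) * F =
            F * (real n + of_int (- int D))" for F :: real
          by (simp add: algebra_simps)
        ultimately show ?case by (simp only:)
      qed
    qed (rule fact_ratio_rational)
  qed
  from this[of "nat (- d)" c] show ?thesis using False assms by auto
qed

lemma abs_divide_add_int_power_le:
  assumes "e \<ge> 1"
  shows "\<bar>real n / (real n + of_int j) ^ e\<bar> \<le> 1 + \<bar>of_int j\<bar>"
proof (cases "int n + j = 0")
  case True
  then have "real n + of_int j = 0" by (metis of_int_add of_int_of_nat_eq of_int_0)
  then show ?thesis using assms by (simp add: power_0_left)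
next
  case False
  define a where "a = \<bar>real n + of_int j\<bar>"
  have "a = of_int \<bar>int n + j\<bar>" by (simp add: a_def)
  then have a: "a \<ge> 1" using False by (simp flip: of_int_add)
  have "\<bar>real n / (real n + of_int j) ^ e\<bar> = real n / a ^ e"
    by (simp add: a_def power_abs)
  also have "\<dots> \<le> real n / a"
    using a power_increasing[OF assms a] by (intro divide_left_mono mult_pos_pos) auto
  also have "\<dots> \<le> (a + \<bar>of_int j\<bar>) / a"
    using a by (intro divide_right_mono) (auto simp: a_def)
  also have "\<dots> = 1 + \<bar>of_int j\<bar> / a" using a by (simp add: add_divide_distrib)
  also have "\<dots> \<le> 1 + \<bar>of_int j\<bar>"
    using a by (simp add: divide_le_eq mult_le_cancel_left1)
  finally show ?thesis .
qed

section \<open>Moving the shift in a denominator by telescoping\<close>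

context root_sum
begin

definition shift :: real where "shift = real p / real m"

lemma shift_bounds: "0 < shift" "shift \<le> 1" "p < m \<Longrightarrow> shift < 1" "\<not> p < m \<Longrightarrow> shift = 1"
  unfolding shift_def using p_pos p_le by auto

lemma coef_Suc: "real (Suc n) * coef (Suc n) = (real n + shift) * coef n"
  unfolding shift_def by (rule Suc_coef_Suc)

lemma coef_rational: "coef n \<in> \<rat>"
proof (induction n)
  case (Suc n)
  have "coef (Suc n) = (real n + shift) * coef n / real (Suc n)"
    using coef_Suc[of n] by (simp add: field_simps del: of_nat_Suc)
  also have "\<dots> \<in> \<rat>"
    using Suc by (intro Rats_divide Rats_mult Rats_add) (auto simp: shift_def simp del: of_nat_Suc)
  finally show ?case .
qed (simp add: coef_0)

lemma coef_decreasing: "coef (Suc n) \<le> coef n"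
proof -
  have "real (Suc n) * coef (Suc n) \<le> real (Suc n) * coef n"
    unfolding coef_Suc using shift_bounds coef_pos[of n] by (intro mult_right_mono) auto
  then show ?thesis by simp
qed

text \<open>For \<open>p < m\<close> the sequence \<open>n * coef n\<close> increases from
  \<open>coef 1 = shift\<close>; for \<open>p = m\<close> all coefficients are one. The exponent
  \<open>order_min - 1\<close> covers both cases.\<close>

lemma coef_lower_bound: "n \<ge> 1 \<Longrightarrow> shift * real n ^ (order_min - 1) / real n \<le> coef n"
proof (cases "p < m")
  case True
  assume "n \<ge> 1"
  then have "shift \<le> real n * coef n"
  proof (induction n rule: dec_induct)
    case base
    show ?case using coef_Suc[of 0] by (simp add: coef_0)
  next
    case (step n)
    have "real n * coef n \<le> (real n + shift) * coef n"
      using coef_pos[of n] shift_bounds by (intro mult_right_mono) auto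
    then show ?case using step.IH unfolding coef_Suc by linarith
  qed
  then show ?thesis using True \<open>n \<ge> 1\<close> by (simp add: order_min_def divide_le_eq mult.commute)
next
  case False
  assume n: "n \<ge> 1"
  have "coef n = 1"
  proof (induction n)
    case (Suc n)
    have "real (Suc n) * coef (Suc n) = real (Suc n) * 1"
      unfolding coef_Suc Suc shift_bounds(4)[OF False] by simp
    then show ?case by (simp only: mult_cancel_left of_nat_eq_0_iff) simp
  qed (simp add: coef_0)
  then show ?thesis using False n shift_bounds(4)[OF False] by (simp add: order_min_def)
qed

definition summable_factor :: "(nat \<Rightarrow> real) \<Rightarrow> nat list \<Rightarrow> bool" where
  "summable_factor f cs \<longleftrightarrow> expressible_series (\<lambda>n. coef n * f n * multi_harmonic cs n)"

lemma summable_factor_add: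
  "summable_factor f cs \<Longrightarrow> summable_factor g cs \<Longrightarrow> summable_factor (\<lambda>n. f n + g n) cs"
  unfolding summable_factor_def
  using expressible_series_add[of "\<lambda>n. coef n * f n * multi_harmonic cs n" "\<lambda>n. coef n * g n * multi_harmonic cs n"]
  by (simp add: algebra_simps)

lemma summable_factor_cmult:
  "summable_factor f cs \<Longrightarrow> r \<in> \<rat> \<Longrightarrow> summable_factor (\<lambda>n. r * f n) cs"
  unfolding summable_factor_def
  using expressible_series_cmult[of "\<lambda>n. coef n * f n * multi_harmonic cs n" r] by (simp add: mult_ac)

lemma summable_factor_diff:
  "summable_factor f cs \<Longrightarrow> summable_factor g cs \<Longrightarrow> summable_factor (\<lambda>n. f n - g n) cs"
  using summable_factor_add[of f cs "\<lambda>n. (- 1) * g n"] summable_factor_cmult[of g cs "- 1"] by simp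

lemma summable_factor_cong:
  assumes "summable_factor f cs" "\<And>n. g n \<in> \<rat>" "eventually (\<lambda>n. f n = g n) sequentially"
  shows "summable_factor g cs"
  unfolding summable_factor_def
  by (rule expressible_series_eventually[OF assms(1)[unfolded summable_factor_def]])
     (use assms in \<open>auto intro!: Rats_mult coef_rational multi_harmonic_rational elim: eventually_mono\<close>)

lemma summable_factor_power:
  assumes "\<forall>k\<in>set cs. k \<ge> 1" "e \<ge> order_min"
  shows "summable_factor (\<lambda>n. 1 / real n ^ e) cs"
proof -
  let ?f = "\<lambda>n. coef n * (1 / real n ^ e) * multi_harmonic cs n"
  have rat: "?f n \<in> \<rat>" for n
    by (intro Rats_mult coef_rational multi_harmonic_rational) auto
  obtain s where "s \<in> cyclotomic_expressible"
      "(\<lambda>n. coef (Suc n) * multi_harmonic cs (Suc n) / real (Suc n) ^ e) sums s"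
    using harmonic_power_sums[OF assms] by blast
  then have "expressible_series (\<lambda>n. ?f (Suc n))"
    using rat[of "Suc n" for n] unfolding expressible_series_def by (auto simp: sums_iff simp del: of_nat_Suc)
  then show ?thesis unfolding summable_factor_def by (rule iffD1[OF expressible_series_Suc_iff[OF rat]])
qed

text \<open>Convergence of the series already summed yields this limit: an outer harmonic sum is a
  partial sum to which \<open>partial_sums_mult_tendsto_0\<close> applies. It removes the boundary
  term of the telescoping.\<close>

lemma coef_harmonic_tendsto_0:
  assumes "\<forall>k\<in>set cs. k \<ge> 1"
  shows "(\<lambda>n. multi_harmonic cs (Suc n) * (coef (Suc n) / real (Suc n) ^ (order_min - 1))) \<longlonglongrightarrow> 0"
proof -
  let ?t = "order_min - 1"
  define w where "w = (\<lambda>n. coef (Suc n) / real (Suc n) ^ ?t)"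
  have order: "Suc ?t = order_min" by (simp add: order_min_def)
  have w: "w n \<ge> 0" for n using coef_pos[of "Suc n"] by (auto simp: w_def)
  have dec: "decseq w"
  proof (rule decseq_SucI)
    fix n
    show "w (Suc n) \<le> w n" unfolding w_def
      using coef_pos[of "Suc n"] by (intro frac_le coef_decreasing power_mono) auto
  qed
  have sum: "summable (\<lambda>n. multi_harmonic cs' (Suc n) / real (Suc n) ^ k * w n)"
    if cs': "\<forall>k\<in>set cs'. k \<ge> 1" and k: "k \<ge> 1" for cs' k
  proof -
    have "k + ?t \<ge> order_min" using k order by simp
    then obtain s where "(\<lambda>n. coef (Suc n) * multi_harmonic cs' (Suc n) / real (Suc n) ^ (k + ?t)) sums s"
      using harmonic_power_sums[OF cs'] by blast
    then show ?thesis by (simp add: sums_iff w_def power_add mult_ac)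
  qed
  have lim: "w \<longlonglongrightarrow> 0"
    using dec w sum[of "[]" 1] by (intro decseq_tendsto_0_of_summable_harmonic) auto
  show ?thesis
  proof (cases cs)
    case Nil
    then show ?thesis using lim by (simp add: w_def)
  next
    case (Cons c cs')
    have "(\<lambda>n. (\<Sum>i\<le>n. multi_harmonic cs' (Suc i) / real (Suc i) ^ c) * w n) \<longlonglongrightarrow> 0"
      using Cons assms dec w lim sum[of cs' c] multi_harmonic_nonneg
      by (intro partial_sums_mult_tendsto_0) auto
    then show ?thesis unfolding Cons multi_harmonic_Cons_Suc w_def .
  qed
qed

lemma telescoped_term_tendsto_0:
  assumes "\<forall>k\<in>set cs. k \<ge> 1" "\<And>n. \<bar>real n ^ order_min * f n\<bar> \<le> C"
  shows "(\<lambda>n. real n * coef n * f n * multi_harmonic cs n) \<longlonglongrightarrow> 0"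
proof -
  let ?t = "order_min - 1"
  let ?g = "\<lambda>n. multi_harmonic cs (Suc n) * (coef (Suc n) / real (Suc n) ^ ?t)"
  have "(\<lambda>n. C * ?g n) \<longlonglongrightarrow> C * 0"
    by (intro tendsto_mult tendsto_const coef_harmonic_tendsto_0 assms)
  then have lim: "(\<lambda>n. C * ?g n) \<longlonglongrightarrow> 0" by simp
  have "(\<lambda>n. real (Suc n) * coef (Suc n) * f (Suc n) * multi_harmonic cs (Suc n)) \<longlonglongrightarrow> 0"
  proof (rule Lim_null_comparison[OF _ lim], intro always_eventually allI)
    fix n
    have "real (Suc n) * coef (Suc n) * f (Suc n) * multi_harmonic cs (Suc n) =
        real (Suc n) ^ order_min * f (Suc n) * ?g n"
    proof -
      have "real (Suc n) ^ order_min = real (Suc n) ^ ?t * real (Suc n)"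
        by (rule power_pred) (simp add: order_min_def)
      then show ?thesis by (simp only:) (simp del: of_nat_Suc)
    qed
    moreover have "?g n \<ge> 0"
      using coef_pos[of "Suc n"] multi_harmonic_nonneg by auto
    ultimately show "norm (real (Suc n) * coef (Suc n) * f (Suc n) * multi_harmonic cs (Suc n))
        \<le> C * ?g n"
      using assms(2)[of "Suc n"] mult_right_mono[of _ C "?g n"]
      by (simp only: real_norm_def abs_mult[of _ "?g n"] abs_of_nonneg)
  qed
  then show ?thesis by (rule LIMSEQ_imp_Suc)
qed

text \<open>The sequence that telescopes is \<open>n * coef n * f n * multi_harmonic cs n\<close>.\<close>

lemma summable_factor_telescope:
  assumes "\<forall>k\<in>set cs. k \<ge> 1" "\<And>n. f n \<in> \<rat>" "\<And>n. \<bar>real n ^ order_min * f n\<bar> \<le> C"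
    and "\<And>c cs'. cs = c # cs' \<Longrightarrow> summable_factor (\<lambda>n. real n * f n / real n ^ c) cs'"
  shows "summable_factor (\<lambda>n. (real n + shift) * f (Suc n) - real n * f n) cs"
proof -
  define t where "t = (\<lambda>n. real n * coef n * f n * multi_harmonic cs n)"
  have rat: "t n \<in> \<rat>" for n
    unfolding t_def using assms(2) by (intro Rats_mult coef_rational multi_harmonic_rational) auto
  have tele: "expressible_series (\<lambda>n. t (Suc n) - t n)"
    using telescoped_term_tendsto_0[OF assms(1,3)] rat by (intro expressible_series_telescope) (simp_all add: t_def)
  have ratf: "real n * f n / real n ^ c \<in> \<rat>" for n c
    using assms(2) by (intro Rats_divide Rats_mult) auto
  have step: "t (Suc n) = coef n * ((real n + shift) * f (Suc n)) * multi_harmonic cs (Suc n)" for n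
    unfolding t_def coef_Suc by (simp add: mult_ac)
  show ?thesis
  proof (cases cs)
    case Nil
    show ?thesis
      using tele unfolding summable_factor_def step unfolding t_def Nil by (simp add: algebra_simps)
  next
    case (Cons c cs')
    \<comment> \<open>The jump of the harmonic sum from \<open>n\<close> to \<open>n + 1\<close>
      leaves a series over the shorter list \<open>cs'\<close>.\<close>
    let ?u = "\<lambda>n. coef n * (real n * f n / real n ^ c) * multi_harmonic cs' n"
    have "expressible_series ?u" using assms(4)[OF Cons] by (simp add: summable_factor_def)
    then have "expressible_series (\<lambda>n. ?u (Suc n))"
      by (subst expressible_series_Suc_iff) (intro Rats_mult coef_rational multi_harmonic_rational ratf)
    then have "expressible_series (\<lambda>n. (t (Suc n) - t n) + (- 1) * ?u (Suc n))"
      by (intro expressible_series_add expressible_series_cmult tele) auto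
    moreover have "(t (Suc n) - t n) + (- 1) * ?u (Suc n) =
        coef n * ((real n + shift) * f (Suc n) - real n * f n) * multi_harmonic cs n" for n
    proof -
      have "multi_harmonic cs (Suc n) = multi_harmonic cs n + multi_harmonic cs' (Suc n) / real (Suc n) ^ c"
        unfolding Cons by simp
      then have "t (Suc n) = coef n * ((real n + shift) * f (Suc n)) * multi_harmonic cs n +
          ((real n + shift) * coef n) * (f (Suc n) / real (Suc n) ^ c * multi_harmonic cs' (Suc n))"
        unfolding step by (simp add: algebra_simps)
      also have "((real n + shift) * coef n) * (f (Suc n) / real (Suc n) ^ c * multi_harmonic cs' (Suc n)) =
          ?u (Suc n)"
        unfolding coef_Suc[symmetric] by simp
      finally have "t (Suc n) = coef n * ((real n + shift) * f (Suc n)) * multi_harmonic cs n + ?u (Suc n)" .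
      moreover have "coef n * ((real n + shift) * f (Suc n)) * multi_harmonic cs n - t n =
          coef n * ((real n + shift) * f (Suc n) - real n * f n) * multi_harmonic cs n"
        unfolding t_def by (simp add: algebra_simps)
      ultimately show ?thesis by linarith
    qed
    ultimately show ?thesis by (simp add: summable_factor_def)
  qed
qed

lemma summable_factor_partial_fraction_of_generators:
  assumes "partial_fraction t f"
    and "\<And>e j. e \<ge> t \<Longrightarrow> e \<ge> 1 \<Longrightarrow> summable_factor (\<lambda>n. 1 / (real n + of_int j) ^ e) cs"
    and "\<And>e i j. Suc e \<ge> t \<Longrightarrow> e \<ge> 1 \<Longrightarrow>
      summable_factor (\<lambda>n. 1 / (real n + of_int i) ^ e - 1 / (real n + of_int j) ^ e) cs"
  shows "summable_factor f cs"
  using assms(1)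
  by (induction rule: partial_fraction.induct)
     (auto intro: assms(2,3) summable_factor_add summable_factor_cmult summable_factor_cong)

text \<open>Telescoping with \<open>1 / (n + j)^e\<close> relates the shifts \<open>j\<close> and
  \<open>j + 1\<close>. Starting from shift zero, the relation can be solved in both directions
  because \<open>shift\<close> lies strictly between 0 and 1.\<close>

lemma summable_factor_shifted_power:
  assumes "p < m" "\<forall>k\<in>set cs. k \<ge> 1" "e \<ge> 1"
    and IH: "\<And>c cs' f. cs = c # cs' \<Longrightarrow> partial_fraction 1 f \<Longrightarrow> summable_factor f cs'"
  shows "summable_factor (\<lambda>n. 1 / (real n + of_int j) ^ e) cs"
  using assms(3)
proof (induction e arbitrary: j rule: less_induct)
  case (less e)
  have order: "order_min = 1" using assms(1) by (simp add: order_min_def)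
  have rel: "summable_factor (\<lambda>n. (shift - of_int j - 1) * (1 / (real n + of_int (j + 1)) ^ e) +
      of_int j * (1 / (real n + of_int j) ^ e)) cs" for j
  proof -
    define f where "f = (\<lambda>n. 1 / (real n + of_int j) ^ e)"
    have "summable_factor (\<lambda>n. (real n + shift) * f (Suc n) - real n * f n) cs"
    proof (rule summable_factor_telescope[OF assms(2)])
      show "f n \<in> \<rat>" for n by (simp add: f_def)
      show "\<bar>real n ^ order_min * f n\<bar> \<le> 1 + \<bar>of_int j\<bar>" for n
        using abs_divide_add_int_power_le[OF less.prems, of n j] by (simp add: f_def order)
      fix c cs' assume cs: "cs = c # cs'"
      then have c: "c \<ge> 1" using assms(2) by simp
      have "partial_fraction 1 (\<lambda>n. 1 / (real n + of_int j) ^ e)"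
        using less.prems by (intro partial_fraction.pow) auto
      then have "partial_fraction 1 (\<lambda>n. f n / (real n + of_int 0) ^ (c - 1))"
        unfolding f_def by (rule partial_fraction_divide_power(1))
      then have "partial_fraction 1 (\<lambda>n. real n * f n / real n ^ c)"
      proof (rule partial_fraction.cong)
        show "real n * f n / real n ^ c \<in> \<rat>" for n by (simp add: f_def)
        show "\<forall>\<^sub>F n in sequentially. f n / (real n + of_int 0) ^ (c - 1) = real n * f n / real n ^ c"
          using eventually_gt_at_top[of 0]
        proof eventually_elim
          case (elim n)
          have "real n ^ c = real n ^ (c - 1) * real n" using c by (intro power_pred) simp
          then show ?case using elim by (simp only:) simp
        qed
      qed
      then show "summable_factor (\<lambda>n. real n * f n / real n ^ c) cs'" by (rule IH[OF cs])
    qed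
    \<comment> \<open>The numerators are split as
      \<open>n + shift = (n + j + 1) + (shift - j - 1)\<close> and
      \<open>n = (n + j) - j\<close>.\<close>
    then have 1: "summable_factor (\<lambda>n. (1 / (real n + of_int (j + 1)) ^ (e - 1) - 1 / (real n + of_int j) ^ (e - 1)) +
        ((shift - of_int j - 1) * (1 / (real n + of_int (j + 1)) ^ e) +
         of_int j * (1 / (real n + of_int j) ^ e))) cs"
    proof (rule summable_factor_cong)
      show "\<forall>\<^sub>F n in sequentially. (real n + shift) * f (Suc n) - real n * f n =
        (1 / (real n + of_int (j + 1)) ^ (e - 1) - 1 / (real n + of_int j) ^ (e - 1)) +
        ((shift - of_int j - 1) * (1 / (real n + of_int (j + 1)) ^ e) +
         of_int j * (1 / (real n + of_int j) ^ e))"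
        using eventually_add_int_pos[of j]
      proof eventually_elim
        case (elim n)
        define a where "a = real n + of_int j"
        have a: "a > 0" using elim by (simp add: a_def)
        have split: "(y + s) / y ^ e = 1 / y ^ (e - 1) + s * (1 / y ^ e)" if "y > 0" for y s :: real
        proof -
          have "y ^ e = y ^ (e - 1) * y" using less.prems by (intro power_pred) simp
          then have "y / y ^ e = 1 / y ^ (e - 1)" using that by simp
          then show ?thesis by (simp add: add_divide_distrib)
        qed
        have eqs: "real n + shift = (a + 1) + (shift - of_int j - 1)" "real n = a + - of_int j"
            "real n + of_int (j + 1) = a + 1" "real (Suc n) + of_int j = a + 1"
          by (simp_all add: a_def)
        have "(real n + shift) * f (Suc n) - real n * f n =
            ((a + 1) + (shift - of_int j - 1)) / (a + 1) ^ e - (a + - of_int j) / a ^ e"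
          unfolding f_def eqs(1,4) a_def[symmetric] by (simp add: a_def)
        also have "\<dots> = (1 / (a + 1) ^ (e - 1) - 1 / a ^ (e - 1)) +
           ((shift - of_int j - 1) * (1 / (a + 1) ^ e) + of_int j * (1 / a ^ e))"
          using split[of "a + 1" "shift - of_int j - 1"] split[of a "- of_int j"] a by simp
        finally show ?case unfolding eqs(3) a_def[symmetric] .
      qed
    qed (auto simp: shift_def)
    \<comment> \<open>The difference of exponent \<open>e - 1\<close> is zero for
      \<open>e = 1\<close> and is covered by the induction on \<open>e\<close> otherwise.\<close>
    have 2: "summable_factor (\<lambda>n. 1 / (real n + of_int (j + 1)) ^ (e - 1) - 1 / (real n + of_int j) ^ (e - 1)) cs"
    proof (cases "e = 1")
      case True
      have "summable_factor (\<lambda>n. 0 * (1 / real n ^ 1)) cs"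
        using summable_factor_power[OF assms(2), of 1] order by (intro summable_factor_cmult) auto
      then show ?thesis by (simp add: True)
    next
      case False
      then show ?thesis using less by (intro summable_factor_diff less.IH) auto
    qed
    show ?thesis using summable_factor_diff[OF 1 2] by simp
  qed
  have isolate: "summable_factor g cs"
    if "summable_factor (\<lambda>n. x * g n + y * h n) cs" "summable_factor h cs" "x \<noteq> 0" "x \<in> \<rat>" "y \<in> \<rat>"
    for g h x y
  proof -
    have "summable_factor (\<lambda>n. 1 / x * ((x * g n + y * h n) - y * h n)) cs"
      using that by (intro summable_factor_cmult summable_factor_diff) auto
    then show ?thesis using that(3) by simp
  qed
  show ?case
  proof (induction j rule: int_induct[where k = 0])
    case base
    then show ?case using summable_factor_power[OF assms(2), of e] less.prems order by simp
  next
    case (step1 j)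
    have "shift - of_int j - 1 \<noteq> 0" using shift_bounds(3)[OF assms(1)] step1.hyps by simp
    then show ?case
      by (rule isolate[OF rel[of j] step1.IH]) (auto simp: shift_def intro!: Rats_diff Rats_divide)
  next
    case (step2 j)
    \<comment> \<open>Downwards the relation at \<open>j - 1\<close> is solved for its other term,
      whose factor \<open>j - 1\<close> is negative for \<open>j <= 0\<close>.\<close>
    have "summable_factor (\<lambda>n. of_int (j - 1) * (1 / (real n + of_int (j - 1)) ^ e) +
       (shift - of_int (j - 1) - 1) * (1 / (real n + of_int j) ^ e)) cs"
      using rel[of "j - 1"] by (simp add: add.commute)
    then show ?case
      by (rule isolate[OF _ step2.IH])
         (use step2.hyps in \<open>auto simp: shift_def intro!: Rats_diff Rats_divide\<close>)
  qed
qed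

text \<open>Here \<open>shift = 1\<close>. An extra factor \<open>1 / n\<close> in \<open>f\<close>
  cancels the \<open>n\<close> of the telescoping sequence, which then yields the difference of
  neighbouring shifts directly.\<close>

lemma summable_factor_shifted_diff:
  assumes "\<not> p < m" "\<forall>k\<in>set cs. k \<ge> 1" "e \<ge> 1"
    and IH: "\<And>c cs' f. cs = c # cs' \<Longrightarrow> partial_fraction 2 f \<Longrightarrow> summable_factor f cs'"
  shows "summable_factor (\<lambda>n. 1 / (real n + of_int j) ^ e - 1 / real n ^ e) cs"
proof -
  have order: "order_min = 2" using assms(1) by (simp add: order_min_def)
  have step: "summable_factor (\<lambda>n. 1 / (real n + of_int (j + 1)) ^ e - 1 / (real n + of_int j) ^ e) cs" for j
  proof -
    define f where "f = (\<lambda>n. 1 / (real n + of_int j) ^ e / real n)"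
    have "summable_factor (\<lambda>n. (real n + shift) * f (Suc n) - real n * f n) cs"
    proof (rule summable_factor_telescope[OF assms(2)])
      show "f n \<in> \<rat>" for n by (simp add: f_def)
      show "\<bar>real n ^ order_min * f n\<bar> \<le> 1 + \<bar>of_int j\<bar>" for n
        using abs_divide_add_int_power_le[OF assms(3), of n j]
        by (simp add: f_def order power2_eq_square)
      fix c cs' assume cs: "cs = c # cs'"
      then have c: "c \<ge> 1" using assms(2) by simp
      have "partial_fraction 1 (\<lambda>n. 1 / (real n + of_int j) ^ e)"
        using assms(3) by (intro partial_fraction.pow) auto
      then have "partial_fraction 2 (\<lambda>n. 1 / (real n + of_int j) ^ e / (real n + of_int 0) ^ c)"
        using c by (rule partial_fraction_divide_power(2))
      then have "partial_fraction 2 (\<lambda>n. real n * f n / real n ^ c)"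
      proof (rule partial_fraction.cong)
        show "real n * f n / real n ^ c \<in> \<rat>" for n by (simp add: f_def)
        show "\<forall>\<^sub>F n in sequentially.
            1 / (real n + of_int j) ^ e / (real n + of_int 0) ^ c = real n * f n / real n ^ c"
          using eventually_gt_at_top[of 0] by eventually_elim (simp add: f_def)
      qed
      then show "summable_factor (\<lambda>n. real n * f n / real n ^ c) cs'" by (rule IH[OF cs])
    qed
    then show ?thesis
    proof (rule summable_factor_cong)
      show "\<forall>\<^sub>F n in sequentially. (real n + shift) * f (Suc n) - real n * f n =
          1 / (real n + of_int (j + 1)) ^ e - 1 / (real n + of_int j) ^ e"
        using eventually_gt_at_top[of 0]
      proof eventually_elim
        case (elim n)
        have 1: "real n + shift = real (Suc n)" using shift_bounds(4)[OF assms(1)] by simp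
        have 2: "real (Suc n) + of_int j = real n + of_int (j + 1)" by simp
        show ?case unfolding f_def 1 2 using elim by (simp del: of_nat_Suc of_int_add)
      qed
    qed auto
  qed
  have zero: "summable_factor (\<lambda>n. 0) cs"
    using summable_factor_diff[OF step[of 0] step[of 0]] by simp
  show ?thesis
  proof (induction j rule: int_induct[where k = 0])
    case base
    then show ?case using zero by simp
  next
    case (step1 j)
    show ?case using summable_factor_add[OF step1.IH step[of j]] by simp
  next
    case (step2 j)
    show ?case using summable_factor_diff[OF step2.IH step[of "j - 1"]] by simp
  qed
qed

text \<open>Induction on the length of \<open>cs\<close>: telescoping leaves a series over the tail
  whose factor is again a partial fraction of the same class.\<close>

lemma summable_factor_partial_fraction:
  assumes "\<forall>k\<in>set cs. k \<ge> 1" "partial_fraction order_min f"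
  shows "summable_factor f cs"
  using assms
proof (induction cs arbitrary: f rule: length_induct)
  case (1 cs)
  note cs = 1(2) and f = 1(3)
  have IH: "summable_factor f cs'" if "cs = c # cs'" "partial_fraction order_min f" for c cs' f
    using 1(1)[rule_format, of cs' f] that cs by simp
  show ?case
  proof (cases "p < m")
    case True
    then have pow: "summable_factor (\<lambda>n. 1 / (real n + of_int j) ^ e) cs" if "e \<ge> 1" for e j
      using cs that IH by (intro summable_factor_shifted_power) (auto simp: order_min_def)
    show ?thesis
      by (rule summable_factor_partial_fraction_of_generators[OF f])
         (auto intro!: pow summable_factor_diff)
  next
    case False
    have diff: "summable_factor (\<lambda>n. 1 / (real n + of_int j) ^ e - 1 / real n ^ e) cs" if "e \<ge> 1" for e j
      using False cs that IH by (intro summable_factor_shifted_diff) (auto simp: order_min_def)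
    show ?thesis
    proof (rule summable_factor_partial_fraction_of_generators[OF f])
      fix e j assume "e \<ge> order_min" "e \<ge> (1::nat)"
      then show "summable_factor (\<lambda>n. 1 / (real n + of_int j) ^ e) cs"
        using summable_factor_add[OF diff[of e j] summable_factor_power[OF cs, of e]] by simp
    next
      fix e i j assume "e \<ge> (1::nat)"
      then show "summable_factor (\<lambda>n. 1 / (real n + of_int i) ^ e - 1 / (real n + of_int j) ^ e) cs"
        using summable_factor_diff[OF diff[of e i] diff[of e j]] by simp
    qed
  qed
qed

end

section \<open>Divergence and the main theorem\<close>

text \<open>Each of the \<open>D\<close> factors \<open>n\<close>, ..., \<open>n - D + 1\<close> is
  at least \<open>n / 2\<close>.\<close>

lemma fact_ratio_numerator_ge:
  assumes "n \<ge> 2 * D"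
  shows "fact n * inv_fact (int n - int D) \<ge> (real n / 2) ^ D"
  using assms
proof (induction D)
  case (Suc D)
  have "(real n / 2) ^ Suc D = (real n / 2) ^ D * (real n / 2)" by simp
  also have "\<dots> \<le> (fact n * inv_fact (int n - int D)) * of_int (int n - int D)"
    using Suc by (intro mult_mono) (auto intro: mult_nonneg_nonneg simp: inv_fact_def)
  also have "\<dots> = fact n * inv_fact (int n - int (Suc D))"
  proof -
    have "int n - int (Suc D) = int n - int D - 1" by simp
    then show ?thesis using inv_fact_pred[of "int n - int D"] by (simp only: mult.assoc)
  qed
  finally show ?case .
qed (simp add: inv_fact_def)

text \<open>The hypotheses force \<open>d <= 0\<close>. The constant \<open>1 / 2^(D + c)\<close>
  collects \<open>D\<close> numerator factors of at least \<open>n / 2\<close> and \<open>c\<close>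
  denominator factors of at most \<open>2 n\<close>.\<close>

lemma fact_ratio_eventually_ge:
  assumes "d + int c \<le> int k" "k \<le> c"
  shows "\<exists>C>0. eventually (\<lambda>n. real n ^ k * fact_ratio b c d n \<ge> C) sequentially"
proof -
  define D where "D = nat (- d)"
  have d: "d = - int D" "c \<le> k + D" using assms by (auto simp: D_def)
  have "eventually (\<lambda>n. real n ^ k * fact_ratio b c d n \<ge> 1 / 2 ^ (D + c)) sequentially"
    using eventually_ge_at_top[of "2 * D"] eventually_ge_at_top[of "nat \<bar>b\<bar>"]
      eventually_gt_at_top[of 0] eventually_add_int_pos[of b]
  proof eventually_elim
    case (elim n)
    have nb: "real n + of_int b \<le> 2 * real n" using elim(2) by linarith
    have "1 / 2 ^ (D + c) \<le> real n ^ (k + D - c) / 2 ^ (D + c)"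
      using elim(3) by (intro divide_right_mono) auto
    also have "\<dots> = (real n ^ k * (real n / 2) ^ D) / (2 * real n) ^ c"
    proof -
      have "real n ^ (k + D - c) * real n ^ c = real n ^ k * real n ^ D"
        using d(2) by (simp flip: power_add)
      then have "real n ^ (k + D - c) = real n ^ k * real n ^ D / real n ^ c"
        using elim(3) by (simp add: field_simps)
      then show ?thesis by (simp add: power_divide power_mult_distrib power_add)
    qed
    also have "\<dots> \<le> (real n ^ k * (fact n * inv_fact (int n - int D))) / (real n + of_int b) ^ c"
      using elim nb fact_ratio_numerator_ge[OF elim(1)]
      by (intro frac_le mult_left_mono power_mono zero_less_power)
         (auto intro!: mult_nonneg_nonneg simp: inv_fact_def)
    finally show ?case by (simp add: fact_ratio_def d)
  qed
  then show ?thesis by (intro exI[of _ "1 / 2 ^ (D + c)"]) auto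
qed

context root_sum
begin

lemma order_min_cases: "order_min = 1 \<or> order_min = 2"
  by (simp add: order_min_def)

text \<open>The lower bounds for \<open>coef\<close> and \<open>fact_ratio\<close> multiply to a
  constant times \<open>1 / n\<close>. The sequence \<open>S\<close> is arbitrary because the
  harmonic sum occurs both at \<open>n\<close> and at \<open>n + 1\<close>.\<close>

lemma not_summable_fact_ratio:
  assumes "c \<ge> 1" "d + int c < int order_min" "\<And>n. n \<ge> 1 \<Longrightarrow> S n \<ge> 1"
  shows "\<not> summable (\<lambda>n. coef n * fact_ratio b c d n * S n)"
proof
  assume sum: "summable (\<lambda>n. coef n * fact_ratio b c d n * S n)"
  let ?k = "order_min - 1"
  have k: "d + int c \<le> int ?k" "?k \<le> c" using assms by (auto simp: order_min_def)
  obtain C where C: "C > 0" "eventually (\<lambda>n. real n ^ ?k * fact_ratio b c d n \<ge> C) sequentially"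
    using fact_ratio_eventually_ge[OF k] by blast
  have "eventually (\<lambda>n. norm (shift * C * inverse (real n)) \<le> coef n * fact_ratio b c d n * S n) sequentially"
    using C(2) eventually_ge_at_top[of 1]
  proof eventually_elim
    case (elim n)
    have R: "fact_ratio b c d n \<ge> 0"
    proof (rule ccontr)
      assume "\<not> ?thesis"
      then have "real n ^ ?k * fact_ratio b c d n \<le> 0" by (simp add: mult_nonneg_nonpos)
      then show False using elim(1) C(1) by linarith
    qed
    have "shift * C * inverse (real n) \<le> shift * (real n ^ ?k * fact_ratio b c d n) * inverse (real n)"
      using elim shift_bounds by (intro mult_right_mono mult_left_mono) auto
    also have "\<dots> = shift * real n ^ ?k / real n * fact_ratio b c d n"
      by (simp add: field_simps)
    also have "\<dots> \<le> coef n * fact_ratio b c d n"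
      using coef_lower_bound[OF elim(2)] R by (intro mult_right_mono)
    also have "\<dots> \<le> coef n * fact_ratio b c d n * S n"
      using mult_left_mono[OF assms(3)[OF elim(2)], of "coef n * fact_ratio b c d n"] coef_pos[of n] R
      by simp
    finally show ?case using shift_bounds C by (simp add: abs_mult)
  qed
  then have "summable (\<lambda>n. shift * C * inverse (real n))"
    by (rule summable_comparison_test_ev[OF _ sum])
  then have "summable (\<lambda>n. inverse (real n))"
    using shift_bounds C by (subst (asm) summable_cmult_iff) auto
  then show False using not_summable_harmonic[where 'a = real] by simp
qed

text \<open>Serves the case \<open>q < -1\<close>, where an index shift leaves the harmonic sum at
  \<open>n + 1\<close>. Its last summand is split off, and the induction continues with the tail of
  the list.\<close>

lemma expressible_series_multi_harmonic_Suc: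
  assumes "p < m" "\<forall>k\<in>set cs. k \<ge> 1" "partial_fraction 1 f"
  shows "expressible_series (\<lambda>n. coef n * f n * multi_harmonic cs (Suc n))"
  using assms(2,3)
proof (induction cs arbitrary: f)
  case Nil
  then show ?case
    using summable_factor_partial_fraction[of "[]" f] assms(1)
    by (simp add: summable_factor_def order_min_def)
next
  case (Cons c cs)
  have 1: "expressible_series (\<lambda>n. coef n * f n * multi_harmonic (c # cs) n)"
    using summable_factor_partial_fraction[of "c # cs" f] assms(1) Cons.prems
    by (simp add: summable_factor_def order_min_def)
  have "partial_fraction 1 (\<lambda>n. f n / (real n + of_int 1) ^ c)"
    by (rule partial_fraction_divide_power(1)[OF Cons.prems(2)])
  then have 2: "expressible_series (\<lambda>n. coef n * (f n / (real n + of_int 1) ^ c) * multi_harmonic cs (Suc n))"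
    using Cons.prems by (intro Cons.IH) auto
  have eq: "coef n * f n * multi_harmonic (c # cs) (Suc n) = coef n * f n * multi_harmonic (c # cs) n +
      coef n * (f n / (real n + of_int 1) ^ c) * multi_harmonic cs (Suc n)" for n
    by (simp add: distrib_left add.commute)
  from expressible_series_add[OF 1 2] show ?case by (simp only: eq)
qed

end

section \<open>The three ranges of \<open>q\<close>\<close>

lemma pochhammer_summand_eq:
  assumes "pochhammer (1 / of_int q) n = x * fact n"
  shows "pochhammer_summand q c b d cs n = x * fact_ratio b c d n * multi_harmonic cs n"
  by (simp add: pochhammer_summand_def fact_ratio_def assms)

lemma pochhammer_rational: "x \<in> \<rat> \<Longrightarrow> pochhammer x n \<in> \<rat>" for x :: real
  by (induction n) (auto simp: pochhammer_Suc)

lemma pochhammer_summand_rational: "pochhammer_summand q c b d cs n \<in> \<rat>"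
  unfolding pochhammer_summand_def
  by (intro Rats_mult Rats_divide Rats_power pochhammer_rational multi_harmonic_rational
      inv_fact_rational) auto

theorem theorem1:
  fixes q b d :: int and c :: nat and cs :: "nat list"
  assumes "q \<noteq> 0" and "c \<ge> 1" and "\<forall>k\<in>set cs. k \<ge> 1"
    and "summable (\<lambda>n. pochhammer_summand q c b d cs (Suc n))"
  shows "(\<Sum>n. pochhammer_summand q c b d cs (Suc n)) \<in> cyclotomic_expressible"
proof -
  have "expressible_series (\<lambda>n. pochhammer_summand q c b d cs (Suc n))"
  proof (cases "q > 0")
    case True
    define m where "m = nat q"
    \<comment> \<open>The value \<open>q = 1\<close> gives \<open>p = m = 1\<close>, the case in
      which \<open>order_min\<close> is 2.\<close>
    interpret root_sum m 1
      using True by unfold_locales (auto simp: m_def)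
    have eq: "pochhammer_summand q c b d cs n = coef n * fact_ratio b c d n * multi_harmonic cs n" for n
    proof (rule pochhammer_summand_eq)
      have "real m = of_int q" using True by (simp add: m_def)
      then show "pochhammer (1 / of_int q) n = coef n * fact n"
        unfolding coef_def by simp
    qed
    have "summable (\<lambda>n. coef n * fact_ratio b c d n * multi_harmonic cs n)"
      using assms(4) unfolding eq[symmetric] by (rule iffD1[OF summable_Suc_iff])
    \<comment> \<open>Convergence is converted into the order of decay that the decomposition
      requires.\<close>
    then have "d + int c \<ge> int order_min"
      using not_summable_fact_ratio[OF assms(2), of d "multi_harmonic cs" b] multi_harmonic_ge_1
      by (meson not_le)
    then have "partial_fraction order_min (fact_ratio b c d)"
      by (rule partial_fraction_fact_ratio[OF assms(2) _ order_min_cases])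
    then have "summable_factor (fact_ratio b c d) cs"
      by (rule summable_factor_partial_fraction[OF assms(3)])
    then have "expressible_series (\<lambda>n. pochhammer_summand q c b d cs n)"
      unfolding summable_factor_def eq .
    then show ?thesis
      using expressible_series_Suc_iff[of "pochhammer_summand q c b d cs"] pochhammer_summand_rational by blast
  next
    case False
    show ?thesis
    proof (cases "q = -1")
      case True
      \<comment> \<open>From index 2 on, the Pochhammer symbol of -1 contains the factor
        zero.\<close>
      have zero: "pochhammer_summand q c b d cs (Suc (Suc n)) = 0" for n
        by (simp add: pochhammer_summand_def True pochhammer_rec)
      have "expressible_series (\<lambda>n. 0 :: real)"
        by (auto simp: expressible_series_def intro: cyclotomic_expressible.rational)
      then have "expressible_series (\<lambda>n. pochhammer_summand q c b d cs (Suc (Suc n)))" by (simp only: zero)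
      then show ?thesis
        using expressible_series_Suc_iff[of "\<lambda>n. pochhammer_summand q c b d cs (Suc n)"]
          pochhammer_summand_rational by blast
    next
      case False
      define m where "m = nat (- q)"
      have q: "q = - int m" "m \<ge> 2" using False \<open>\<not> q > 0\<close> assms(1) by (auto simp: m_def)
      \<comment> \<open>The numerator \<open>m - 1\<close> comes from
        \<open>1 + 1/q = (m - 1)/m\<close>.\<close>
      interpret root_sum m "m - 1"
        using q by unfold_locales auto
      define x where "x = 1 / real_of_int q"
      have x: "x \<noteq> 0" "x \<in> \<rat>" "x + 1 = real (m - 1) / real m"
        using q by (auto simp: x_def field_simps of_nat_diff)
      \<comment> \<open>Pulling out the first Pochhammer factor advances the index by one, which
        raises \<open>b\<close>, \<open>d\<close> and the argument of the harmonic sum by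
        one.\<close>
      have eq: "pochhammer_summand q c b d cs (Suc n) =
          x * (coef n * fact_ratio (b + 1) c (d + 1) n * multi_harmonic cs (Suc n))" for n
      proof -
        have "pochhammer (1 / of_int q) (Suc n) = x * (coef n * fact n)"
          unfolding x_def[symmetric] pochhammer_rec coef_def x(3) by simp
        then show ?thesis by (simp add: pochhammer_summand_def fact_ratio_def add_ac)
      qed
      have "summable (\<lambda>n. coef n * fact_ratio (b + 1) c (d + 1) n * multi_harmonic cs (Suc n))"
        using assms(4) x(1) unfolding eq by (subst (asm) summable_cmult_iff) simp
      moreover have "multi_harmonic cs (Suc n) \<ge> 1" for n by (rule multi_harmonic_ge_1) simp
      ultimately have "(d + 1) + int c \<ge> int order_min"
        using not_summable_fact_ratio[OF assms(2), of "d + 1" "\<lambda>n. multi_harmonic cs (Suc n)" "b + 1"]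
        by (meson not_le)
      moreover have "order_min = 1" unfolding order_min_def using q by simp
      ultimately have "partial_fraction 1 (fact_ratio (b + 1) c (d + 1))"
        by (intro partial_fraction_fact_ratio[OF assms(2)]) simp_all
      then have "expressible_series (\<lambda>n. coef n * fact_ratio (b + 1) c (d + 1) n * multi_harmonic cs (Suc n))"
        using q assms(3) by (intro expressible_series_multi_harmonic_Suc) auto
      then show ?thesis unfolding eq using x by (intro expressible_series_cmult)
    qed
  qed
  then show ?thesis by (simp add: expressible_series_def)
qed

end
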